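(* Up to isomorphism, there are precisely two graphs having valency-array $(18,9,9;24,14,8)$ and spectrum $\{[20]^1,[2]^{17},[-3]^{18}\}$.
   Context: All graphs are finite and simple. The valency-array $(n_1,\dots,n_r;k_1,\dots,k_r)$ of a graph with distinct valencies (degrees) $k_1>\dots>k_r$ records that exactly $n_i$ vertices have valency $k_i$ for each $i$ (and there are no other vertices). The spectrum is that of the adjacency matrix, where $[\theta]^m$ means that $\theta$ is an eigenvalue with multiplicity $m$. *)

theory Defs
  imports
    "Graph_Theory.Pair_Digraph"
    "Graph_Theory.Digraph_Isomorphism"
    "Jordan_Normal_Form.Char_Poly"
begin

text \<open>
  A finite simple graph is a \<^locale>\<open>pair_graph\<close>: a finite, loopless, symmetric digraph
  whose arcs are pairs of vertices.  Every edge is thus represented by its two opposite arcs,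
  so the valency of a vertex is its \<^const>\<open>out_degree\<close>, and graph isomorphism is
  \<^const>\<open>digraph_iso\<close> via the coercion \<^const>\<open>with_proj\<close>.
\<close>

text \<open>The image condition says that the entries of \<open>ks\<close> are exactly the valencies that occur.\<close>

definition has_valency_array :: "'a pair_pre_digraph \<Rightarrow> nat list \<Rightarrow> nat list \<Rightarrow> bool" where
  "has_valency_array G ns ks \<longleftrightarrow>
     length ns = length ks \<and> sorted_wrt (>) ks \<and>
     out_degree (with_proj G) ` pverts G = set ks \<and>
     (\<forall>i < length ks. card {v \<in> pverts G. out_degree (with_proj G) v = ks ! i} = ns ! i)"

definition adjacency_mat :: "'a pair_pre_digraph \<Rightarrow> 'a list \<Rightarrow> real mat" where
  "adjacency_mat G vs =
     mat (length vs) (length vs) (\<lambda>(i, j). if (vs ! i, vs ! j) \<in> parcs G then 1 else 0)"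

text \<open>
  The eigenvalues with their multiplicities as roots of the characteristic polynomial.
  The adjacency matrix is real symmetric, so all its eigenvalues are real, and algebraic and
  geometric multiplicities agree.  The choice of the enumeration of the vertices is immaterial;
  see \<open>graph_spectrum_eq\<close> below.
\<close>

definition graph_spectrum :: "'a pair_pre_digraph \<Rightarrow> real multiset" where
  "graph_spectrum G =
     proots (char_poly (adjacency_mat G (SOME vs. distinct vs \<and> set vs = pverts G)))"

lemma char_poly_adjacency_mat_cong:
  assumes "distinct vs" "distinct ws" "set vs = set ws"
  shows "char_poly (adjacency_mat G vs) = char_poly (adjacency_mat G ws)"
proof -
  define n where "n = length ws"
  have "mset vs = mset ws"
    using assms by (simp add: set_eq_iff_mset_eq_distinct)
  then obtain p where p: "p permutes {..<n}" and vs: "permute_list p ws = vs"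
    unfolding n_def by (rule mset_eq_permutation)
  have len: "length vs = n"
    using vs n_def by auto
  have nth: "vs ! i = ws ! p i" if "i < n" for i
    using vs p that permute_list_nth[of p ws i] by (simp add: n_def)
  have p': "p permutes {0..<n}"
    using p by (simp add: atLeast0LessThan)
  have less: "p i < n" if "i < n" for i
    using permutes_in_image[OF p] that by simp
  have inj: "p i = p j \<longleftrightarrow> i = j" for i j
    using permutes_inj[OF p] by (simp add: inj_eq)
  define B where "B = char_poly_matrix (adjacency_mat G ws)"
  define C where "C = mat n n (\<lambda>(i, j). B $$ (p i, j))"
  have B: "B \<in> carrier_mat n n"
    by (simp add: B_def adjacency_mat_def char_poly_matrix_def n_def)
  have C: "C \<in> carrier_mat n n"
    by (simp add: C_def)
  have "char_poly_matrix (adjacency_mat G vs) = mat n n (\<lambda>(i, j). C $$ (i, p j))"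
    by (rule eq_matI)
       (auto simp: char_poly_matrix_def adjacency_mat_def B_def C_def len nth less inj
          n_def[symmetric])
  also have "\<dots> = transpose_mat (mat n n (\<lambda>(i, j). transpose_mat C $$ (p i, j)))"
    using less by (intro eq_matI) (auto simp: C_def)
  also have "det \<dots> = signof p * det (transpose_mat C)"
    using C det_permute_rows[OF _ p', of "transpose_mat C"]
    by (subst det_transpose[where n = n]) auto
  also have "det (transpose_mat C) = signof p * det B"
    using det_transpose[OF C] det_permute_rows[OF B p'] by (simp add: C_def)
  also have "signof p * (signof p * det B) = det B"
    by (simp add: sign_def)
  finally show ?thesis
    by (simp add: char_poly_def B_def)
qed

lemma graph_spectrum_eq:
  assumes "distinct vs" "set vs = pverts G"
  shows "graph_spectrum G = proots (char_poly (adjacency_mat G vs))"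
proof -
  let ?P = "\<lambda>ws. distinct ws \<and> set ws = pverts G"
  have "?P (SOME ws. ?P ws)"
    by (rule someI[of ?P vs]) (use assms in simp)
  then have "char_poly (adjacency_mat G (SOME ws. ?P ws)) = char_poly (adjacency_mat G vs)"
    using assms by (intro char_poly_adjacency_mat_cong) auto
  then show ?thesis
    by (simp add: graph_spectrum_def)
qed

end

theory Submission
  imports Defs "Jordan_Normal_Form.Schur_Decomposition" "HOL-Analysis.Convex"
begin

text \<open>
  The spectrum forces A^2 + A - 6 I to be 2 c c^T, where c takes the values 3, 2, 1 on the vertices
  of valency 24, 14, 8. Entrywise this counts the common neighbours of any two vertices, so that the
  adjacencies between the 18 vertices of valency 24 and the 18 others form an incidence structure from
  which the whole graph can be recovered. Each of the two sides splits into cycles; the incidence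
  between two cycles is a circulant pattern. Either all cycles of the first side are triangles or there are
  hexagons, and in each case the patterns are determined up to relabelling. The two resulting graphs are told
  apart by their subgraphs on the vertices of valency 8: adjacency or equality is transitive in one of them only.
\<close>

text \<open>Towards valency 8 adjacency is kept, towards valency 14 it is complemented, and on the
  first side non-adjacency replaces adjacency; in this way both sides become graphs of valency two,
  with six incidences at every vertex. If R and S are these graphs and N is the incidence matrix,
  the counts become N N^T = 2 J + (2 - R)(3 + R) and R N = N S. As 2 - R kills the indicator vector
  of a union of cycles, every block contains exactly a third of such a union, and all cycle lengths
  are multiples of 3. The second equation is a discrete wave equation for the incidence between two
  cycles. It has solutions that are not circulant, so an odd period or disjointness at distance 3
  has to be brought in. The main obstacle is a cycle of length nine, which would fill a whole
  valency class of blocks; it is excluded by comparing correlations of 3-subsets of Z/9. The other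
  difficulty is orientation: reversing cycles normalises it only along a spanning tree of the pairs
  of cycles, and the remaining pairs are settled by finite searches.\<close>

section \<open>Traces, triangular forms and quadratic polynomials of matrices\<close>

definition mat_trace :: "'a :: comm_ring_1 mat \<Rightarrow> 'a" where
  "mat_trace A = (\<Sum>i<dim_row A. A $$ (i, i))"

lemma mat_trace_mult_comm:
  assumes "A \<in> carrier_mat n m" "B \<in> carrier_mat m n"
  shows "mat_trace (A * B) = mat_trace (B * A)"
proof -
  have "mat_trace (A * B) = (\<Sum>i<n. \<Sum>k<m. A $$ (i, k) * B $$ (k, i))"
    using assms by (simp add: mat_trace_def scalar_prod_def atLeast0LessThan)
  also have "\<dots> = (\<Sum>k<m. \<Sum>i<n. B $$ (k, i) * A $$ (i, k))"
    by (subst sum.swap) (simp add: mult.commute)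
  also have "\<dots> = mat_trace (B * A)"
    using assms by (simp add: mat_trace_def scalar_prod_def atLeast0LessThan)
  finally show ?thesis .
qed

lemma mat_trace_similar:
  fixes A :: "'a :: comm_ring_1 mat"
  assumes "similar_mat_wit A T P Q"
  shows "mat_trace A = mat_trace T"
proof -
  define n where "n = dim_row A"
  note D = similar_mat_witD[OF n_def assms]
  have "mat_trace A = mat_trace (P * T * Q)"
    by (simp only: D(3)[symmetric])
  also have "\<dots> = mat_trace (Q * (P * T))"
    using D(5-7) by (intro mat_trace_mult_comm[of _ n n]) auto
  also have "Q * (P * T) = (Q * P) * T"
    using D(4-7) by (intro assoc_mult_mat[symmetric]) auto
  also have "\<dots> = T" using D(5) by (simp add: D(2))
  finally show ?thesis .
qed

text \<open>The same pair \<open>P\<close>, \<open>Q\<close> serves for the product. Together with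
  \<open>similar_mat_wit_lincomb\<close> this conjugates every polynomial in \<open>A\<close> to the
  same polynomial in a triangular \<open>T\<close>.\<close>

lemma similar_mat_wit_mult:
  fixes A :: "'a :: comm_ring_1 mat"
  assumes "similar_mat_wit A T P Q" "similar_mat_wit B U P Q" "A \<in> carrier_mat n n"
  shows "similar_mat_wit (A * B) (T * U) P Q"
proof -
  note D = similar_mat_witD2[OF assms(3,1)]
  have "B \<in> carrier_mat n n"
    using D similar_mat_witD[OF refl assms(2)] by (metis carrier_matD(2) carrier_matI index_one_mat(2))
  note E = similar_mat_witD2[OF this assms(2)]
  have 1: "P * T \<in> carrier_mat n n" "U * Q \<in> carrier_mat n n" using D E by auto
  have "A * B = (P * T * Q) * (P * (U * Q))"
    using D E by (simp add: assoc_mult_mat[of P n n U n Q n])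
  also have "\<dots> = P * T * (Q * (P * (U * Q)))"
    using 1 D E by (intro assoc_mult_mat) auto
  also have "Q * (P * (U * Q)) = Q * P * (U * Q)"
    using 1 D E by (intro assoc_mult_mat[symmetric]) auto
  also have "\<dots> = U * Q" using left_mult_one_mat[OF 1(2)] by (simp only: D(2))
  also have "P * T * (U * Q) = P * (T * U) * Q"
    using 1 D E by (smt (verit) assoc_mult_mat mult_carrier_mat)
  finally show ?thesis
    using D E by (intro similar_mat_witI[where n = n]) auto
qed

lemma similar_mat_wit_lincomb:
  fixes A :: "'a :: comm_ring_1 mat"
  assumes "similar_mat_wit A T P Q" "similar_mat_wit B U P Q" "A \<in> carrier_mat n n"
  shows "similar_mat_wit (A + c \<cdot>\<^sub>m B) (T + c \<cdot>\<^sub>m U) P Q"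
proof -
  note D = similar_mat_witD2[OF assms(3,1)]
  have "B \<in> carrier_mat n n"
    using D similar_mat_witD[OF refl assms(2)] by (metis carrier_matD(2) carrier_matI index_one_mat(2))
  note E = similar_mat_witD2[OF this assms(2)]
  have "P * (T + c \<cdot>\<^sub>m U) * Q = (P * T + c \<cdot>\<^sub>m (P * U)) * Q"
    using D E by (simp add: mult_add_distrib_mat[of P n n] mult_smult_distrib[of P n n])
  also have "\<dots> = P * T * Q + c \<cdot>\<^sub>m (P * U) * Q"
    using D E by (intro add_mult_distrib_mat[of _ n n]) auto
  also have "c \<cdot>\<^sub>m (P * U) * Q = c \<cdot>\<^sub>m (P * U * Q)"
    using D E by (intro mult_smult_assoc_mat[of _ n n]) auto
  also have "P * T * Q + c \<cdot>\<^sub>m (P * U * Q) = A + c \<cdot>\<^sub>m B"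
    using D E by simp
  finally show ?thesis
    using D E by (intro similar_mat_witI[where n = n]) auto
qed

lemma similar_mat_wit_one:
  fixes A :: "'a :: comm_ring_1 mat"
  assumes "similar_mat_wit A T P Q" "A \<in> carrier_mat n n"
  shows "similar_mat_wit (1\<^sub>m n) (1\<^sub>m n) P Q"
  using similar_mat_witD2[OF assms(2,1)] by (intro similar_mat_witI[where n = n]) auto

text \<open>Restricting to \<open>j\<close> at most \<open>i\<close> covers two facts at once: the
  zeros below the diagonal and the multiplicativity of the diagonal.\<close>

lemma upper_triangular_mult_index:
  fixes A :: "'a :: comm_ring_1 mat"
  assumes "upper_triangular A" "upper_triangular B" "A \<in> carrier_mat n n" "B \<in> carrier_mat n n"
    and "i < n" "j \<le> i"
  shows "(A * B) $$ (i, j) = (if i = j then A $$ (i, i) * B $$ (i, i) else 0)"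
proof -
  have "(A * B) $$ (i, j) = (\<Sum>k<n. A $$ (i, k) * B $$ (k, j))"
    using assms by (simp add: scalar_prod_def atLeast0LessThan)
  also have "\<dots> = (\<Sum>k<n. if k = i then if i = j then A $$ (i, i) * B $$ (i, i) else 0 else 0)"
  proof (rule sum.cong[OF refl])
    fix k assume "k \<in> {..<n}"
    then consider "k < i" | "k = i" | "i < k" "k < n" by fastforce
    then show "A $$ (i, k) * B $$ (k, j) =
      (if k = i then if i = j then A $$ (i, i) * B $$ (i, i) else 0 else 0)"
    proof cases
      case 1
      then have "A $$ (i, k) = 0" using assms by (intro upper_triangularD) auto
      with 1 show ?thesis by simp
    next
      case 2
      have "j < i \<Longrightarrow> B $$ (i, j) = 0" using assms by (intro upper_triangularD) auto
      with 2 assms show ?thesis by (cases "j = i") auto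
    next
      case 3
      then have "B $$ (k, j) = 0" using assms by (intro upper_triangularD) auto
      with 3 show ?thesis by simp
    qed
  qed
  also have "\<dots> = (if i = j then A $$ (i, i) * B $$ (i, i) else 0)"
    using assms by simp
  finally show ?thesis .
qed

lemma upper_triangular_mult:
  fixes A :: "'a :: comm_ring_1 mat"
  assumes "upper_triangular A" "upper_triangular B" "A \<in> carrier_mat n n" "B \<in> carrier_mat n n"
  shows "upper_triangular (A * B)"
  using assms by (intro upper_triangularI) (simp add: upper_triangular_mult_index[where n = n] del: index_mult_mat(1))

lemma upper_triangular_lincomb:
  fixes A :: "'a :: comm_ring_1 mat"
  assumes "upper_triangular A" "upper_triangular B" "A \<in> carrier_mat n n" "B \<in> carrier_mat n n"
  shows "upper_triangular (A + c \<cdot>\<^sub>m B)"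
  using assms by (intro upper_triangularI) (auto simp: upper_triangularD)

text \<open>The Schur decomposition only needs a split characteristic polynomial. The general field
  permits its use over the reals, where the spectrum is given, and over the complex numbers, where
  it is to be found.\<close>

lemma triangularize:
  fixes A :: "'a :: conjugatable_ordered_field mat"
  assumes "A \<in> carrier_mat n n" "char_poly A = (\<Prod>a\<leftarrow>es. [:- a, 1:])"
  obtains T P Q where "similar_mat_wit A T P Q" "upper_triangular T" "diag_mat T = es"
    "T \<in> carrier_mat n n"
proof -
  obtain T P Q where "schur_decomposition A es = (T, P, Q)"
    by (cases "schur_decomposition A es")
  note dec = schur_decomposition[OF assms this]
  show ?thesis
    by (rule that[of T P Q]) (use dec similar_mat_witD2(5)[OF assms(1)] in auto)
qed

text \<open>In general \<open>proots\<close> sees only the linear factors; as many roots as the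
  degree leave no room for a factor without roots.\<close>

lemma poly_split_of_proots:
  fixes p :: "'a :: field poly"
  assumes "proots p = mset es" "length es = degree p" "p \<noteq> 0"
  shows "p = Polynomial.smult (lead_coeff p) (\<Prod>a\<leftarrow>es. [:- a, 1:])"
  using assms
proof (induction es arbitrary: p)
  case Nil
  then show ?case by (auto elim!: degree_eq_zeroE)
next
  case (Cons a es)
  have "poly p a = 0"
    using Cons.prems by (metis list.set_intros(1) mem_Collect_eq set_count_proots set_mset_mset)
  then obtain q where q: "p = [:- a, 1:] * q"
    by (auto simp: poly_eq_0_iff_dvd dvd_def)
  have nz: "q \<noteq> 0" using q Cons.prems by auto
  have "proots p = {#a#} + proots q"
    unfolding q using nz by (subst proots_mult) auto
  then have "proots q = mset es" using Cons.prems by simp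
  moreover have "degree p = Suc (degree q)"
    unfolding q using nz by (subst degree_mult_eq) auto
  ultimately have "q = Polynomial.smult (lead_coeff q) (\<Prod>a\<leftarrow>es. [:- a, 1:])"
    using Cons nz by auto
  moreover have "lead_coeff p = lead_coeff q"
    unfolding q by (simp only: lead_coeff_mult) simp
  ultimately show ?case
    by (metis (no_types, lifting) list.simps(9) mult_smult_right prod_list.Cons q)
qed

lemma char_poly_split_of_proots:
  fixes A :: "'a :: field mat"
  assumes "A \<in> carrier_mat n n" "proots (char_poly A) = mset es" "length es = n"
  shows "char_poly A = (\<Prod>a\<leftarrow>es. [:- a, 1:])"
proof -
  have "degree (char_poly A) = n" "monic (char_poly A)"
    using degree_monic_char_poly[OF assms(1)] by auto
  then show ?thesis
    using poly_split_of_proots[OF assms(2)] assms(3) by (metis leading_coeff_0_iff smult_1_left zero_neq_one)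
qed

lemma diag_mat_quadratic:
  fixes T :: "'a :: comm_ring_1 mat"
  assumes "upper_triangular T" "T \<in> carrier_mat n n" "i < n"
  shows "(T * T + c \<cdot>\<^sub>m T) $$ (i, i) = T $$ (i, i) ^ 2 + c * T $$ (i, i)"
  using assms by (simp add: upper_triangular_mult_index power2_eq_square del: index_mult_mat(1))

lemma mat_trace_quadratic_eq_sum_list:
  fixes A :: "'a :: conjugatable_ordered_field mat"
  assumes "A \<in> carrier_mat n n" "char_poly A = (\<Prod>a\<leftarrow>es. [:- a, 1:])"
  shows "mat_trace (A * A + c \<cdot>\<^sub>m A) = (\<Sum>a\<leftarrow>es. a\<^sup>2 + c * a)"
proof -
  obtain T P Q where T: "similar_mat_wit A T P Q" "upper_triangular T" "diag_mat T = es"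
    "T \<in> carrier_mat n n"
    using triangularize[OF assms] .
  have "mat_trace (A * A + c \<cdot>\<^sub>m A) = mat_trace (T * T + c \<cdot>\<^sub>m T)"
    using assms T by (intro mat_trace_similar[where P = P and Q = Q] similar_mat_wit_lincomb
        similar_mat_wit_mult) auto
  also have "\<dots> = (\<Sum>i<n. T $$ (i, i) ^ 2 + c * T $$ (i, i))"
    using T by (auto simp: mat_trace_def diag_mat_quadratic simp del: index_mult_mat(1) index_add_mat(1))
  also have "\<dots> = (\<Sum>a\<leftarrow>es. a\<^sup>2 + c * a)"
    using T by (auto simp: diag_mat_def sum_list_sum_nth atLeast0LessThan)
  finally show ?thesis .
qed

text \<open>For symmetric \<open>K\<close> the trace of \<open>K * K\<close> is the sum of the
  squares of all entries.\<close>

lemma symmetric_mat_square_trace_zero: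
  fixes K :: "real mat"
  assumes "K \<in> carrier_mat n n" "transpose_mat K = K" "mat_trace (K * K) = 0"
  shows "K = 0\<^sub>m n n"
proof -
  have sym: "K $$ (j, i) = K $$ (i, j)" if "i < n" "j < n" for i j
    using assms(1,2) that by (metis carrier_matD index_transpose_mat(1))
  have "mat_trace (K * K) = (\<Sum>i<n. \<Sum>j<n. (K $$ (i, j))\<^sup>2)"
    using assms(1) sym by (simp add: mat_trace_def scalar_prod_def atLeast0LessThan power2_eq_square)
  then have "\<forall>i<n. \<forall>j<n. (K $$ (i, j))\<^sup>2 = 0"
    using assms(3) by (simp add: sum_nonneg_eq_0_iff sum_nonneg)
  then show ?thesis using assms(1) by (intro eq_matI) auto
qed

text \<open>If \<open>x\<^sup>2 + b x + c\<close> vanishes at all eigenvalues but one, simple one, where it takes the value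
  \<open>d\<close>, then \<open>(A\<^sup>2 + b A + c) / d\<close> is an orthogonal projection of trace one, so its rank is one
  and its \<open>2 \<times> 2\<close> minors vanish.\<close>

lemma symmetric_quadratic_minors:
  fixes A :: "real mat"
  assumes A: "A \<in> carrier_mat n n" "transpose_mat A = A"
    and char: "char_poly A = (\<Prod>a\<leftarrow>es. [:- a, 1:])"
    and val: "\<And>a. a \<in> set es \<Longrightarrow> a\<^sup>2 + b * a + c \<in> {0, d}" "(\<Sum>a\<leftarrow>es. a\<^sup>2 + b * a + c) = d" "d > 0"
    and M_def: "M = A * A + b \<cdot>\<^sub>m A + c \<cdot>\<^sub>m 1\<^sub>m n"
    and ij: "i < n" "j < n"
  shows "(M $$ (i, j))\<^sup>2 = M $$ (i, i) * M $$ (j, j)"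
proof -
  obtain T P Q where T: "similar_mat_wit A T P Q" "upper_triangular T" "diag_mat T = es"
    "T \<in> carrier_mat n n"
    using triangularize[OF A(1) char] .
  define U where "U = T * T + b \<cdot>\<^sub>m T + c \<cdot>\<^sub>m 1\<^sub>m n"
  \<comment> \<open>The aim is \<open>K = 0\<close>, reached without diagonalising: \<open>L\<close>
    is triangular with zero diagonal, hence so is \<open>L * L\<close>, and the symmetric
    \<open>K\<close>, being similar to \<open>L\<close>, vanishes because the trace of its square
    does.\<close>
  define L where "L = U * U + (- d) \<cdot>\<^sub>m U"
  define K where "K = M * M + (- d) \<cdot>\<^sub>m M"
  have carr: "M \<in> carrier_mat n n" "K \<in> carrier_mat n n" "U \<in> carrier_mat n n" "L \<in> carrier_mat n n"
    using A T by (auto simp: M_def K_def U_def L_def)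
  have simM: "similar_mat_wit M U P Q"
    unfolding M_def U_def using A T
    by (intro similar_mat_wit_lincomb[where n = n] similar_mat_wit_mult[where n = n] similar_mat_wit_one) auto
  have simK: "similar_mat_wit K L P Q"
    unfolding K_def L_def using carr simM
    by (intro similar_mat_wit_lincomb[where n = n] similar_mat_wit_mult[where n = n]) auto
  have triU: "upper_triangular U"
    unfolding U_def using T
    by (intro upper_triangular_lincomb[where n = n] upper_triangular_mult[where n = n]) auto
  have Uii: "U $$ (i, i) = (es ! i)\<^sup>2 + b * es ! i + c" if "i < n" for i
    using T that diag_mat_quadratic[OF T(2,4) that, of b]
    by (auto simp: U_def diag_mat_def simp del: index_mult_mat(1))
  have len: "length es = n" using T by (auto simp: diag_mat_def)
  have "mat_trace M = (\<Sum>i<n. U $$ (i, i))"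
    using mat_trace_similar[OF simM] carr by (simp add: mat_trace_def)
  also have "\<dots> = d" using Uii len val(2) by (simp add: sum_list_sum_nth atLeast0LessThan)
  finally have trM: "mat_trace M = d" .
  have Lii: "L $$ (i, i) = 0" if "i < n" for i
  proof -
    have "U $$ (i, i) \<in> {0, d}" using Uii[OF that] val(1)[of "es ! i"] len that by simp
    then show ?thesis unfolding L_def using carr triU that
      by (subst diag_mat_quadratic[where n = n]) (auto simp: power2_eq_square)
  qed
  have triL: "upper_triangular L"
    unfolding L_def using carr triU
    by (intro upper_triangular_lincomb[where n = n] upper_triangular_mult[where n = n]) auto
  have "mat_trace (K * K) = mat_trace (L * L)"
    using simK carr by (intro mat_trace_similar similar_mat_wit_mult) auto
  also have "\<dots> = (\<Sum>i<n. (L * L) $$ (i, i))" using carr by (simp add: mat_trace_def)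
  also have "\<dots> = 0"
    using carr triL Lii by (intro sum.neutral) (simp add: upper_triangular_mult_index del: index_mult_mat(1))
  finally have trK: "mat_trace (K * K) = 0" .
  have smult_transpose: "transpose_mat (e \<cdot>\<^sub>m X) = e \<cdot>\<^sub>m transpose_mat X" for e and X :: "real mat"
    by (rule eq_matI) auto
  have symM: "transpose_mat M = M"
    unfolding M_def using A by (simp add: transpose_add[where nr = n and nc = n] transpose_mult[of _ n n] smult_transpose)
  have symK: "transpose_mat K = K"
    unfolding K_def using carr symM by (simp add: transpose_add[where nr = n and nc = n] transpose_mult[of _ n n] smult_transpose)
  have "K = 0\<^sub>m n n"
    by (rule symmetric_mat_square_trace_zero[OF carr(2) symK trK])
  then have "(M * M + (- d) \<cdot>\<^sub>m M) $$ (i, j) = 0" if "i < n" "j < n" for i j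
    using that by (simp add: K_def)
  then have MM: "(\<Sum>k<n. M $$ (i, k) * M $$ (k, j)) = d * M $$ (i, j)" if "i < n" "j < n" for i j
    using that carr by (simp add: scalar_prod_def atLeast0LessThan)
  have sym: "M $$ (j, i) = M $$ (i, j)" if "i < n" "j < n" for i j
    using carr symM that by (metis carrier_matD index_transpose_mat(1))
  \<comment> \<open>The Gram matrix of the rows of \<open>M\<close> is \<open>d\<close> times
    \<open>M\<close>, so Cauchy-Schwarz becomes an inequality between entries of
    \<open>M\<close>.\<close>
  have gram: "(\<Sum>k<n. M $$ (i, k) * M $$ (j, k)) = d * M $$ (i, j)" if "i < n" "j < n" for i j
    using MM[OF that] that by (auto simp: sym)
  have le: "(M $$ (i, j))\<^sup>2 \<le> M $$ (i, i) * M $$ (j, j)" if "i < n" "j < n" for i j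
  proof -
    have "(\<Sum>k<n. M $$ (i, k) * M $$ (j, k))\<^sup>2 \<le> (\<Sum>k<n. (M $$ (i, k))\<^sup>2) * (\<Sum>k<n. (M $$ (j, k))\<^sup>2)"
      by (rule Cauchy_Schwarz_ineq_sum)
    then have "(d * M $$ (i, j))\<^sup>2 \<le> (d * M $$ (i, i)) * (d * M $$ (j, j))"
      using that by (simp add: gram power2_eq_square)
    then have "d\<^sup>2 * (M $$ (i, j))\<^sup>2 \<le> d\<^sup>2 * (M $$ (i, i) * M $$ (j, j))"
      by (simp add: power2_eq_square algebra_simps)
    then show ?thesis using val(3) by simp
  qed
  \<comment> \<open>The nonnegative defects of these inequalities add up to (tr M)^2 - d tr M = d^2
    - d^2 = 0, so each of them is zero.\<close>
  have "(\<Sum>i<n. \<Sum>j<n. M $$ (i, i) * M $$ (j, j) - (M $$ (i, j))\<^sup>2)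
      = (\<Sum>i<n. M $$ (i, i)) * (\<Sum>j<n. M $$ (j, j)) - (\<Sum>i<n. \<Sum>j<n. (M $$ (i, j))\<^sup>2)"
    by (simp add: sum_subtractf sum_product)
  also have "(\<Sum>i<n. \<Sum>j<n. (M $$ (i, j))\<^sup>2) = (\<Sum>i<n. d * M $$ (i, i))"
    using gram by (intro sum.cong) (auto simp: power2_eq_square)
  also have "(\<Sum>i<n. M $$ (i, i)) = d" using trM carr by (simp add: mat_trace_def)
  also have "(\<Sum>i<n. d * M $$ (i, i)) = d * d"
    using trM carr by (simp add: mat_trace_def sum_distrib_left[symmetric])
  finally have "(\<Sum>i<n. \<Sum>j<n. M $$ (i, i) * M $$ (j, j) - (M $$ (i, j))\<^sup>2) = 0"
    by simp
  then have "(\<Sum>j<n. M $$ (i, i) * M $$ (j, j) - (M $$ (i, j))\<^sup>2) = 0"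
    using le ij by (subst (asm) sum_nonneg_eq_0_iff) (auto intro!: sum_nonneg)
  then have "M $$ (i, i) * M $$ (j, j) - (M $$ (i, j))\<^sup>2 = 0"
    using le ij by (subst (asm) sum_nonneg_eq_0_iff) auto
  then show ?thesis by simp
qed

text \<open>Polynomials in the triangular \<open>T\<close> act separately on each diagonal entry,
  and a matrix similar to zero is zero; so the annihilating cubic vanishes at every diagonal entry
  of \<open>T\<close>, that is, at every root.\<close>

lemma char_poly_roots_of_annihilator:
  fixes A :: "'a :: conjugatable_ordered_field mat"
  assumes A: "A \<in> carrier_mat n n" and char: "char_poly A = (\<Prod>a\<leftarrow>es. [:- a, 1:])"
    and ann: "(A * A + b \<cdot>\<^sub>m A + c \<cdot>\<^sub>m 1\<^sub>m n) * (A + (- e) \<cdot>\<^sub>m 1\<^sub>m n) = 0\<^sub>m n n"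
    and a: "a \<in> set es"
  shows "(a\<^sup>2 + b * a + c) * (a - e) = 0"
proof -
  obtain T P Q where T: "similar_mat_wit A T P Q" "upper_triangular T" "diag_mat T = es"
    "T \<in> carrier_mat n n"
    using triangularize[OF A char] .
  define U where "U = T * T + b \<cdot>\<^sub>m T + c \<cdot>\<^sub>m 1\<^sub>m n"
  define W where "W = T + (- e) \<cdot>\<^sub>m 1\<^sub>m n"
  have carr: "U \<in> carrier_mat n n" "W \<in> carrier_mat n n" using T by (auto simp: U_def W_def)
  have tri: "upper_triangular U" "upper_triangular W"
    unfolding U_def W_def using T
    by (auto intro!: upper_triangular_lincomb[where n = n] upper_triangular_mult[where n = n])
  have "similar_mat_wit (0\<^sub>m n n) (U * W) P Q"
    unfolding ann[symmetric] U_def W_def using A T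
    by (intro similar_mat_wit_lincomb[where n = n] similar_mat_wit_mult[where n = n] similar_mat_wit_one) auto
  then have "similar_mat_wit (U * W) (0\<^sub>m n n) Q P" by (rule similar_mat_wit_sym)
  note D = similar_mat_witD2[OF mult_carrier_mat[OF carr] this]
  have UW: "U * W = 0\<^sub>m n n"
    using D by (metis left_mult_zero_mat right_mult_zero_mat)
  obtain i where i: "i < n" "T $$ (i, i) = a"
    using a T by (auto simp: diag_mat_def)
  have "U $$ (i, i) = a\<^sup>2 + b * a + c"
    using diag_mat_quadratic[OF T(2,4) i(1), of b] T i
    by (simp add: U_def del: index_mult_mat(1))
  moreover have "W $$ (i, i) = a - e" using T i by (simp add: W_def)
  ultimately show ?thesis
    using upper_triangular_mult_index[OF tri carr i(1) order_refl] UW i by simp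
qed

lemma mat_trace_eq_sum_list:
  fixes A :: "'a :: conjugatable_ordered_field mat"
  assumes "A \<in> carrier_mat n n" "char_poly A = (\<Prod>a\<leftarrow>es. [:- a, 1:])"
  shows "mat_trace A = (\<Sum>a\<leftarrow>es. a)"
proof -
  obtain T P Q where T: "similar_mat_wit A T P Q" "upper_triangular T" "diag_mat T = es"
    "T \<in> carrier_mat n n"
    using triangularize[OF assms] .
  then have "mat_trace A = (\<Sum>i<n. T $$ (i, i))"
    using mat_trace_similar[OF T(1)] by (simp add: mat_trace_def)
  then show ?thesis
    using T by (auto simp: diag_mat_def interv_sum_list_conv_sum_set_nat atLeast0LessThan)
qed

section \<open>Graphs of valency two and their cycles\<close>

locale two_regular =
  fixes V :: "'a set" and E :: "'a \<Rightarrow> 'a \<Rightarrow> bool"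
  assumes fin: "finite V"
    and wf: "E u v \<Longrightarrow> u \<in> V"
    and sym: "E u v \<Longrightarrow> E v u"
    and irrefl: "\<not> E u u"
    and deg: "u \<in> V \<Longrightarrow> card {v. E u v} = 2"
begin

lemma wf2: "E u v \<Longrightarrow> v \<in> V"
  using wf sym by blast

lemma nbs_eq: "u \<in> V \<Longrightarrow> E u v \<Longrightarrow> E u w \<Longrightarrow> v \<noteq> w \<Longrightarrow> {x. E u x} = {v, w}"
  using deg[of u] by (intro card_seteq[symmetric]) (auto intro: card_ge_0_finite)

text \<open>A cycle of length \<open>n\<close> is a function on all integers with exact period
  \<open>n\<close>, so that rotations and reflections are affine substitutions and indices need no
  reduction. Since all neighbours are listed, a cycle is a whole connected component.\<close>

definition is_cycle :: "(int \<Rightarrow> 'a) \<Rightarrow> nat \<Rightarrow> bool" where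
  "is_cycle c n \<longleftrightarrow> 3 \<le> n \<and> (\<forall>k l. c k = c l \<longleftrightarrow> int n dvd k - l) \<and>
     (\<forall>k v. E (c k) v \<longleftrightarrow> v = c (k + 1) \<or> v = c (k - 1))"

definition other :: "'a \<Rightarrow> 'a \<Rightarrow> 'a" where
  "other p v = (SOME w. E v w \<and> w \<noteq> p)"

lemma other:
  assumes "E p v"
  shows "E v (other p v)" "other p v \<noteq> p"
proof -
  have "\<exists>w. E v w \<and> w \<noteq> p"
  proof (rule ccontr)
    assume "\<nexists>w. E v w \<and> w \<noteq> p"
    then have "{w. E v w} \<subseteq> {p}" by auto
    then have "card {w. E v w} \<le> 1" by (metis card.empty card.insert card_mono empty_iff finite.simps One_nat_def)
    then show False using deg[OF wf2[OF assms]] by simp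
  qed
  then show "E v (other p v)" "other p v \<noteq> p"
    unfolding other_def by (metis (mono_tags, lifting) someI_ex)+
qed

text \<open>The state consists of the previous and the current vertex, so that the walk can avoid
  turning back.\<close>

primrec walk :: "'a \<Rightarrow> 'a \<Rightarrow> nat \<Rightarrow> 'a \<times> 'a" where
  "walk u v 0 = (u, v)"
| "walk u v (Suc k) = (snd (walk u v k), other (fst (walk u v k)) (snd (walk u v k)))"

lemma cycle_exists:
  assumes "u \<in> V"
  obtains c n where "is_cycle c n" "c 0 = u"
proof -
  obtain v where uv: "E u v"
    using deg[OF assms] by (metis Collect_empty_eq card.empty zero_neq_numeral)
  define a where "a k = fst (walk u v k)" for k
  have snd: "snd (walk u v k) = a (Suc k)" for k by (simp add: a_def)
  have E_walk: "E (a k) (a (Suc k))" for k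
  proof (induction k)
    case 0
    then show ?case using uv by (simp add: a_def)
  next
    case (Suc k)
    have "a (Suc (Suc k)) = other (a k) (a (Suc k))"
      using snd[of k] by (simp add: a_def)
    then show ?case using other(1)[OF Suc] by simp
  qed
  have nonback: "a (Suc (Suc k)) \<noteq> a k" for k
  proof -
    have "a (Suc (Suc k)) = other (a k) (a (Suc k))"
      using snd[of k] by (simp add: a_def)
    then show ?thesis using other(2)[OF E_walk[of k]] by simp
  qed
  have aV: "a k \<in> V" for k using E_walk wf by blast
  have nb: "{x. E (a (Suc k)) x} = {a k, a (Suc (Suc k))}" for k
    using nonback[of k] by (intro nbs_eq aV) (auto intro: E_walk sym)
  have "\<exists>n. 0 < n \<and> (\<exists>k. a (k + n) = a k)"
  proof -
    have "\<not> inj a"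
      using fin aV by (metis finite_imageD finite_subset image_subsetI infinite_UNIV_nat)
    then obtain i j where "i < j" "a i = a j" unfolding inj_def by (metis nat_neq_iff)
    then show ?thesis by (intro exI[of _ "j - i"]) (auto intro!: exI[of _ i])
  qed
  \<comment> \<open>\<open>n\<close> is the least gap between equal vertices anywhere on the walk,
    not only at its start.\<close>
  then obtain n where n: "0 < n" "\<exists>k. a (k + n) = a k"
    and n_min: "\<And>m. 0 < m \<Longrightarrow> m < n \<Longrightarrow> \<nexists>k. a (k + m) = a k"
    using exists_least_iff[of "\<lambda>n. 0 < n \<and> (\<exists>k. a (k + n) = a k)"] by blast
  obtain k where k: "a (k + n) = a k" using n by blast
  have n3: "3 \<le> n"
  proof (rule ccontr)
    assume "\<not> 3 \<le> n"
    then have "n = 1 \<or> n = 2" using n(1) by linarith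
    then show False using k E_walk[of k] irrefl nonback[of k] by auto
  qed
  \<comment> \<open>Otherwise the walk has come back to \<open>a k\<close> through
    \<open>a (Suc k)\<close>, and the smaller gap \<open>n - 2\<close> occurs.\<close>
  have step: "a (Suc k + n) = a (Suc k)"
  proof (rule ccontr)
    assume "a (Suc k + n) \<noteq> a (Suc k)"
    moreover have "a (Suc k) \<in> {x. E (a (Suc (k + n - 1))) x}"
      using E_walk[of k] k n(1) by simp
    ultimately have "a (Suc k) = a (k + n - 1)"
      unfolding nb using n(1) by auto
    moreover have "k + n - 1 = Suc k + (n - 2)" using n3 by simp
    ultimately have "a (Suc k + (n - 2)) = a (Suc k)" by simp
    moreover have "0 < n - 2" "n - 2 < n" using n3 by auto
    ultimately show False using n_min[of "n - 2"] by blast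
  qed
  \<comment> \<open>Two consecutive agreements imply the next one, because the middle vertex has
    only two neighbours; this propagates the period in both directions.\<close>
  have fwd: "a (k + j + n) = a (k + j) \<and> a (Suc (k + j) + n) = a (Suc (k + j))" for j
  proof (induction j)
    case 0
    then show ?case using k step by simp
  next
    case (Suc j)
    have "{a (k + j + n), a (Suc (Suc (k + j + n)))} = {a (k + j), a (Suc (Suc (k + j)))}"
      using nb[of "k + j + n"] nb[of "k + j"] Suc by simp
    then show ?case using Suc by (auto simp: doubleton_eq_iff)
  qed
  have bwd: "j \<le> k \<Longrightarrow> a (k - j + n) = a (k - j) \<and> a (Suc (k - j) + n) = a (Suc (k - j))" for j
  proof (induction j)
    case 0
    then show ?case using k step by simp
  next
    case (Suc j)
    define i where "i = k - Suc j"
    have i: "k - j = Suc i" using Suc.prems i_def by simp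
    have "{a (i + n), a (Suc (Suc (i + n)))} = {a i, a (Suc (Suc i))}"
      using nb[of "i + n"] nb[of "i"] Suc i by simp
    then show ?case using Suc i by (auto simp: doubleton_eq_iff i_def[symmetric])
  qed
  have per: "a (j + n) = a j" for j
    using fwd[of "j - k"] bwd[of "k - j"] by (cases "k \<le> j") auto
  have permul: "a (j + q * n) = a j" for j q
    by (induction q) (simp_all add: per add.assoc[symmetric] add.commute[of n])
  have pmod: "a (j mod n) = a j" for j
    using permul[of "j mod n" "j div n"] by simp
  have inj: "a i = a j \<longleftrightarrow> i = j" if "i < n" "j < n" for i j
  proof -
    have "False" if "i < j" "j < n" "a i = a j" for i j
      using n_min[of "j - i"] that by (metis add_diff_inverse_nat diff_less_mono2 less_imp_diff_less not_less_iff_gr_or_eq zero_less_diff)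
    then show ?thesis using that by (metis nat_neq_iff)
  qed
  define c where "c k = a (nat (k mod int n))" for k
  have c_eq: "c i = c j \<longleftrightarrow> int n dvd i - j" for i j
  proof -
    have "c i = c j \<longleftrightarrow> nat (i mod int n) = nat (j mod int n)"
      unfolding c_def using n(1) by (intro inj) (simp_all add: nat_less_iff)
    then show ?thesis using n(1) by (simp add: eq_nat_nat_iff mod_eq_dvd_iff)
  qed
  have c_int: "c (int j) = a j" for j
    by (simp add: c_def zmod_int[symmetric] pmod)
  have E_succ: "E (c i) (c (i + 1))" for i
  proof -
    define j where "j = nat (i mod int n)"
    have "int n dvd i - int j" "int n dvd i + 1 - int (Suc j)"
      using n(1) by (simp_all add: j_def mod_eq_dvd_iff[symmetric])
    then have "c i = a j" "c (i + 1) = a (Suc j)"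
      using c_eq c_int by metis+
    then show ?thesis using E_walk by simp
  qed
  have ne: "c (i + 1) \<noteq> c (i - 1)" for i
    using n3 by (auto simp: c_eq dest: zdvd_imp_le)
  have "{x. E (c i) x} = {c (i + 1), c (i - 1)}" for i
    using E_succ[of i] sym[OF E_succ[of "i - 1"]] ne by (intro nbs_eq) (auto dest: wf)
  then have "is_cycle c n"
    unfolding is_cycle_def using n3 c_eq by blast
  moreover have "c 0 = u" using c_int[of 0] by (simp add: a_def)
  ultimately show ?thesis using that by blast
qed

context
  fixes c n assumes c: "is_cycle c n"
begin

lemma cycle_eq_iff: "c k = c l \<longleftrightarrow> int n dvd k - l"
  and cycle_E_iff: "E (c k) v \<longleftrightarrow> v = c (k + 1) \<or> v = c (k - 1)"
  and cycle_length: "3 \<le> n"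
  using c by (auto simp: is_cycle_def)

lemma cycle_in: "c k \<in> V"
  using cycle_E_iff[of k] wf by blast

lemma cycle_succ_neq: "c (k + 1) \<noteq> c (k - 1)"
  using cycle_length by (auto simp: cycle_eq_iff dest: zdvd_imp_le)

lemma cycle_nbs: "{v. E (c k) v} = {c (k + 1), c (k - 1)}"
  by (auto simp: cycle_E_iff)

lemma cycle_mod: "c (k mod int n) = c k"
  by (simp add: cycle_eq_iff mod_eq_dvd_iff[symmetric])

lemma range_cycle: "range c = c ` {0..<int n}"
proof -
  have "c k \<in> c ` {0..<int n}" for k
    using cycle_length by (intro image_eqI[of _ _ "k mod int n"]) (auto simp: cycle_mod)
  then show ?thesis by auto
qed

lemma inj_on_cycle: "inj_on c {0..<int n}"
  by (rule inj_onI) (use cycle_length in \<open>auto simp: cycle_eq_iff mod_eq_dvd_iff[symmetric]\<close>)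

lemma card_range_cycle: "card (range c) = n"
  unfolding range_cycle by (subst card_image[OF inj_on_cycle]) simp

lemma range_cycle_closed: "u \<in> range c \<Longrightarrow> E u v \<Longrightarrow> v \<in> range c"
  by (auto simp: cycle_E_iff)

lemma cycle_reparam:
  assumes "e = 1 \<or> e = - 1"
  shows "is_cycle (\<lambda>k. c (a + e * k)) n"
proof -
  have "int n dvd e * (k - l) \<longleftrightarrow> int n dvd k - l" for k l
    using assms by (auto simp: dvd_diff_commute)
  then have "int n dvd (a + e * k) - (a + e * l) \<longleftrightarrow> int n dvd k - l" for k l
    by (simp add: right_diff_distrib)
  then show ?thesis
    using cycle_length assms unfolding is_cycle_def
    by (auto simp: cycle_eq_iff cycle_E_iff algebra_simps)
qed

lemma range_cycle_reparam:
  fixes a e :: int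
  assumes "e = 1 \<or> e = - 1"
  shows "range (\<lambda>k. c (a + e * k)) = range c"
proof -
  have "surj (\<lambda>k. a + e * k)"
    by (rule surjI[of _ "\<lambda>k. e * (k - a)"]) (use assms in auto)
  then show ?thesis by (metis image_image)
qed

lemma sum_nbs: "(\<Sum>v\<in>{v. E (c k) v}. f v) = f (c (k + 1)) + f (c (k - 1))"
  using cycle_succ_neq[of k] by (simp add: cycle_nbs)

end

definition closed :: "'a set \<Rightarrow> bool" where
  "closed C \<longleftrightarrow> C \<subseteq> V \<and> (\<forall>u\<in>C. \<forall>v. E u v \<longrightarrow> v \<in> C)"

lemma closed_cycle: "is_cycle c n \<Longrightarrow> closed (range c)"
  unfolding closed_def using cycle_in range_cycle_closed by blast

lemma closed_diff: "closed C \<Longrightarrow> closed D \<Longrightarrow> closed (C - D)"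
  unfolding closed_def using sym by blast

lemma closed_cycle_subset:
  assumes "is_cycle c n" "closed C" "c 0 \<in> C"
  shows "range c \<subseteq> C"
proof -
  have "c (int k) \<in> C" for k
  proof (induction k)
    case (Suc k)
    then show ?case using assms(2) cycle_E_iff[OF assms(1), of "int k" "c (1 + int k)"]
      by (auto simp: closed_def add.commute)
  qed (use assms in simp)
  then have "c ` {0..<int n} \<subseteq> C" by (auto simp: image_subset_iff) (metis nonneg_int_cases)
  then show ?thesis using range_cycle[OF assms(1)] by simp
qed

text \<open>The union of the cycles of length three, described without reference to cycles so that
  it is visibly closed under relabelling; \<open>cycle_tris_iff\<close> gives the link.\<close>

definition tris :: "'a set" where
  "tris = {u. \<exists>v w. E u v \<and> E v w \<and> E w u}"

lemma tris_subset: "tris \<subseteq> V"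
  using wf by (auto simp: tris_def)

lemma cycle_tris_iff:
  assumes c: "is_cycle c n"
  shows "c k \<in> tris \<longleftrightarrow> n = 3"
proof
  assume "n = 3"
  have "E (c k) (c (k + 1))" "E (c (k + 1)) (c (k + 2))" "E (c (k + 2)) (c k)"
    using \<open>n = 3\<close> by (auto simp: cycle_E_iff[OF c] cycle_eq_iff[OF c])
  then show "c k \<in> tris" unfolding tris_def by blast
next
  assume "c k \<in> tris"
  then obtain v w where *: "E (c k) v" "E v w" "E w (c k)" by (auto simp: tris_def)
  then have w: "w = c (k + 1) \<or> w = c (k - 1)"
    using sym cycle_E_iff[OF c] by blast
  have "v = c (k + 1) \<or> v = c (k - 1)" using * cycle_E_iff[OF c] by blast
  moreover have "v \<noteq> w" using * irrefl by blast
  ultimately have "E (c (k + 1)) (c (k - 1))" using w * sym by blast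
  then have "int n dvd 3 \<or> int n dvd 1"
    by (auto simp: cycle_E_iff[OF c] cycle_eq_iff[OF c] dvd_diff_commute)
  then have "n dvd 3 \<or> n dvd 1" by presburger
  then show "n = 3" using cycle_length[OF c] by (auto dest!: dvd_imp_le)
qed

lemma closed_tris: "closed tris"
proof -
  have "v \<in> tris" if u: "u \<in> tris" and uv: "E u v" for u v
  proof -
    obtain c n where c: "is_cycle c n" "c 0 = u"
      using cycle_exists u tris_subset by blast
    then have "n = 3" using u cycle_tris_iff by metis
    moreover obtain k where "v = c k" using c uv cycle_E_iff by blast
    ultimately show ?thesis using c cycle_tris_iff by metis
  qed
  then show ?thesis unfolding closed_def using tris_subset by blast
qed

end

section \<open>Incidence structures between two graphs of valency two\<close>

lemma int_card_filter: "finite A \<Longrightarrow> int (card {x \<in> A. Q x}) = (\<Sum>x\<in>A. of_bool (Q x))"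
  by (simp add: Int_def)

text \<open>With N the incidence matrix, \<open>intertwine\<close> is R N = N S, while
  \<open>deg_P\<close> and \<open>codeg_P\<close> give the diagonal and the other entries of N N^T =
  6 + 2 J - R - R^2. The axioms are symmetric in points and blocks, so that every lemma has a
  dual.\<close>

locale biadjacency = P: two_regular P R + B: two_regular B S
  for P :: "'a set" and R and B :: "'b set" and S +
  fixes I :: "'a \<Rightarrow> 'b \<Rightarrow> bool"
  assumes card_P: "card P = 18" and card_B: "card B = 18"
    and deg_P: "u \<in> P \<Longrightarrow> card {x \<in> B. I u x} = 6"
    and deg_B: "x \<in> B \<Longrightarrow> card {u \<in> P. I u x} = 6"
    and intertwine: "u \<in> P \<Longrightarrow> x \<in> B \<Longrightarrow> card {v. R u v \<and> I v x} = card {y. S x y \<and> I u y}"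
    and codeg_P: "u \<in> P \<Longrightarrow> v \<in> P \<Longrightarrow> u \<noteq> v \<Longrightarrow>
      card {x \<in> B. I u x \<and> I v x} + of_bool (R u v) + card {w. R u w \<and> R w v} = 2"
    and codeg_B: "x \<in> B \<Longrightarrow> y \<in> B \<Longrightarrow> x \<noteq> y \<Longrightarrow>
      card {u \<in> P. I u x \<and> I u y} + of_bool (S x y) + card {z. S x z \<and> S z y} = 2"
begin

lemma dual: "biadjacency B S P R (\<lambda>x u. I u x)"
proof
  show "card {x. S y x \<and> I u x} = card {v. R u v \<and> I v y}" if "y \<in> B" "u \<in> P" for u y
    using intertwine that by simp
qed (use card_P card_B deg_P deg_B codeg_P codeg_B in auto)

definition codeg :: "'a \<Rightarrow> 'a \<Rightarrow> nat" where
  "codeg u v = card {x \<in> B. I u x \<and> I v x}"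

text \<open>The diagonal is included, at the price of the term 6, because the codegrees are summed
  over whole cycles later.\<close>

lemma codeg_eq:
  assumes "u \<in> P" "v \<in> P"
  shows "int (codeg u v) = 2 + 6 * of_bool (u = v) - of_bool (R u v)
    - (\<Sum>w\<in>{w. R u w}. of_bool (R w v))"
proof -
  have fin: "finite {w. R u w}" using P.deg[OF assms(1)] by (intro card_ge_0_finite) simp
  have *: "(\<Sum>w\<in>{w. R u w}. of_bool (R w v)) = int (card {w. R u w \<and> R w v})"
    using fin by (simp add: Int_def)
  show ?thesis
  proof (cases "u = v")
    case True
    have "{w. R u w \<and> R w v} = {w. R u w}" using P.sym True by auto
    then have "card {w. R u w \<and> R w v} = 2" using P.deg[OF assms(1)] by simp
    then show ?thesis unfolding * codeg_def using True assms P.irrefl by (simp add: deg_P)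
  next
    case False
    then show ?thesis using codeg_P[OF assms False] unfolding * codeg_def by (cases "R u v") auto
  qed
qed

lemma codeg_le_2: "u \<in> P \<Longrightarrow> v \<in> P \<Longrightarrow> u \<noteq> v \<Longrightarrow> codeg u v \<le> 2"
  unfolding codeg_def using codeg_P[of u v] by linarith

text \<open>The variance of the intersection sizes of \<open>C\<close> with the blocks vanishes.\<close>

lemma closed_block_card:
  assumes C: "P.closed C" and x: "x \<in> B"
  shows "3 * card {u \<in> C. I u x} = card C"
proof -
  define a where "a x = (\<Sum>u\<in>C. of_bool (I u x) :: int)" for x
  have CP: "C \<subseteq> P" and clo: "\<And>u v. u \<in> C \<Longrightarrow> R u v \<Longrightarrow> v \<in> C"
    using C by (auto simp: P.closed_def)
  have fin: "finite C" "finite B" using CP P.fin B.fin finite_subset by auto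
  have "(\<Sum>x\<in>B. a x) = (\<Sum>u\<in>C. \<Sum>x\<in>B. of_bool (I u x))"
    unfolding a_def by (rule sum.swap)
  also have "\<dots> = (\<Sum>u\<in>C. int (card {x \<in> B. I u x}))"
    by (simp only: int_card_filter[OF fin(2)])
  also have "\<dots> = (\<Sum>u\<in>C. 6)"
    using CP deg_P by (intro sum.cong) auto
  finally have s1: "(\<Sum>x\<in>B. a x) = 6 * int (card C)" by simp
  have R2: "(\<Sum>v\<in>C. \<Sum>w\<in>{w. R u w}. of_bool (R w v)) = (4 :: int)" if u: "u \<in> C" for u
  proof -
    have "(\<Sum>v\<in>C. \<Sum>w\<in>{w. R u w}. of_bool (R w v))
        = (\<Sum>w\<in>{w. R u w}. \<Sum>v\<in>C. of_bool (R w v) :: int)" by (rule sum.swap)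
    also have "\<dots> = (\<Sum>w\<in>{w. R u w}. 2)"
    proof (rule sum.cong[OF refl])
      fix w assume "w \<in> {w. R u w}"
      then have w: "w \<in> C" using clo u by auto
      then have "{v \<in> C. R w v} = {v. R w v}" using clo by auto
      then show "(\<Sum>v\<in>C. of_bool (R w v)) = (2 :: int)"
        using int_card_filter[OF fin(1), of "R w"] P.deg[of w] w CP by auto
    qed
    also have "\<dots> = 4" using P.deg[of u] u CP by auto
    finally show ?thesis .
  qed
  have R1: "(\<Sum>v\<in>C. of_bool (R u v)) = (2 :: int)" if u: "u \<in> C" for u
  proof -
    have "{v \<in> C. R u v} = {v. R u v}" using clo u by auto
    then show ?thesis using int_card_filter[OF fin(1), of "R u"] P.deg[of u] u CP by auto
  qed
  have cd: "(\<Sum>x\<in>B. of_bool (I u x) * of_bool (I v x)) = int (codeg u v)" for u v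
    unfolding codeg_def int_card_filter[OF fin(2)] by (simp only: of_bool_conj)
  have "(\<Sum>x\<in>B. (a x)\<^sup>2) = (\<Sum>x\<in>B. \<Sum>u\<in>C. \<Sum>v\<in>C. of_bool (I u x) * of_bool (I v x))"
    unfolding a_def power2_eq_square sum_product by simp
  also have "\<dots> = (\<Sum>u\<in>C. \<Sum>x\<in>B. \<Sum>v\<in>C. of_bool (I u x) * of_bool (I v x))"
    by (rule sum.swap)
  also have "\<dots> = (\<Sum>u\<in>C. \<Sum>v\<in>C. \<Sum>x\<in>B. of_bool (I u x) * of_bool (I v x))"
    by (intro sum.cong refl sum.swap)
  also have "\<dots> = (\<Sum>u\<in>C. \<Sum>v\<in>C. int (codeg u v))" by (simp only: cd)
  also have "\<dots> = (\<Sum>u\<in>C. 2 * int (card C))"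
  proof (rule sum.cong[OF refl])
    fix u assume u: "u \<in> C"
    have "(\<Sum>v\<in>C. int (codeg u v)) = (\<Sum>v\<in>C. 2 + 6 * of_bool (u = v) - of_bool (R u v)
      - (\<Sum>w\<in>{w. R u w}. of_bool (R w v)))"
      using u CP by (intro sum.cong codeg_eq) auto
    \<comment> \<open>The constants cancel: the indicator of \<open>C\<close> is an eigenvector of
      \<open>R\<close> for the eigenvalue 2, and 2 is a root of 6 - x - x^2.\<close>
    also have "\<dots> = 2 * int (card C) + 6 - 2 - 4"
      using u R1[OF u] R2[OF u] fin(1)
      by (simp add: sum.distrib sum_subtractf sum_distrib_left[symmetric] of_bool_def)
    finally show "(\<Sum>v\<in>C. int (codeg u v)) = 2 * int (card C)" by simp
  qed
  finally have s2: "(\<Sum>x\<in>B. (a x)\<^sup>2) = 2 * (int (card C))\<^sup>2" by (simp add: power2_eq_square)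
  have "(\<Sum>x\<in>B. (3 * a x - int (card C))\<^sup>2)
      = 9 * (\<Sum>x\<in>B. (a x)\<^sup>2) - 6 * int (card C) * (\<Sum>x\<in>B. a x) + (\<Sum>x\<in>B. (int (card C))\<^sup>2)"
    by (simp add: power2_diff sum.distrib sum_subtractf sum_distrib_left sum_distrib_right algebra_simps power2_eq_square)
  also have "\<dots> = 0" unfolding s1 s2 by (simp add: card_B power2_eq_square)
  finally have "(3 * a x - int (card C))\<^sup>2 = 0"
    using x fin(2) by (subst (asm) sum_nonneg_eq_0_iff) auto
  then show ?thesis unfolding a_def int_card_filter[OF fin(1), symmetric] by simp
qed

text \<open>A sum of indicators rather than a case distinction, since for \<open>n = 3\<close> and
  \<open>n = 4\<close> some of these congruences hold simultaneously.\<close>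

lemma codeg_cycle:
  assumes c: "P.is_cycle c n"
  shows "int (codeg (c k) (c l)) = 2 + 4 * of_bool (int n dvd k - l)
    - of_bool (int n dvd k - l + 1) - of_bool (int n dvd k - l - 1)
    - of_bool (int n dvd k - l + 2) - of_bool (int n dvd k - l - 2)"
proof -
  note c_eq = P.cycle_eq_iff[OF c] and c_E = P.cycle_E_iff[OF c]
  have E: "of_bool (R (c i) (c j)) = (of_bool (int n dvd i - j + 1) + of_bool (int n dvd i - j - 1) :: int)" for i j
  proof -
    have 1: "R (c i) (c j) \<longleftrightarrow> int n dvd i - j + 1 \<or> int n dvd i - j - 1"
    proof -
      have "R (c i) (c j) \<longleftrightarrow> c (i + 1) = c j \<or> c (i - 1) = c j" by (auto simp: c_E)
      then show ?thesis unfolding c_eq by (simp add: algebra_simps)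
    qed
    have "\<not> (int n dvd i - j + 1 \<and> int n dvd i - j - 1)"
    proof
      assume "int n dvd i - j + 1 \<and> int n dvd i - j - 1"
      then have "int n dvd (i - j + 1) - (i - j - 1)" by (meson dvd_diff)
      then have "int n dvd 2" by simp
      then show False using P.cycle_length[OF c] by (auto dest: zdvd_imp_le)
    qed
    then show ?thesis unfolding 1 by auto
  qed
  show ?thesis
    unfolding codeg_eq[OF P.cycle_in[OF c] P.cycle_in[OF c]] P.sum_nbs[OF c] E
    by (simp add: c_eq algebra_simps)
qed

text \<open>A single entry of R N = N S: a discrete wave equation, with space along one cycle and
  time along the other.\<close>

lemma wave:
  assumes c: "P.is_cycle c n" and d: "B.is_cycle d m"
  shows "of_bool (I (c (k - 1)) (d j)) + of_bool (I (c (k + 1)) (d j))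
    = (of_bool (I (c k) (d (j - 1))) + of_bool (I (c k) (d (j + 1))) :: int)"
proof -
  have finP: "finite {v. R (c k) v}" and finB: "finite {y. S (d j) y}"
    by (simp_all add: P.cycle_nbs[OF c] B.cycle_nbs[OF d])
  have "int (card {v \<in> {v. R (c k) v}. I v (d j)}) = int (card {y \<in> {y. S (d j) y}. I (c k) y})"
    using intertwine[OF P.cycle_in[OF c] B.cycle_in[OF d]] by simp
  then show ?thesis
    unfolding int_card_filter[OF finP] int_card_filter[OF finB] P.sum_nbs[OF c] B.sum_nbs[OF d]
    by simp
qed

lemma sum_cycle:
  assumes c: "P.is_cycle c n" and x: "x \<in> B"
  shows "3 * (\<Sum>k\<in>{0..<int n}. of_bool (I (c k) x)) = int n"
proof -
  have "{u \<in> range c. I u x} = c ` {k \<in> {0..<int n}. I (c k) x}"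
    unfolding P.range_cycle[OF c] by auto
  moreover have "inj_on c {k \<in> {0..<int n}. I (c k) x}"
    using P.inj_on_cycle[OF c] by (rule inj_on_subset) auto
  ultimately have "card {u \<in> range c. I u x} = card {k \<in> {0..<int n}. I (c k) x}"
    by (simp add: card_image)
  then have "3 * card {k \<in> {0..<int n}. I (c k) x} = n"
    using closed_block_card[OF P.closed_cycle[OF c] x] P.card_range_cycle[OF c] by simp
  then have "3 * int (card {k \<in> {0..<int n}. I (c k) x}) = int n"
    by linarith
  then show ?thesis by (simp only: int_card_filter finite_atLeastLessThan_int)
qed

end

section \<open>Solutions of the discrete wave equation with values 0 and 1\<close>

text \<open>By the wave equation the difference between the antidiagonals of index
  \<open>k + j\<close> and \<open>k + j + 2\<close> is constant along them; where it is not zero,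
  the values 0 and 1 leave no choice.\<close>

lemma wave_anti_constant:
  fixes f :: "int \<Rightarrow> int \<Rightarrow> int"
  assumes f01: "\<And>k j. f k j \<in> {0, 1}"
    and wave: "\<And>k j. f (k - 1) j + f (k + 1) j = f k (j - 1) + f k (j + 1)"
    and ne: "f (k + 1) (j + 1) \<noteq> f k j"
  shows "f (k + i) (j - i) = f k j" "f (k + 1 + i) (j + 1 - i) = 1 - f k j"
proof -
  define D where "D i = f (k + 1 + i) (j + 1 - i) - f (k + i) (j - i)" for i
  have "D (i + 1) = D i" for i
    using wave[of "k + i + 1" "j - i"] by (simp add: D_def algebra_simps)
  then have D: "D i = D 0" for i
    by (induction i rule: int_induct[of _ 0]) (simp, simp, metis diff_add_cancel)
  have "D 0 \<noteq> 0" using ne by (simp add: D_def)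
  then show "f (k + i) (j - i) = f k j" "f (k + 1 + i) (j + 1 - i) = 1 - f k j"
    using D[of i] f01[of "k + 1 + i" "j + 1 - i"] f01[of "k + i" "j - i"] f01[of "k + 1" "j + 1"] f01[of k j]
    by (auto simp: D_def)
qed

lemma wave_diag_constant:
  fixes f :: "int \<Rightarrow> int \<Rightarrow> int"
  assumes f01: "\<And>k j. f k j \<in> {0, 1}"
    and wave: "\<And>k j. f (k - 1) j + f (k + 1) j = f k (j - 1) + f k (j + 1)"
    and ne: "f (k + 1) (j - 1) \<noteq> f k j"
  shows "f (k + i) (j + i) = f k j" "f (k + 1 + i) (j - 1 + i) = 1 - f k j"
  using wave_anti_constant[of "\<lambda>k j. f k (- j)" k "- j" i] f01 wave[of _ "- _"] ne
  by (auto simp: algebra_simps)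

text \<open>A failure of invariance in one diagonal direction is a jump between two parallel lines
  at distance two, and then one line carries only 0 and the other only 1. Failures in both
  directions give such lines of both kinds.\<close>

lemma wave_lines:
  fixes f :: "int \<Rightarrow> int \<Rightarrow> int"
  assumes f01: "\<And>k j. f k j \<in> {0, 1}"
    and wave: "\<And>k j. f (k - 1) j + f (k + 1) j = f k (j - 1) + f k (j + 1)"
    and not_shift: "\<not> ((\<forall>k j. f (k + 1) (j + 1) = f k j) \<or> (\<forall>k j. f (k + 1) (j - 1) = f k j))"
  obtains s t r where "\<And>k. f k (s - k) = 1" "\<And>k. f k (t - k) = 0" "even (s - t)" "\<And>k. f k (r + k) = 1"
proof -
  obtain k1 j1 where 1: "f (k1 + 1) (j1 + 1) \<noteq> f k1 j1" using not_shift by blast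
  obtain k2 j2 where 2: "f (k2 + 1) (j2 - 1) \<noteq> f k2 j2" using not_shift by blast
  note A = wave_anti_constant[OF f01 wave 1] and B = wave_diag_constant[OF f01 wave 2]
  have a0: "f k (k1 + j1 - k) = f k1 j1" for k using A(1)[of "k - k1"] by (simp add: algebra_simps)
  have a1: "f k (k1 + j1 + 2 - k) = 1 - f k1 j1" for k using A(2)[of "k - k1 - 1"] by (simp add: algebra_simps)
  have b0: "f k (j2 - k2 + k) = f k2 j2" for k using B(1)[of "k - k2"] by (simp add: algebra_simps)
  have b1: "f k (j2 - k2 - 2 + k) = 1 - f k2 j2" for k using B(2)[of "k - k2 - 1"] by (simp add: algebra_simps)
  obtain r where r: "\<And>k. f k (r + k) = 1"
  proof (cases "f k2 j2 = 1")
    case True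
    then show ?thesis using b0 that by metis
  next
    case False
    then have "f k2 j2 = 0" using f01[of k2 j2] by auto
    then show ?thesis using b1 that by (metis diff_zero)
  qed
  show ?thesis
  proof (cases "f k1 j1 = 1")
    case True
    then show ?thesis using a0 a1 r that[of "k1 + j1" "k1 + j1 + 2" r] by simp
  next
    case False
    then have "f k1 j1 = 0" using f01[of k1 j1] by auto
    then show ?thesis using a0 a1 r that[of "k1 + j1 + 2" "k1 + j1" r] by simp
  qed
qed

text \<open>An antidiagonal on which \<open>f\<close> is constantly 0 meets a diagonal on which \<open>f\<close> is constantly 1;
  the odd period takes care of the parity obstruction.\<close>

lemma wave_odd_period:
  fixes f :: "int \<Rightarrow> int \<Rightarrow> int"
  assumes f01: "\<And>k j. f k j \<in> {0, 1}"
    and wave: "\<And>k j. f (k - 1) j + f (k + 1) j = f k (j - 1) + f k (j + 1)"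
    and per: "\<And>k j. f k (j + m) = f k j" and odd: "odd m"
  shows "(\<forall>k j. f (k + 1) (j + 1) = f k j) \<or> (\<forall>k j. f (k + 1) (j - 1) = f k j)"
proof (rule ccontr)
  assume "\<not> ?thesis"
  from wave_lines[OF f01 wave this] obtain s t r where
    t: "\<And>k. f k (t - k) = 0" and r: "\<And>k. f k (r + k) = 1"
    by metis
  have no: "\<not> even (t' - r)" if "\<And>k. f k (t' - k) = 0" for t'
  proof
    assume "even (t' - r)"
    then obtain k where "t' - r = 2 * k" by blast
    then have "t' - k = r + k" by simp
    then show False using that[of k] r[of k] by (simp add: add.commute)
  qed
  have "f k (t + m - k) = 0" for k using t[of k] per[of k "t - k"] by (simp add: algebra_simps)
  then show False using no[of t] no[of "t + m"] t odd by auto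
qed

text \<open>An antidiagonal of zeros and a diagonal of ones must have opposite parity, or they would
  meet. The antidiagonal of ones has the parity of the zeros, so the odd shift by 3 makes it meet
  the diagonal of ones: two ones at distance 3 with the same \<open>j\<close>.\<close>

lemma wave_half_period:
  fixes f :: "int \<Rightarrow> int \<Rightarrow> int"
  assumes f01: "\<And>k j. f k j \<in> {0, 1}"
    and wave: "\<And>k j. f (k - 1) j + f (k + 1) j = f k (j - 1) + f k (j + 1)"
    and disj: "\<And>k j. f k j * f (k + 3) j = 0"
  shows "(\<forall>k j. f (k + 1) (j + 1) = f k j) \<or> (\<forall>k j. f (k + 1) (j - 1) = f k j)"
proof (rule ccontr)
  assume "\<not> ?thesis"
  from wave_lines[OF f01 wave this] obtain s t r where
    s: "\<And>k. f k (s - k) = 1" and t: "\<And>k. f k (t - k) = 0" and "even (s - t)"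
    and r: "\<And>k. f k (r + k) = 1"
    by metis
  have "odd (t - r)"
  proof
    assume "even (t - r)"
    then obtain k where "t - r = 2 * k" by blast
    then have "t - k = r + k" by simp
    then show False using t[of k] r[of k] by (simp add: add.commute)
  qed
  with \<open>even (s - t)\<close> have "even (s - 3 - r)" by presburger
  then obtain k where "s - 3 - r = 2 * k" by blast
  then have "s - k = r + (k + 3)" by simp
  then show False using s[of k] r[of "k + 3"] disj[of k "s - k"] by (simp add: ac_simps)
qed

lemma sum_periodic_shift:
  fixes \<psi> :: "int \<Rightarrow> 'a :: comm_monoid_add" and m :: int
  assumes per: "\<And>t. \<psi> (t + m) = \<psi> t" and m: "m > 0"
  shows "(\<Sum>k\<in>{0..<m}. \<psi> (a + k)) = (\<Sum>k\<in>{0..<m}. \<psi> k)"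
proof -
  have step: "(\<Sum>k\<in>{0..<m}. \<psi> (b + 1 + k)) = (\<Sum>k\<in>{0..<m}. \<psi> (b + k))" for b
  proof -
    have "(\<Sum>k\<in>{0..<m}. \<psi> (b + 1 + k)) = (\<Sum>k\<in>{1..<m + 1}. \<psi> (b + k))"
      by (rule sum.reindex_bij_witness[of _ "\<lambda>k. k - 1" "\<lambda>k. k + 1"]) (auto simp: add.assoc add.commute[of 1])
    also have "{1..<m + 1} = insert m {1..<m}" using m by auto
    also have "(\<Sum>k\<in>insert m {1..<m}. \<psi> (b + k)) = \<psi> b + (\<Sum>k\<in>{1..<m}. \<psi> (b + k))"
      using per[of b] by simp
    also have "\<dots> = (\<Sum>k\<in>insert 0 {1..<m}. \<psi> (b + k))" by simp
    also have "insert 0 {1..<m} = {0..<m}" using m by auto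
    finally show ?thesis .
  qed
  show ?thesis
  proof (induction a rule: int_induct[of _ 0])
    case (step2 i)
    then show ?case using step[of "i - 1"] by simp
  qed (use step in simp_all)
qed

lemma sum_periodic_uminus:
  fixes \<psi> :: "int \<Rightarrow> 'a :: comm_monoid_add" and m :: int
  assumes per: "\<And>t. \<psi> (t + m) = \<psi> t" and m: "m > 0"
  shows "(\<Sum>k\<in>{0..<m}. \<psi> (- k)) = (\<Sum>k\<in>{0..<m}. \<psi> k)"
proof -
  have "(\<Sum>k\<in>{0..<m}. \<psi> (- k)) = (\<Sum>k\<in>{0..<m}. \<psi> (- (m - 1) + k))"
    by (rule sum.reindex_bij_witness[of _ "\<lambda>k. m - 1 - k" "\<lambda>k. m - 1 - k"]) auto
  also have "\<dots> = (\<Sum>k\<in>{0..<m}. \<psi> k)" using per m by (rule sum_periodic_shift)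
  finally show ?thesis .
qed

lemma diagonal_shift:
  fixes f :: "int \<Rightarrow> int \<Rightarrow> 'a"
  assumes "\<And>k j. f (k + 1) (j + e) = f k j"
  shows "f k j = f 0 (j - e * k)"
proof (induction k arbitrary: j rule: int_induct[of _ 0])
  case (step1 i)
  then show ?case using assms[of i "j - e"] by (simp add: algebra_simps)
next
  case (step2 i)
  then show ?case using assms[of "i - 1" j] by (simp add: algebra_simps)
qed simp

section \<open>Triangles among the cycles\<close>

context biadjacency
begin

lemma card_dual_codeg:
  "biadjacency.codeg P (\<lambda>x u. I u x) x y = card {u \<in> P. I u x \<and> I u y}"
  by (simp add: biadjacency.codeg_def[OF dual])

lemma triangle_sum:
  assumes c: "P.is_cycle c 3" and x: "x \<in> B"
  shows "of_bool (I (c (k - 1)) x) + of_bool (I (c k) x) + of_bool (I (c (k + 1)) x) = (1 :: int)"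
proof -
  have "3 * (\<Sum>i\<in>{0..<int 3}. of_bool (I (c (k - 1 + 1 * i)) x)) = int 3"
    by (rule sum_cycle[OF P.cycle_reparam[OF c] x]) simp
  moreover have "{0..<int 3} = {0, 1, 2}" by auto
  ultimately show ?thesis by (simp add: add.commute del: sum_of_bool_eq)
qed

text \<open>On a triangle the two neighbours of \<open>c k\<close> contribute one minus the value at
  \<open>c k\<close>, which turns the wave equation into a statement about three consecutive
  blocks.\<close>

lemma triangle_wave:
  assumes c: "P.is_cycle c 3" and d: "B.is_cycle d m"
  shows "of_bool (I (c k) (d (j - 1))) + of_bool (I (c k) (d j)) + of_bool (I (c k) (d (j + 1))) = (1 :: int)"
  using triangle_sum[OF c B.cycle_in[OF d], of k j] wave[OF c d, of k j] by linarith

lemma triangle_period: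
  assumes c: "P.is_cycle c 3" and d: "B.is_cycle d m"
  shows "I (c k) (d (j + 3)) = I (c k) (d j)"
  using triangle_wave[OF c d, of k "j + 1"] triangle_wave[OF c d, of k "j + 2"]
  by (cases "I (c k) (d (j + 3))"; cases "I (c k) (d j)") (simp_all add: algebra_simps)

lemma tris_period:
  assumes u: "u \<in> P.tris" and d: "B.is_cycle d m"
  shows "I u (d (j + 3)) = I u (d j)"
proof -
  obtain c n where c: "P.is_cycle c n" "c 0 = u"
    using P.cycle_exists u P.tris_subset by blast
  then have "n = 3" using u P.cycle_tris_iff by metis
  then show ?thesis using triangle_period c d by metis
qed

lemma codeg_cycle_3:
  assumes "P.is_cycle c n" "6 \<le> n"
  shows "codeg (c k) (c (k + 3)) = 2"
proof -
  have "\<not> int n dvd 1" "\<not> int n dvd 2" "\<not> int n dvd 3" "\<not> int n dvd 4" "\<not> int n dvd 5"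
    using assms(2) by (auto dest: zdvd_imp_le)
  then show ?thesis
    using codeg_cycle[OF assms(1), of k "k + 3"] by (simp add: of_bool_def)
qed

text \<open>A triangle point in \<open>d j\<close> is also in \<open>d (j + 3)\<close>, but blocks
  at distance 3 on a long cycle share just two points, and a block contains a third of
  \<open>P.tris\<close>.\<close>

lemma tris_bound:
  assumes d: "B.is_cycle d m" and m: "6 \<le> m"
  shows "{u \<in> P.tris. I u (d j)} \<subseteq> {u \<in> P. I u (d j) \<and> I u (d (j + 3))}"
    and "card {u \<in> P. I u (d j) \<and> I u (d (j + 3))} = 2"
    and "card P.tris \<le> 6"
proof -
  show sub: "{u \<in> P.tris. I u (d j)} \<subseteq> {u \<in> P. I u (d j) \<and> I u (d (j + 3))}" for j
    using tris_period[OF _ d] P.tris_subset by auto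
  show 2: "card {u \<in> P. I u (d j) \<and> I u (d (j + 3))} = 2" for j
    using biadjacency.codeg_cycle_3[OF dual d m] by (simp add: card_dual_codeg)
  have "card {u \<in> P.tris. I u (d 0)} \<le> 2"
    using card_mono[OF _ sub[of 0]] 2[of 0] P.fin by simp
  then show "card P.tris \<le> 6"
    using closed_block_card[OF P.closed_tris B.cycle_in[OF d, of 0]] by simp
qed

end

section \<open>Correlations of three-element subsets of Z/9\<close>

text \<open>The cyclic cross-correlation of two indicator vectors on Z/9.\<close>

definition corr9 :: "bool list \<Rightarrow> bool list \<Rightarrow> nat list" where
  "corr9 a b = map (\<lambda>j. length (filter (\<lambda>s. a ! s \<and> b ! ((s + j) mod 9)) [0..<9])) [0..<9]"

definition rotations :: "'a list \<Rightarrow> 'a list list" where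
  "rotations a = map (\<lambda>k. drop k a @ take k a) [0..<length a]"

definition triples9 :: "bool list list" where
  "triples9 = filter (\<lambda>a. length (filter id a) = 3) (List.n_lists 9 [True, False])"

text \<open>The translates of \<open>{0, 1, 4}\<close> and \<open>{0, 1, 6}\<close> in \<open>\<int> / 9\<close>, and those of \<open>{0, 2, 5}\<close> and
  \<open>{0, 2, 6}\<close>.\<close>

definition triples_134 :: "bool list list" where
  "triples_134 = rotations [True, True, False, False, True, False, False, False, False] @
     rotations [True, True, False, False, False, False, True, False, False]"

definition triples_234 :: "bool list list" where
  "triples_234 = rotations [True, False, True, False, False, True, False, False, False] @
     rotations [True, False, True, False, False, False, True, False, False]"

text \<open>Large enough to contain the correlations, in either order, between the families
  \<open>triples_134\<close> and \<open>triples_234\<close>; see \<open>corr9_cross\<close>.\<close>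

definition cross_corrs :: "nat list list" where
  "cross_corrs = rotations [2, 1, 1, 1, 1, 1, 2, 0, 0] @ rotations [2, 1, 1, 1, 0, 2, 1, 0, 1] @
     rotations [2, 1, 0, 1, 2, 0, 1, 1, 1]"

text \<open>Together with the autocorrelations of the two families above these cover all 3-subsets
  of Z/9, by \<open>autocorr_cases\<close>.\<close>

definition other_autocorrs :: "nat list list" where
  "other_autocorrs = [[3, 0, 0, 3, 0, 0, 3, 0, 0], [3, 0, 2, 0, 1, 1, 0, 2, 0], [3, 1, 0, 0, 2, 2, 0, 0, 1],
     [3, 1, 1, 1, 0, 0, 1, 1, 1], [3, 2, 1, 0, 0, 0, 0, 1, 2]]"

lemma autocorr_cases:
  "list_all (\<lambda>a. (case corr9 a a of p \<Rightarrow>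
     p = [3, 1, 0, 1, 1, 1, 1, 0, 1] \<and> a \<in> set triples_134 \<or>
     p = [3, 0, 1, 1, 1, 1, 1, 1, 0] \<and> a \<in> set triples_234 \<or>
     p \<in> set other_autocorrs)) triples9"
  by code_simp

text \<open>The target [6, 1, 1, 2, 2, 2, 2, 1, 1] lists the codegrees along a cycle of length nine,
  as given by \<open>codeg_cycle\<close>. Two autocorrelations add up to it only if one comes from
  the differences 1, 3, 4 and the other from 2, 3, 4, up to sign.\<close>

lemma autocorr_pairs:
  "list_all (\<lambda>p. list_all (\<lambda>q. map2 (+) p q = [6, 1, 1, 2, 2, 2, 2, 1, 1] \<longrightarrow>
      p = [3, 1, 0, 1, 1, 1, 1, 0, 1] \<and> q = [3, 0, 1, 1, 1, 1, 1, 1, 0] \<or>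
      q = [3, 1, 0, 1, 1, 1, 1, 0, 1] \<and> p = [3, 0, 1, 1, 1, 1, 1, 1, 0])
    ([3, 1, 0, 1, 1, 1, 1, 0, 1] # [3, 0, 1, 1, 1, 1, 1, 1, 0] # other_autocorrs))
    ([3, 1, 0, 1, 1, 1, 1, 0, 1] # [3, 0, 1, 1, 1, 1, 1, 1, 0] # other_autocorrs)"
  by code_simp

lemma corr9_cross:
  "list_all (\<lambda>a. list_all (\<lambda>b. corr9 a b \<in> set cross_corrs \<and> corr9 b a \<in> set cross_corrs) triples_234) triples_134"
  by code_simp

lemma cross_corrs_no_match:
  "list_all (\<lambda>v. v \<noteq> replicate 9 (hd v) \<and>
      list_all (\<lambda>w. map2 (+) v w \<noteq> replicate 9 2) cross_corrs) cross_corrs"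
  by code_simp

text \<open>The hypotheses put \<open>g1\<close> and \<open>g2\<close>, \<open>g1\<close> and
  \<open>h1\<close>, \<open>g2\<close> and \<open>h2\<close> into opposite families, so that both
  correlations in the conclusions are cross-correlations. The two conclusions serve for the two
  orientations of the last pair of cycles in \<open>no_cycle_nine\<close>.\<close>

lemma triples9_no_match:
  assumes mem: "g1 \<in> set triples9" "g2 \<in> set triples9" "h1 \<in> set triples9" "h2 \<in> set triples9"
    and g: "map2 (+) (corr9 g1 g1) (corr9 g2 g2) = [6, 1, 1, 2, 2, 2, 2, 1, 1]"
    and gh1: "map2 (+) (corr9 g1 g1) (corr9 h1 h1) = [6, 1, 1, 2, 2, 2, 2, 1, 1]"
    and gh2: "map2 (+) (corr9 g2 g2) (corr9 h2 h2) = [6, 1, 1, 2, 2, 2, 2, 1, 1]"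
  shows "corr9 g1 h1 \<noteq> replicate 9 c"
    "map2 (+) (corr9 g1 h1) (corr9 g2 h2) \<noteq> replicate 9 2"
proof -
  let ?A = "[3, 1, 0, 1, 1, 1, 1, 0, 1 :: nat]" and ?B = "[3, 0, 1, 1, 1, 1, 1, 1, 0 :: nat]"
  have AB: "?A \<noteq> ?B" "?A \<notin> set other_autocorrs" "?B \<notin> set other_autocorrs"
    by (simp_all add: other_autocorrs_def)
  have cases: "corr9 a a = ?A \<and> a \<in> set triples_134 \<or> corr9 a a = ?B \<and> a \<in> set triples_234
      \<or> corr9 a a \<in> set other_autocorrs" if "a \<in> set triples9" for a
    using autocorr_cases that by (simp add: list_all_iff)
  have pairs: "corr9 a a = ?A \<and> corr9 b b = ?B \<or> corr9 b b = ?A \<and> corr9 a a = ?B"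
    if "a \<in> set triples9" "b \<in> set triples9"
      "map2 (+) (corr9 a a) (corr9 b b) = [6, 1, 1, 2, 2, 2, 2, 1, 1]" for a b
  proof -
    have a: "corr9 a a \<in> set (?A # ?B # other_autocorrs)" and b: "corr9 b b \<in> set (?A # ?B # other_autocorrs)"
      using cases that(1,2) by auto
    show ?thesis using autocorr_pairs[unfolded list_all_iff, rule_format, OF a b that(3)] .
  qed
  have types: "a \<in> set triples_134 \<and> b \<in> set triples_234 \<or> b \<in> set triples_134 \<and> a \<in> set triples_234"
    if "a \<in> set triples9" "b \<in> set triples9"
      "map2 (+) (corr9 a a) (corr9 b b) = [6, 1, 1, 2, 2, 2, 2, 1, 1]" for a b
    using pairs[OF that] cases[OF that(1)] cases[OF that(2)] AB by metis
  have cross: "corr9 a b \<in> set cross_corrs" if "a \<in> set triples9" "b \<in> set triples9"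
      "map2 (+) (corr9 a a) (corr9 b b) = [6, 1, 1, 2, 2, 2, 2, 1, 1]" for a b
    using types[OF that] corr9_cross unfolding list_all_iff by blast
  show "corr9 g1 h1 \<noteq> replicate 9 c"
  proof
    assume "corr9 g1 h1 = replicate 9 c"
    then have "corr9 g1 h1 = replicate 9 (hd (corr9 g1 h1))" by simp
    then show False
      using cross[OF mem(1,3) gh1] cross_corrs_no_match unfolding list_all_iff by blast
  qed
  show "map2 (+) (corr9 g1 h1) (corr9 g2 h2) \<noteq> replicate 9 2"
    using cross[OF mem(1,3) gh1] cross[OF mem(2,4) gh2] cross_corrs_no_match
    unfolding list_all_iff by blast
qed

lemma corr9_periodic:
  assumes q: "\<And>t. q (t + 9) = (q t :: bool)" and j: "j < 9"
  shows "int (corr9 (map (\<lambda>s. p (int s)) [0..<9]) (map (\<lambda>s. q (int s)) [0..<9]) ! j)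
    = (\<Sum>s\<in>{0..<9}. of_bool (p s \<and> q (s + int j)))"
proof -
  have qi: "q (t + 9 * i) = q t" for t i
  proof (induction i rule: int_induct[of _ 0])
    case (step1 i)
    then show ?case using q[of "t + 9 * i"] by (simp add: algebra_simps)
  next
    case (step2 i)
    then show ?case using q[of "t + 9 * (i - 1)"] by (simp add: algebra_simps)
  qed simp
  have qm: "q (t mod 9) = q t" for t
    using qi[of "t mod 9" "t div 9"] by simp
  have "int (corr9 (map (\<lambda>s. p (int s)) [0..<9]) (map (\<lambda>s. q (int s)) [0..<9]) ! j)
      = int (length (filter (\<lambda>s. p (int s) \<and> q (int ((s + j) mod 9))) [0..<9]))"
    using j unfolding corr9_def
    by (subst nth_map) (auto intro!: arg_cong[where f = length] filter_cong)
  also have "\<dots> = int (card {s \<in> {0..<9}. p (int s) \<and> q (int ((s + j) mod 9))})"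
    by (simp add: distinct_card[symmetric])
  also have "\<dots> = (\<Sum>s\<in>{0..<9::nat}. of_bool (p (int s) \<and> q (int s + int j)))"
    by (subst int_card_filter) (simp_all add: zmod_int qm)
  also have "\<dots> = (\<Sum>s\<in>{0..<9::int}. of_bool (p s \<and> q (s + int j)))"
    by (rule sum.reindex_bij_witness[of _ nat int]) auto
  finally show ?thesis .
qed

section \<open>Exclusion of cycles of length nine\<close>

context biadjacency
begin

lemma shift9:
  assumes c: "P.is_cycle c n" and d: "B.is_cycle d 9"
  shows "\<exists>e. (e = 1 \<or> e = - 1) \<and> (\<forall>k j. I (c k) (d j) = I (c 0) (d (j - e * k)))"
proof -
  define f where "f k j = (of_bool (I (c k) (d j)) :: int)" for k j
  have per: "f k (j + 9) = f k j" for k j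
    using B.cycle_eq_iff[OF d, of "j + 9" j] by (simp add: f_def)
  have "(\<forall>k j. f (k + 1) (j + 1) = f k j) \<or> (\<forall>k j. f (k + 1) (j - 1) = f k j)"
    using wave[OF c d] per by (intro wave_odd_period[where m = 9]) (auto simp: f_def)
  then obtain e where e: "e = 1 \<or> e = - 1" "\<And>k j. f (k + 1) (j + e) = f k j"
    by (metis diff_conv_add_uminus)
  then have "I (c k) (d j) = I (c 0) (d (j - e * k))" for k j
    using diagonal_shift[of f e k j] by (auto simp: f_def of_bool_def split: if_splits)
  then show ?thesis using e(1) by blast
qed

text \<open>\<open>c 9\<close> and \<open>c 0\<close> lie in the same three blocks of
  \<open>d\<close>, one more than distinct points may share. So they coincide and \<open>n\<close>
  divides 9.\<close>

lemma cycle_length_nine: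
  assumes c: "P.is_cycle c n" and d: "B.is_cycle d 9"
  shows "n = 3 \<or> n = 9"
proof -
  obtain e where e: "e = 1 \<or> e = - 1" "\<And>k j. I (c k) (d j) = I (c 0) (d (j - e * k))"
    using shift9[OF assms] by blast
  have "c 9 = c 0"
  proof (rule ccontr)
    assume ne: "c 9 \<noteq> c 0"
    have "I (c 9) (d j) = I (c 0) (d j)" for j
      using e(1) e(2)[of 9 j] B.cycle_eq_iff[OF d, of "j - e * 9" j] by auto
    then have "{x \<in> range d. I (c 0) x} \<subseteq> {x \<in> B. I (c 9) x \<and> I (c 0) x}"
      using B.cycle_in[OF d] by auto
    then have "card {x \<in> range d. I (c 0) x} \<le> codeg (c 9) (c 0)"
      unfolding codeg_def using B.fin by (intro card_mono) auto
    moreover have "3 * card {x \<in> range d. I (c 0) x} = 9"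
      using biadjacency.closed_block_card[OF dual B.closed_cycle[OF d] P.cycle_in[OF c]]
        B.card_range_cycle[OF d] by simp
    ultimately show False
      using codeg_le_2[OF P.cycle_in[OF c] P.cycle_in[OF c] ne] by simp
  qed
  then have "int n dvd int 9" using P.cycle_eq_iff[OF c, of 9 0] by simp
  then have "n dvd 9" by presburger
  moreover have "m = 1 \<or> m = 3 \<or> m = 9" if "m dvd 9" for m :: nat
  proof -
    have "m \<le> 9" using that by (auto dest: dvd_imp_le)
    then have "m \<in> {0, 1, 2, 3, 4, 5, 6, 7, 8, 9}" by auto
    then show ?thesis using that by auto
  qed
  ultimately show ?thesis using P.cycle_length[OF c] by fastforce
qed

text \<open>At most six points lie on triangles, so every closed set of more than six points
  contains a cycle of length nine; this applies to all points and again to what the first such cycle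
  leaves.\<close>

lemma two_nine_cycles:
  assumes d: "B.is_cycle d 9"
  obtains c1 c2 where "P.is_cycle c1 9" "P.is_cycle c2 9" "range c1 \<inter> range c2 = {}"
    "range c1 \<union> range c2 = P"
proof -
  have tb: "card P.tris \<le> 6" using tris_bound(3)[OF d] by simp
  have long: "\<exists>c. P.is_cycle c 9 \<and> range c \<subseteq> C" if C: "P.closed C" "card C > 6" for C
  proof -
    have "\<not> C \<subseteq> P.tris"
      using that tb card_mono[of P.tris C] finite_subset[OF P.tris_subset P.fin] by auto
    then obtain u where u: "u \<in> C" "u \<notin> P.tris" by blast
    then have "u \<in> P" using C by (auto simp: P.closed_def)
    then obtain c n where c: "P.is_cycle c n" "c 0 = u" using P.cycle_exists by blast
    then have "n = 9" using cycle_length_nine[OF c(1) d] P.cycle_tris_iff[OF c(1), of 0] u by auto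
    then show ?thesis using c u P.closed_cycle_subset[OF c(1) C(1)] by auto
  qed
  have "P.closed P" using P.wf2 by (auto simp: P.closed_def)
  then obtain c1 where c1: "P.is_cycle c1 9" "range c1 \<subseteq> P"
    using long[of P] card_P by auto
  have "card (P - range c1) = 9"
    using c1 P.card_range_cycle[OF c1(1)] card_P P.fin by (simp add: card_Diff_subset finite_subset)
  moreover have "P.closed (P - range c1)"
    using \<open>P.closed P\<close> P.closed_cycle[OF c1(1)] by (rule P.closed_diff)
  ultimately obtain c2 where c2: "P.is_cycle c2 9" "range c2 \<subseteq> P - range c1"
    using long[of "P - range c1"] by auto
  have "range c2 = P - range c1"
    using c2 P.card_range_cycle[OF c2(1)] \<open>card (P - range c1) = 9\<close> P.fin
    by (intro card_subset_eq) auto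
  then show ?thesis using that[OF c1(1) c2(1)] c1(2) by blast
qed

lemma card_two_cycles:
  assumes "P.is_cycle c1 n" "P.is_cycle c2 m" "range c1 \<inter> range c2 = {}" "range c1 \<union> range c2 = P"
  shows "int (card {u \<in> P. Q u}) =
    (\<Sum>k\<in>{0..<int n}. of_bool (Q (c1 k))) + (\<Sum>k\<in>{0..<int m}. of_bool (Q (c2 k)))"
proof -
  have *: "(\<Sum>u\<in>range c. of_bool (Q u)) = (\<Sum>k\<in>{0..<int n}. of_bool (Q (c k)) :: int)"
    if "P.is_cycle c n" for c n
    unfolding P.range_cycle[OF that] using P.inj_on_cycle[OF that] by (simp add: sum.reindex del: sum_of_bool_eq)
  have "int (card {u \<in> P. Q u}) = (\<Sum>u\<in>range c1 \<union> range c2. of_bool (Q u))"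
    using int_card_filter[OF P.fin] assms(4) by simp
  also have "\<dots> = (\<Sum>u\<in>range c1. of_bool (Q u)) + (\<Sum>u\<in>range c2. of_bool (Q u))"
    using assms(3) P.range_cycle[OF assms(1)] P.range_cycle[OF assms(2)]
    by (intro sum.union_disjoint) auto
  finally show ?thesis unfolding *[OF assms(1)] *[OF assms(2)] .
qed

lemma no_cycle_nine: "\<not> B.is_cycle d 9"
proof
  assume d: "B.is_cycle d 9"
  interpret D: biadjacency B S P R "\<lambda>x u. I u x" by (rule dual)
  obtain p1 p2 where p: "P.is_cycle p1 9" "P.is_cycle p2 9" "range p1 \<inter> range p2 = {}" "range p1 \<union> range p2 = P"
    using two_nine_cycles[OF d] .
  obtain d1 q2 where q: "B.is_cycle d1 9" "B.is_cycle q2 9" "range d1 \<inter> range q2 = {}" "range d1 \<union> range q2 = B"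
    using D.two_nine_cycles[OF p(1)] .
  \<comment> \<open>Reversing cycles of points makes both patterns against \<open>d1\<close> run in
    the positive direction, and \<open>d2\<close> is then reversed to fit \<open>c1\<close>. The
    sign \<open>e\<close> of the fourth pattern cannot be normalised any more.\<close>
  have orient: "\<exists>c'. P.is_cycle c' 9 \<and> range c' = range c \<and> (\<forall>k j. I (c' k) (d1 j) = I (c' 0) (d1 (j - k)))"
    if c: "P.is_cycle c 9" for c
  proof -
    obtain e where e: "e = 1 \<or> e = - 1" "\<And>k j. I (c k) (d1 j) = I (c 0) (d1 (j - e * k))"
      using shift9[OF c q(1)] by blast
    have "range (\<lambda>k. c (0 + e * k)) = range c"
      using P.range_cycle_reparam[OF c e(1), of 0] .
    moreover have "I (c (0 + e * k)) (d1 j) = I (c (0 + e * 0)) (d1 (j - k))" for k j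
      using e(1) e(2)[of "e * k" j] by auto
    ultimately show ?thesis using P.cycle_reparam[OF c e(1), of 0] by blast
  qed
  obtain c1 where c1: "P.is_cycle c1 9" "range c1 = range p1" "\<And>k j. I (c1 k) (d1 j) = I (c1 0) (d1 (j - k))"
    using orient[OF p(1)] by blast
  obtain c2 where c2: "P.is_cycle c2 9" "range c2 = range p2" "\<And>k j. I (c2 k) (d1 j) = I (c2 0) (d1 (j - k))"
    using orient[OF p(2)] by blast
  obtain e1 where e1: "e1 = 1 \<or> e1 = - 1" "\<And>k j. I (c1 k) (q2 j) = I (c1 0) (q2 (j - e1 * k))"
    using shift9[OF c1(1) q(2)] by blast
  define d2 where "d2 j = q2 (0 + e1 * j)" for j
  have d2: "B.is_cycle d2 9" "range d2 = range q2"
  proof -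
    have "d2 = (\<lambda>j. q2 (0 + e1 * j))" by (simp add: d2_def fun_eq_iff)
    then show "B.is_cycle d2 9" "range d2 = range q2"
      using B.cycle_reparam[OF q(2) e1(1), of 0] B.range_cycle_reparam[OF q(2) e1(1), of 0]
      by (simp_all only:)
  qed
  have c1d2: "I (c1 k) (d2 j) = I (c1 0) (d2 (j - k))" for k j
    using e1(1) e1(2)[of k "e1 * j"] by (auto simp: d2_def algebra_simps)
  obtain e where e: "e = 1 \<or> e = - 1" "\<And>k j. I (c2 k) (d2 j) = I (c2 0) (d2 (j - e * k))"
    using shift9[OF c2(1) d2(1)] by blast
  note cc = c1(1) c2(1) p(3,4)[folded c1(2) c2(2)]
  note dd = q(1) d2(1) q(3,4)[folded d2(2)]
  define g1 where "g1 t = I (c1 0) (d1 t)" for t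
  define g2 where "g2 t = I (c2 0) (d1 t)" for t
  define h1 where "h1 t = I (c1 0) (d2 t)" for t
  define h2 where "h2 t = I (c2 0) (d2 t)" for t
  have F: "I (c1 k) (d1 j) = g1 (j - k)" "I (c2 k) (d1 j) = g2 (j - k)" "I (c1 k) (d2 j) = h1 (j - k)"
    "I (c2 k) (d2 j) = h2 (j - e * k)" for k j
    using c1(3) c2(3) c1d2 e(2) by (auto simp: g1_def g2_def h1_def h2_def)
  have per: "g1 (t + 9) = g1 t" "g2 (t + 9) = g2 t" "h1 (t + 9) = h1 t" "h2 (t + 9) = h2 t" for t
    using B.cycle_eq_iff[OF dd(1), of "t + 9" t] B.cycle_eq_iff[OF dd(2), of "t + 9" t]
    by (simp_all add: g1_def g2_def h1_def h2_def)
  define L where "L p = map (\<lambda>s. p (int s)) [0..<9]" for p :: "int \<Rightarrow> bool"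
  define K where "K p q j = (\<Sum>s\<in>{0..<9}. of_bool (p s \<and> q (s + j)) :: int)" for p q :: "int \<Rightarrow> bool" and j :: int
  have LK: "int (corr9 (L p) (L q) ! j) = K p q (int j)" if "\<And>t. q (t + 9) = q t" "j < 9" for p q j
    unfolding L_def K_def using that by (rule corr9_periodic)
  have neg: "(\<Sum>k\<in>{0..<9}. of_bool (p (- k) \<and> q (j - k))) = K p q j"
    if "\<And>t. p (t + 9) = p t" "\<And>t. q (t + 9) = q t" for p q j
    unfolding K_def using sum_periodic_uminus[of "\<lambda>s. of_bool (p s \<and> q (s + j)) :: int" 9] that
      that(2)[of "_ + j"] by (simp add: algebra_simps del: sum_of_bool_eq)
  define T where "T j = (2 + 4 * of_bool (9 dvd j) - of_bool (9 dvd j + 1) - of_bool (9 dvd j - 1)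
    - of_bool (9 dvd j + 2) - of_bool (9 dvd j - 2) :: int)" for j :: int
  have Tm: "T (0 - j) = T j" for j
  proof -
    have *: "(9 dvd 0 - j) = (9 dvd j)" "(9 dvd 0 - j + 1) = (9 dvd j - 1)" "(9 dvd 0 - j - 1) = (9 dvd j + 1)"
      "(9 dvd 0 - j + 2) = (9 dvd j - 2)" "(9 dvd 0 - j - 2) = (9 dvd j + 2)"
      by presburger+
    show ?thesis unfolding T_def * by simp
  qed
  have kg: "K g1 g1 j + K g2 g2 j = T j" for j
  proof -
    have "int (D.codeg (d1 0) (d1 j)) = T j"
      using D.codeg_cycle[OF dd(1), of 0 j] unfolding Tm[of j, symmetric] by (simp only: T_def of_nat_numeral)
    moreover have "int (D.codeg (d1 0) (d1 j)) = K g1 g1 j + K g2 g2 j"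
      unfolding D.codeg_def card_two_cycles[OF cc] F using neg per by simp
    ultimately show ?thesis by simp
  qed
  have kgh: "K g1 g1 j + K h1 h1 j = T j" "K g2 g2 j + K h2 h2 j = T j" for j
  proof -
    have "int (codeg (c1 0) (c1 (- j))) = T j" "int (codeg (c2 0) (c2 (- e * j))) = T j"
    proof -
      have "int (codeg (c1 0) (c1 (- j))) = T (0 - - j)"
        using codeg_cycle[OF cc(1), of 0 "- j"] by (simp only: T_def of_nat_numeral)
      then show "int (codeg (c1 0) (c1 (- j))) = T j" by simp
      have "int (codeg (c2 0) (c2 (- e * j))) = T (0 - - e * j)"
        using codeg_cycle[OF cc(2), of 0 "- e * j"] by (simp only: T_def of_nat_numeral)
      also have "\<dots> = T j" using e(1) Tm[of j] by auto
      finally show "int (codeg (c2 0) (c2 (- e * j))) = T j" .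
    qed
    moreover have "int (codeg (c1 0) (c1 (- j))) = K g1 g1 j + K h1 h1 j"
      unfolding codeg_def D.card_two_cycles[OF dd] F by (simp add: K_def del: sum_of_bool_eq)
    moreover have "int (codeg (c2 0) (c2 (- e * j))) = K g2 g2 (e * j) + K h2 h2 j"
      unfolding codeg_def D.card_two_cycles[OF dd] F using e(1) by (auto simp: K_def simp del: sum_of_bool_eq)
    moreover have "K g2 g2 (- j) = K g2 g2 j"
      using sum_periodic_shift[of "\<lambda>s. of_bool (g2 s \<and> g2 (s - j)) :: int" 9 j] per(2) per(2)[of "_ - j"]
      by (simp add: K_def algebra_simps conj_commute del: sum_of_bool_eq)
    ultimately show "K g1 g1 j + K h1 h1 j = T j" "K g2 g2 j + K h2 h2 j = T j" 
      using e(1) by auto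
  qed
  \<comment> \<open>Blocks on different cycles are joined neither by an edge nor by a path of length
    two, so they share exactly two points.\<close>
  have cross: "(\<Sum>k\<in>{0..<9}. of_bool (g1 (i - k) \<and> h1 (j - k)))
      + (\<Sum>k\<in>{0..<9}. of_bool (g2 (i - k) \<and> h2 (j - e * k))) = (2 :: int)" for i j
  proof -
    have nr: "d2 j \<notin> range d1" using dd(3) by blast
    have clo: "S y z \<Longrightarrow> y \<in> range d1 \<Longrightarrow> z \<in> range d1" for y z
      using B.range_cycle_closed[OF dd(1)] by blast
    have "d1 i \<noteq> d2 j" using nr by (metis rangeI)
    moreover have "\<not> S (d1 i) (d2 j)" using nr clo by blast
    moreover have "\<not> (S (d1 i) z \<and> S z (d2 j))" for z using nr clo by blast
    then have "{z. S (d1 i) z \<and> S z (d2 j)} = {}" by blast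
    then have "card {z. S (d1 i) z \<and> S z (d2 j)} = 0" by (simp only: card.empty)
    ultimately have "int (D.codeg (d1 i) (d2 j)) = 2"
      unfolding D.codeg_def using codeg_B[OF B.cycle_in[OF dd(1)] B.cycle_in[OF dd(2)], of i j] by (simp del: card_eq_0_iff)
    then show ?thesis unfolding D.codeg_def card_two_cycles[OF cc] F by simp
  qed
  have len: "length (corr9 a b) = 9" for a b by (simp add: corr9_def)
  have mem: "L p \<in> set triples9" if "3 * (\<Sum>s\<in>{0..<int 9}. of_bool (p s)) = int 9" for p
  proof -
    have "int (length (filter id (L p))) = int (card {s \<in> {0..<9}. p (int s)})"
      unfolding L_def by (simp add: filter_map comp_def distinct_card[symmetric])
    also have "\<dots> = (\<Sum>s\<in>{0..<9::nat}. of_bool (p (int s)))" by (subst int_card_filter) simp_all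
    also have "\<dots> = (\<Sum>s\<in>{0..<int 9}. of_bool (p s))"
      by (rule sum.reindex_bij_witness[of _ nat int]) auto
    finally have "length (filter id (L p)) = 3" using that by linarith
    then show ?thesis by (auto simp: triples9_def set_n_lists L_def)
  qed
  have mems: "L g1 \<in> set triples9" "L g2 \<in> set triples9" "L h1 \<in> set triples9" "L h2 \<in> set triples9"
    unfolding g1_def g2_def h1_def h2_def
    by (intro mem D.sum_cycle dd P.cycle_in[OF cc(1)] P.cycle_in[OF cc(2)])+
  have Tl: "T (int j) = int ([6, 1, 1, 2, 2, 2, 2, 1, 1] ! j)" if "j < 9" for j
  proof -
    have "j \<in> {0, 1, 2, 3, 4, 5, 6, 7, 8}" using that by auto
    then show ?thesis by (auto simp: T_def)
  qed
  have m2: "map2 (+) (corr9 (L p) (L p)) (corr9 (L q) (L q)) = [6, 1, 1, 2, 2, 2, 2, 1, 1]"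
    if "\<And>t. p (t + 9) = p t" "\<And>t. q (t + 9) = q t" "\<And>j. K p p j + K q q j = T j" for p q
  proof (rule nth_equalityI)
    fix j assume "j < length (map2 (+) (corr9 (L p) (L p)) (corr9 (L q) (L q)))"
    then have j: "j < 9" by (simp add: len)
    have "int (corr9 (L p) (L p) ! j) + int (corr9 (L q) (L q) ! j) = int ([6, 1, 1, 2, 2, 2, 2, 1, 1] ! j)"
      using LK[of p j p] LK[of q j q] that j Tl[OF j] by simp
    then show "map2 (+) (corr9 (L p) (L p)) (corr9 (L q) (L q)) ! j = [6, 1, 1, 2, 2, 2, 2, 1, 1] ! j"
      using j len by simp
  qed (simp add: len)
  note no = triples9_no_match[OF mems m2[OF per(1,2) kg] m2[OF per(1,3) kgh(1)] m2[OF per(2,4) kgh(2)]]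
  show False
  proof (cases "e = 1")
    case True
    have "K g1 h1 j + K g2 h2 j = 2" for j
      using cross[of 0 j] neg[of g1 h1 j] neg[of g2 h2 j] per True by simp
    then have "map2 (+) (corr9 (L g1) (L h1)) (corr9 (L g2) (L h2)) = replicate 9 2"
    proof (intro nth_equalityI, goal_cases)
      case (2 j)
      then have j: "j < 9" by (simp add: len)
      have "int (corr9 (L g1) (L h1) ! j) + int (corr9 (L g2) (L h2) ! j) = 2"
        using LK[of h1 j g1] LK[of h2 j g2] per j 2(1)[of "int j"] by simp
      then show ?case using j len by simp
    qed (simp add: len)
    then show False using no(2) by blast
  next
    case False
    then have e': "e = - 1" using e(1) by simp
    define \<beta> where "\<beta> = (\<Sum>k\<in>{0..<9}. of_bool (g2 (- k) \<and> h2 k) :: int)"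
    have K: "K g1 h1 j = 2 - \<beta>" for j
    proof -
      \<comment> \<open>Taking \<open>- i\<close> as the second index in \<open>cross\<close> makes
        the second sum independent of \<open>i\<close>. As 5 inverts 2 modulo 9,
        \<open>- 2 * i\<close> runs through all residues and is congruent to \<open>j\<close> for
        this \<open>i\<close>, so the first correlation is constant.\<close>
      define i where "i = - 5 * j"
      have m9: "g1 (x - 9) = g1 x" "h1 (x - 9) = h1 x" "g2 (x - 9) = g2 x" for x
        using per(1)[of "x - 9"] per(3)[of "x - 9"] per(2)[of "x - 9"] by simp_all
      define \<psi> where "\<psi> k = (of_bool (g1 (- k) \<and> h1 (- 2 * i - k)) :: int)" for k
      define \<chi> where "\<chi> k = (of_bool (g2 (- k) \<and> h2 k) :: int)" for k
      have per2: "\<psi> (t + 9) = \<psi> t" "\<chi> (t + 9) = \<chi> t" for t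
        using m9(1)[of "- t"] m9(2)[of "- 2 * i - t"] m9(3)[of "- t"] per(4)[of t]
        by (simp_all add: \<psi>_def \<chi>_def algebra_simps)
      have "(\<Sum>k\<in>{0..<9}. of_bool (g1 (i - k) \<and> h1 (- i - k))) = (\<Sum>k\<in>{0..<9}. \<psi> (- i + k))"
        by (simp add: \<psi>_def algebra_simps del: sum_of_bool_eq)
      also have "\<dots> = (\<Sum>k\<in>{0..<9}. \<psi> k)" by (intro sum_periodic_shift per2) simp
      also have "\<dots> = K g1 h1 (- 2 * i)" unfolding \<psi>_def by (rule neg) (rule per)+
      finally have "(\<Sum>k\<in>{0..<9}. of_bool (g1 (i - k) \<and> h1 (- i - k))) = K g1 h1 (- 2 * i)" .
      moreover have "(\<Sum>k\<in>{0..<9}. of_bool (g2 (i - k) \<and> h2 (- i + k))) = (\<Sum>k\<in>{0..<9}. \<chi> (- i + k))"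
        by (simp add: \<chi>_def algebra_simps del: sum_of_bool_eq)
      moreover have "\<dots> = (\<Sum>k\<in>{0..<9}. \<chi> k)" by (intro sum_periodic_shift per2) simp
      moreover have "\<dots> = \<beta>" by (simp add: \<chi>_def \<beta>_def del: sum_of_bool_eq)
      moreover have "K g1 h1 (- 2 * i) = K g1 h1 j"
      proof -
        have "d2 (s + 10 * j) = d2 (s + j)" for s by (simp add: B.cycle_eq_iff[OF dd(2)])
        then show ?thesis by (simp add: K_def h1_def i_def)
      qed
      ultimately show ?thesis using cross[of i "- i"] e' by simp
    qed
    have "corr9 (L g1) (L h1) = replicate 9 (nat (2 - \<beta>))"
    proof (rule nth_equalityI)
      fix j assume "j < length (corr9 (L g1) (L h1))"
      then have j: "j < 9" by (simp add: len)
      have "int (corr9 (L g1) (L h1) ! j) = 2 - \<beta>" using LK[of h1 j g1] per j K by simp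
      then show "corr9 (L g1) (L h1) ! j = replicate 9 (nat (2 - \<beta>)) ! j" using j by simp
    qed (simp add: len)
    then show False using no(1) by blast
  qed
qed

end

section \<open>Lengths of the cycles\<close>

context biadjacency
begin

lemma cycle_length_dvd: "P.is_cycle c n \<Longrightarrow> 3 dvd n"
  using closed_block_card[OF P.closed_cycle, of c n] P.card_range_cycle[of c n] card_B
  by (metis card.empty dvd_triv_left ex_in_conv zero_neq_numeral)

lemma long_cycle:
  assumes "u \<in> P" "u \<notin> P.tris"
  obtains c n where "P.is_cycle c n" "c 0 = u" "6 \<le> n"
proof -
  obtain c n where c: "P.is_cycle c n" "c 0 = u" using P.cycle_exists assms by blast
  then have "n \<noteq> 3" using P.cycle_tris_iff[OF c(1), of 0] assms by simp
  moreover have "3 dvd n" using cycle_length_dvd[OF c(1)] .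
  ultimately have "6 \<le> n" using P.cycle_length[OF c(1)] by presburger
  then show ?thesis using that c by blast
qed

text \<open>One long cycle on either side bounds the triangle vertices of the other side by six out
  of eighteen; this leaves a long cycle there as well, which bounds the first side in turn.\<close>

lemma all_or_few_tris:
  "(P.tris = P \<and> B.tris = B) \<or> (card P.tris \<le> 6 \<and> card B.tris \<le> 6)"
proof -
  interpret D: biadjacency B S P R "\<lambda>x u. I u x" by (rule dual)
  have 1: "card B.tris \<le> 6" if ne: "P.tris \<noteq> P"
  proof -
    obtain u where "u \<in> P" "u \<notin> P.tris" using ne P.tris_subset by blast
    then show ?thesis using long_cycle[of u] D.tris_bound(3) by metis
  qed
  have 2: "card P.tris \<le> 6" if ne: "B.tris \<noteq> B"
  proof -
    obtain u where "u \<in> B" "u \<notin> B.tris" using ne B.tris_subset by blast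
    then show ?thesis using D.long_cycle[of u] tris_bound(3) by metis
  qed
  show ?thesis using 1 2 card_P card_B by fastforce
qed

text \<open>A long cycle has a length between 6 and 9 divisible by 3, and 9 is excluded; the three
  remaining points can only form a triangle.\<close>

lemma closed_nine_structure:
  assumes few: "card P.tris \<le> 6" and C: "P.closed C" "card C = 9"
  obtains d t where "P.is_cycle d 6" "P.is_cycle t 3" "C = range d \<union> range t"
proof -
  interpret D: biadjacency B S P R "\<lambda>x u. I u x" by (rule dual)
  have CP: "C \<subseteq> P" using C by (auto simp: P.closed_def)
  have finC: "finite C" using CP P.fin finite_subset by blast
  have "\<not> C \<subseteq> P.tris"
    using few C(2) card_mono[of P.tris C] finite_subset[OF P.tris_subset P.fin] by auto
  then obtain u where u: "u \<in> C" "u \<notin> P.tris" by blast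
  then obtain d n where d: "P.is_cycle d n" "d 0 = u" "6 \<le> n" using long_cycle CP by blast
  have sub: "range d \<subseteq> C" using P.closed_cycle_subset[OF d(1) C(1)] u d by simp
  then have "n \<le> 9" using card_mono[OF finC sub] P.card_range_cycle[OF d(1)] C(2) by simp
  moreover have "n \<noteq> 9" using D.no_cycle_nine d(1) by blast
  ultimately have n: "n = 6" using d(3) cycle_length_dvd[OF d(1)] by presburger
  have card3: "card (C - range d) = 3"
    using sub n P.card_range_cycle[OF d(1)] C(2) finC by (simp add: card_Diff_subset finite_subset)
  then obtain v where v: "v \<in> C - range d" by (metis card.empty ex_in_conv zero_neq_numeral)
  then obtain t m where t: "P.is_cycle t m" "t 0 = v" using P.cycle_exists CP by blast
  have sub2: "range t \<subseteq> C - range d"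
    using P.closed_cycle_subset[OF t(1) P.closed_diff[OF C(1) P.closed_cycle[OF d(1)]]] v t by simp
  have "m \<le> 3" using card_mono[OF _ sub2] finC P.card_range_cycle[OF t(1)] card3 by simp
  then have m: "m = 3" using P.cycle_length[OF t(1)] by simp
  have "range t = C - range d"
    using sub2 card3 finC P.card_range_cycle[OF t(1)] m by (intro card_subset_eq) auto
  then have "C = range d \<union> range t" using sub by blast
  then show ?thesis using that[of d t] d(1) t(1) m n by blast
qed

end

section \<open>The hexagonal case: patterns between two cycles\<close>

text \<open>Two distinct residues modulo 6 that are not opposite are at distance 1 or 2.\<close>

lemma shift_pattern_iff:
  fixes g :: "int \<Rightarrow> bool"
  assumes per: "\<And>t. g (t + 6) = g t" and sum: "(\<Sum>t\<in>{0..<6}. of_bool (g t)) = (2 :: int)"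
    and disj: "\<And>t. \<not> (g t \<and> g (t + 3))"
  shows "\<exists>a w. (w = 1 \<or> w = 2) \<and> (\<forall>t. g t \<longleftrightarrow> (t - a) mod 6 \<in> {0, w})"
proof -
  have "g (t + 6 * i) = g t" for t i
  proof (induction i rule: int_induct[of _ 0])
    case (step1 i)
    then show ?case using per[of "t + 6 * i"] by (simp add: algebra_simps)
  next
    case (step2 i)
    then show ?case using per[of "t + 6 * (i - 1)"] by (simp add: algebra_simps)
  qed simp
  then have gm: "g t = g (t mod 6)" for t by (metis mod_mult_div_eq)
  have set6: "{0..<6 :: int} = {0, 1, 2, 3, 4, 5}" by auto
  have "\<exists>a w. (w = 1 \<or> w = 2) \<and> (\<forall>t\<in>{0..<6}. g t \<longleftrightarrow> (t - a) mod 6 \<in> {0, w})"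
  proof -
    have d: "\<not> (g 0 \<and> g 3)" "\<not> (g 1 \<and> g 4)" "\<not> (g 2 \<and> g 5)"
      using disj[of 0] disj[of 1] disj[of 2] by auto
    have s: "of_bool (g 0) + of_bool (g 1) + of_bool (g 2) + of_bool (g 3) + of_bool (g 4) + of_bool (g 5) = (2 :: int)"
      using sum unfolding set6 by (simp del: sum_of_bool_eq)
    consider "g 0 \<and> g 1" | "g 1 \<and> g 2" | "g 2 \<and> g 3" | "g 3 \<and> g 4" | "g 4 \<and> g 5" | "g 5 \<and> g 0"
      | "g 0 \<and> g 2" | "g 1 \<and> g 3" | "g 2 \<and> g 4" | "g 3 \<and> g 5" | "g 4 \<and> g 0" | "g 5 \<and> g 1"
      using d s by (auto simp: of_bool_def split: if_splits)
    then show ?thesis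
    proof cases
      case 1 then show ?thesis using s by (intro exI[of _ 0] exI[of _ 1]) (auto simp: set6 of_bool_def split: if_splits)
    next case 2 then show ?thesis using s by (intro exI[of _ 1] exI[of _ 1]) (auto simp: set6 of_bool_def split: if_splits)
    next case 3 then show ?thesis using s by (intro exI[of _ 2] exI[of _ 1]) (auto simp: set6 of_bool_def split: if_splits)
    next case 4 then show ?thesis using s by (intro exI[of _ 3] exI[of _ 1]) (auto simp: set6 of_bool_def split: if_splits)
    next case 5 then show ?thesis using s by (intro exI[of _ 4] exI[of _ 1]) (auto simp: set6 of_bool_def split: if_splits)
    next case 6 then show ?thesis using s by (intro exI[of _ 5] exI[of _ 1]) (auto simp: set6 of_bool_def split: if_splits)
    next case 7 then show ?thesis using s by (intro exI[of _ 0] exI[of _ 2]) (auto simp: set6 of_bool_def split: if_splits)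
    next case 8 then show ?thesis using s by (intro exI[of _ 1] exI[of _ 2]) (auto simp: set6 of_bool_def split: if_splits)
    next case 9 then show ?thesis using s by (intro exI[of _ 2] exI[of _ 2]) (auto simp: set6 of_bool_def split: if_splits)
    next case 10 then show ?thesis using s by (intro exI[of _ 3] exI[of _ 2]) (auto simp: set6 of_bool_def split: if_splits)
    next case 11 then show ?thesis using s by (intro exI[of _ 4] exI[of _ 2]) (auto simp: set6 of_bool_def split: if_splits)
    next case 12 then show ?thesis using s by (intro exI[of _ 5] exI[of _ 2]) (auto simp: set6 of_bool_def split: if_splits)
    qed
  qed
  then obtain a w where aw: "w = 1 \<or> w = 2" "\<forall>t\<in>{0..<6}. g t \<longleftrightarrow> (t - a) mod 6 \<in> {0, w}" by blast
  have "g t \<longleftrightarrow> (t - a) mod 6 \<in> {0, w}" for t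
    using gm[of t] aw(2) by (simp add: mod_diff_left_eq)
  then show ?thesis using aw(1) by blast
qed

text \<open>Each of the two valency classes of blocks is a hexagon and a triangle. In the
  application \<open>d3\<close> and \<open>t3\<close> have valency 8, \<open>d2\<close> and
  \<open>t2\<close> valency 14.\<close>

locale hexagonal = biadjacency +
  fixes d2 t2 d3 t3
  assumes d2: "B.is_cycle d2 6" and t2: "B.is_cycle t2 3" and d3: "B.is_cycle d3 6" and t3: "B.is_cycle t3 3"
    and cover: "B = range d2 \<union> range t2 \<union> (range d3 \<union> range t3)"
begin

lemma hex_not_tris: "d2 j \<notin> B.tris" "d3 j \<notin> B.tris"
  using B.cycle_tris_iff[OF d2] B.cycle_tris_iff[OF d3] by auto

lemma tris_B: "B.tris = range t2 \<union> range t3"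
  using B.cycle_tris_iff[OF t2] B.cycle_tris_iff[OF t3] hex_not_tris cover B.tris_subset by auto

lemma card_tris_B: "6 \<le> card B.tris"
proof -
  have "card B \<le> card (range d2 \<union> range d3) + card (range t2 \<union> range t3)"
    unfolding cover by (metis (no_types, lifting) Un_assoc Un_left_commute card_Un_le)
  moreover have "card (range d2 \<union> range d3) \<le> 12"
    using card_Un_le[of "range d2" "range d3"] B.card_range_cycle[OF d2] B.card_range_cycle[OF d3] by simp
  ultimately show ?thesis using card_B tris_B by simp
qed

text \<open>Points at distance 3 on a long cycle share two blocks, and two shared blocks already lie
  on triangles. So none is left on the hexagons, which is the disjointness required by
  \<open>wave_half_period\<close>.\<close>

lemma codeg_dist3_in_tris:
  assumes c: "P.is_cycle c n" "6 \<le> n" and x: "x \<in> B" "I (c k) x" "I (c (k + 3)) x"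
  shows "x \<in> B.tris"
proof -
  note D = biadjacency.tris_bound(1,2)[OF dual c, where j = k]
  have "3 * card {x \<in> B.tris. I (c k) x} = card B.tris"
    using biadjacency.closed_block_card[OF dual B.closed_tris P.cycle_in[OF c(1)]] .
  then have "2 \<le> card {x \<in> B.tris. I (c k) x}" using card_tris_B by simp
  then have "{x \<in> B.tris. I (c k) x} = {x \<in> B. I (c k) x \<and> I (c (k + 3)) x}"
    using D(1,2) B.fin by (intro card_seteq) auto
  then show ?thesis using x by auto
qed

lemma hex_pattern:
  assumes c: "P.is_cycle c n" "6 \<le> n" and d: "d = d2 \<or> d = d3"
  shows "\<exists>e a w. (e = 1 \<or> e = - 1) \<and> (w = 1 \<or> w = 2) \<and>
    (\<forall>k j. I (c k) (d j) \<longleftrightarrow> (j - e * k - a) mod 6 \<in> {0, w})"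
proof -
  define f where "f k j = (of_bool (I (c k) (d j)) :: int)" for k j
  have dc: "B.is_cycle d 6" using d d2 d3 by auto
  have ndisj: "\<not> (I (c k) (d j) \<and> I (c (k + 3)) (d j))" for k j
    using codeg_dist3_in_tris[OF c, of "d j" k] hex_not_tris[of j] d B.cycle_in[OF dc] by auto
  have "(\<forall>k j. f (k + 1) (j + 1) = f k j) \<or> (\<forall>k j. f (k + 1) (j - 1) = f k j)"
    using wave[OF c(1) dc] ndisj by (intro wave_half_period) (auto simp: f_def)
  then obtain e where e: "e = 1 \<or> e = - 1" "\<And>k j. f (k + 1) (j + e) = f k j"
    by (metis diff_conv_add_uminus)
  then have shift: "I (c k) (d j) = I (c 0) (d (j - e * k))" for k j
    using diagonal_shift[of f e k j] by (auto simp: f_def of_bool_def split: if_splits)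
  have per: "I (c 0) (d (t + 6)) = I (c 0) (d t)" for t
    using B.cycle_eq_iff[OF dc, of "t + 6" t] by simp
  have "3 * (\<Sum>t\<in>{0..<int 6}. of_bool (I (c 0) (d t))) = int 6"
    using biadjacency.sum_cycle[OF dual dc P.cycle_in[OF c(1)]] .
  then have "3 * (\<Sum>t\<in>{0..<6}. of_bool (I (c 0) (d t))) = (3 * 2 :: int)"
    by (simp del: sum_of_bool_eq)
  then have sum: "(\<Sum>t\<in>{0..<6}. of_bool (I (c 0) (d t))) = (2 :: int)"
    by (simp only: mult_cancel_left) simp
  \<comment> \<open>Three steps along \<open>c\<close> amount to three steps along \<open>d\<close>
    up to sign, so disjointness for points at distance 3 passes to blocks at distance 3.\<close>
  have disj: "\<not> (I (c 0) (d t) \<and> I (c 0) (d (t + 3)))" for t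
    using ndisj[of 0 "t + 3"] ndisj[of 0 t] shift[of 3 "t + 3"] shift[of 3 t] e(1) per[of "t - 3"] by (auto simp: algebra_simps)
  obtain a w where aw: "w = 1 \<or> w = 2" "\<And>t. I (c 0) (d t) \<longleftrightarrow> (t - a) mod 6 \<in> {0, w}"
    using shift_pattern_iff[of "\<lambda>t. I (c 0) (d t)", OF per sum disj] by blast
  have "I (c k) (d j) \<longleftrightarrow> (j - e * k - a) mod 6 \<in> {0, w}" for k j
    unfolding shift[of k j] aw(2) ..
  then show ?thesis using e(1) aw(1) by blast
qed

text \<open>All patterns, with hexagons and with triangles, repeat after six steps along
  \<open>c\<close>; so \<open>c 6\<close> and \<open>c 0\<close> share all six blocks, more than
  distinct points may.\<close>

lemma hex_length:
  assumes c: "P.is_cycle c n" "6 \<le> n"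
  shows "n = 6"
proof -
  have "I (c 6) x = I (c 0) x" if "x \<in> B" for x
  proof -
    have "I (c 6) (d j) = I (c 0) (d j)" if dd: "d = d2 \<or> d = d3" for d j
    proof -
      obtain e a w where e: "e = 1 \<or> e = - 1" "\<forall>k j. I (c k) (d j) \<longleftrightarrow> (j - e * k - a) mod 6 \<in> {0, w}"
        using hex_pattern[OF c dd] by blast
      have "(j - e * 6 - a) mod 6 = (j - e * 0 - a) mod 6"
        using e(1) by (auto simp: mod_eq_dvd_iff)
      then show ?thesis using e(2) by presburger
    qed
    moreover have "I (c 6) x = I (c 0) x" if "x \<in> B.tris"
      using biadjacency.tris_period[OF dual that c(1), of 0] biadjacency.tris_period[OF dual that c(1), of 3] by simp
    ultimately show ?thesis using that cover tris_B by blast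
  qed
  then have "{x \<in> B. I (c 6) x \<and> I (c 0) x} = {x \<in> B. I (c 0) x}" by auto
  then have "codeg (c 6) (c 0) = 6" unfolding codeg_def using deg_P P.cycle_in[OF c(1)] by simp
  then have "c 6 = c 0" using codeg_le_2[OF P.cycle_in[OF c(1)] P.cycle_in[OF c(1)]] by fastforce
  then have "int n dvd 6" using P.cycle_eq_iff[OF c(1), of 6 0] by simp
  then show ?thesis using c(2) by (auto dest: zdvd_imp_le)
qed

text \<open>Since 3 is not a difference of elements of {0, w} modulo 6, no point of a long cycle
  lies in both \<open>d3 0\<close> and \<open>d3 3\<close>. Their two common points are thus the
  triangle points in \<open>d3 0\<close>, a third of all triangle points.\<close>

lemma card_tris_P: "card P.tris = 6"
proof -
  note T = tris_bound(1,2)[OF d3 order_refl, of 0, simplified]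
  have "u \<in> P.tris" if u: "u \<in> P" "I u (d3 0)" "I u (d3 3)" for u
  proof (rule ccontr)
    assume "u \<notin> P.tris"
    then obtain c n where c: "P.is_cycle c n" "c 0 = u" "6 \<le> n" using long_cycle u by blast
    obtain e a w where e: "w = 1 \<or> w = (2 :: int)" "\<forall>k j. I (c k) (d3 j) \<longleftrightarrow> (j - e * k - a) mod 6 \<in> {0, w}"
      using hex_pattern[OF c(1,3), of d3] by blast
    then have "(- a) mod 6 \<in> {0, w}" "(3 - a) mod 6 \<in> {0, w}"
      using e(2)[rule_format, of 0 0] e(2)[rule_format, of 0 3] u c(2) by auto
    then show False using e(1) by auto presburger+
  qed
  then have "{u \<in> P.tris. I u (d3 0)} = {u \<in> P. I u (d3 0) \<and> I u (d3 3)}"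
    using T(1) by auto
  then show ?thesis
    using T(2) closed_block_card[OF P.closed_tris B.cycle_in[OF d3, of 0]] by simp
qed

end

section \<open>Executable rows of the incidence matrix in the hexagonal case\<close>

fun common :: "bool list \<Rightarrow> bool list \<Rightarrow> nat" where
  "common (a # as) (b # bs) = (if a \<and> b then Suc (common as bs) else common as bs)"
| "common _ _ = 0"

lemma common_map: "distinct xs \<Longrightarrow> common (map f xs) (map g xs) = card {x \<in> set xs. f x \<and> g x}"
proof (induction xs)
  case (Cons a xs)
  have "{x \<in> set (a # xs). f x \<and> g x} = (if f a \<and> g a then insert a else id) {x \<in> set xs. f x \<and> g x}"
    by auto
  then show ?case using Cons by auto
qed simp

definition hex_row :: "int \<times> int \<Rightarrow> int \<Rightarrow> int \<Rightarrow> bool list" where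
  "hex_row p w k = map (\<lambda>j. (j - fst p * k - snd p) mod 6 \<in> {0, w}) [0, 1, 2, 3, 4, 5]"

definition tri_row :: "int \<times> int \<Rightarrow> int list \<Rightarrow> int \<Rightarrow> bool list" where
  "tri_row p js k = map (\<lambda>j. (j - fst p * k - snd p) mod 3 = 0) js"

text \<open>The parameters are the unknown offsets and orientations of the incidences between the cycles
  in a normalised labelling; a row lists the incidences of a point with the blocks of the cycles
  \<open>d3\<close>, \<open>t3\<close>, \<open>d2\<close>, \<open>t2\<close>, in this order.\<close>

definition hex1_point :: "int \<times> int \<Rightarrow> int \<Rightarrow> bool list" where
  "hex1_point p k = hex_row (1, 0) 1 k @ tri_row (1, 0) [0, 1, 2] k @ hex_row p 2 k @ tri_row (1, 0) [0, 1, 2] k"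

definition hex2_point :: "int \<times> int \<Rightarrow> int \<times> int \<Rightarrow> int \<Rightarrow> bool list" where
  "hex2_point p q k = hex_row (1, 0) 2 k @ tri_row p [0, 1, 2] k @ hex_row (1, 0) 1 k @ tri_row q [0, 1, 2] k"

definition tri_point :: "int \<times> int \<Rightarrow> int \<times> int \<Rightarrow> int \<times> int \<Rightarrow> int \<Rightarrow> bool list" where
  "tri_point p q r k = tri_row (1, 0) [0, 1, 2, 3, 4, 5] k @ tri_row p [0, 1, 2] k @
     tri_row q [0, 1, 2, 3, 4, 5] k @ tri_row r [0, 1, 2] k"

definition offsets6 :: "(int \<times> int) list" where
  "offsets6 = [(1, 0), (1, 1), (1, 2), (1, 3), (1, 4), (1, 5), (- 1, 0), (- 1, 1), (- 1, 2), (- 1, 3), (- 1, 4), (- 1, 5)]"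

definition offsets3 :: "(int \<times> int) list" where
  "offsets3 = [(1, 0), (1, 1), (1, 2), (- 1, 0), (- 1, 1), (- 1, 2)]"

text \<open>The number 2 is the codegree of points on different cycles. The two solutions for
  \<open>p1\<close> and \<open>p2\<close> are identified by a reflection in
  \<open>labelling_aux\<close>.\<close>

lemma hex_points_search:
  "list_all (\<lambda>p0. list_all (\<lambda>p1. list_all (\<lambda>p2.
    list_all (\<lambda>k. list_all (\<lambda>l. common (hex1_point p0 k) (hex2_point p1 p2 l) = 2) [0, 1, 2, 3, 4, 5]) [0, 1, 2, 3, 4, 5] \<longrightarrow>
    p0 = (1, 2) \<and> (p1 = (1, 0) \<and> p2 = (1, 1) \<or> p1 = (1, 1) \<and> p2 = (1, 0)))
    offsets3) offsets3) offsets6"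
  by code_simp

text \<open>Every triangle of points is tested against both hexagons of points; the two solutions
  will belong to the two triangles. The primed version treats the other solution of
  \<open>hex_points_search\<close>.\<close>

lemma tri_points_search:
  "list_all (\<lambda>p. list_all (\<lambda>q. list_all (\<lambda>r.
    list_all (\<lambda>k. list_all (\<lambda>l. common (tri_point p q r k) (hex1_point (1, 2) l) = 2 \<and>
      common (tri_point p q r k) (hex2_point (1, 0) (1, 1) l) = 2) [0, 1, 2, 3, 4, 5]) [0, 1, 2] \<longrightarrow>
    (p, q, r) = ((1, 1), (1, 0), (1, 0)) \<or> (p, q, r) = ((1, 2), (1, 2), (1, 1)))
    offsets3) offsets3) offsets3"
  by code_simp

lemma tri_points_search':
  "list_all (\<lambda>p. list_all (\<lambda>q. list_all (\<lambda>r.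
    list_all (\<lambda>k. list_all (\<lambda>l. common (tri_point p q r k) (hex1_point (1, 2) l) = 2 \<and>
      common (tri_point p q r k) (hex2_point (1, 1) (1, 0) l) = 2) [0, 1, 2, 3, 4, 5]) [0, 1, 2] \<longrightarrow>
    (p, q, r) = ((1, 0), (1, 0), (1, 1)) \<or> (p, q, r) = ((1, 1), (1, 2), (1, 2)))
    offsets3) offsets3) offsets3"
  by code_simp

text \<open>Row and column sums 1 make a permutation matrix, and every permutation of Z/3 is affine
  with slope 1 or - 1.\<close>

lemma affine_pattern3:
  fixes F :: "int \<Rightarrow> int \<Rightarrow> bool"
  assumes per: "\<And>k j. F (k + 3) j = F k j" "\<And>k j. F k (j + 3) = F k j"
    and row: "\<And>k. of_bool (F k 0) + of_bool (F k 1) + of_bool (F k 2) = (1 :: int)"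
    and col: "\<And>j. of_bool (F 0 j) + of_bool (F 1 j) + of_bool (F 2 j) = (1 :: int)"
  shows "\<exists>e a. (e = 1 \<or> e = - 1) \<and> (\<forall>k j. F k j \<longleftrightarrow> (j - e * k - a) mod 3 = 0)"
proof -
  have 1: "F (k + 3 * i) j = F k j" for k j i
  proof (induction i rule: int_induct[of _ 0])
    case (step1 i)
    then show ?case using per(1)[of "k + 3 * i"] by (simp add: algebra_simps)
  next
    case (step2 i)
    then show ?case using per(1)[of "k + 3 * (i - 1)"] by (simp add: algebra_simps)
  qed simp
  have 2: "F k (j + 3 * i) = F k j" for k j i
  proof (induction i rule: int_induct[of _ 0])
    case (step1 i)
    then show ?case using per(2)[of k "j + 3 * i"] by (simp add: algebra_simps)
  next
    case (step2 i)
    then show ?case using per(2)[of k "j + 3 * (i - 1)"] by (simp add: algebra_simps)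
  qed simp
  have Fm: "F k j = F (k mod 3) (j mod 3)" for k j
  proof -
    have "F k j = F (k mod 3 + 3 * (k div 3)) (j mod 3 + 3 * (j div 3))" by (simp only: mod_mult_div_eq)
    then show ?thesis by (simp only: 1 2)
  qed
  have "\<exists>e a. (e = 1 \<or> e = - 1) \<and> (\<forall>k\<in>{0, 1, 2}. \<forall>j\<in>{0, 1, 2}. F k j \<longleftrightarrow> (j - e * k - a) mod 3 = 0)"
  proof -
    note r = row[of 0] row[of 1] row[of 2] col[of 0] col[of 1] col[of 2]
    consider "F 0 0 \<and> F 1 1 \<and> F 2 2" | "F 0 0 \<and> F 1 2 \<and> F 2 1" | "F 0 1 \<and> F 1 2 \<and> F 2 0"
      | "F 0 1 \<and> F 1 0 \<and> F 2 2" | "F 0 2 \<and> F 1 0 \<and> F 2 1" | "F 0 2 \<and> F 1 1 \<and> F 2 0"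
      using r by (auto simp: of_bool_def split: if_splits)
    then show ?thesis
    proof cases
      case 1 then show ?thesis using r by (intro exI[of _ 1] exI[of _ 0]) (auto simp: of_bool_def split: if_splits)
    next case 2 then show ?thesis using r by (intro exI[of _ "- 1"] exI[of _ 0]) (auto simp: of_bool_def split: if_splits)
    next case 3 then show ?thesis using r by (intro exI[of _ 1] exI[of _ 1]) (auto simp: of_bool_def split: if_splits)
    next case 4 then show ?thesis using r by (intro exI[of _ "- 1"] exI[of _ 1]) (auto simp: of_bool_def split: if_splits)
    next case 5 then show ?thesis using r by (intro exI[of _ 1] exI[of _ 2]) (auto simp: of_bool_def split: if_splits)
    next case 6 then show ?thesis using r by (intro exI[of _ "- 1"] exI[of _ 2]) (auto simp: of_bool_def split: if_splits)
    qed
  qed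
  then obtain e a where ea: "e = 1 \<or> e = - 1"
    "\<forall>k\<in>{0, 1, 2}. \<forall>j\<in>{0, 1, 2}. F k j \<longleftrightarrow> (j - e * k - a) mod 3 = 0" by blast
  have "F k j \<longleftrightarrow> (j - e * k - a) mod 3 = 0" for k j
  proof -
    have *: "x mod 3 \<in> {0, 1, 2}" for x :: int by (simp, presburger)
    have "F k j \<longleftrightarrow> F (k mod 3) (j mod 3)" by (rule Fm)
    also have "\<dots> \<longleftrightarrow> (j mod 3 - e * (k mod 3) - a) mod 3 = 0"
      using ea(2)[rule_format, OF * *] .
    also have "(j mod 3 - e * (k mod 3) - a) mod 3 = (j - e * k - a) mod 3"
      using ea(1) by (auto; presburger)
    finally show ?thesis .
  qed
  then show ?thesis using ea(1) by blast
qed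

section \<open>Orientations and offsets of patterns\<close>

context biadjacency
begin

text \<open>\<open>p\<close> consists of the orientation, 1 or - 1, and the offset. \<open>W\<close>
  is {0} as soon as a triangle is involved, and {0, 1} or {0, 2} between two hexagons.\<close>

definition pat :: "(int \<Rightarrow> 'a) \<Rightarrow> (int \<Rightarrow> 'b) \<Rightarrow> int \<Rightarrow> int set \<Rightarrow> int \<times> int \<Rightarrow> bool" where
  "pat c d m W p \<longleftrightarrow> (\<forall>k j. I (c k) (d j) \<longleftrightarrow> (j - fst p * k - snd p) mod m \<in> W)"

lemma pat_mod: "pat c d m W (e, a) \<Longrightarrow> pat c d m W (e, a mod m)"
  by (simp add: pat_def mod_diff_right_eq)

lemma pat_point_reparam:
  assumes "pat c d m W (e, a)" "e = 1 \<or> e = - 1"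
  shows "pat (\<lambda>k. c (- e * a + e * k)) d m W (1, 0)"
  using assms by (auto simp: pat_def algebra_simps)

text \<open>For \<open>e = - 1\<close> reversing the blocks exchanges the two ends of {0, w}. The
  map x -> w - x preserves this set, which explains the additional shift by
  \<open>w\<close>.\<close>

lemma pat_block_reparam:
  assumes "pat c d m {0, w} (e, a)" "e = 1 \<or> e = - 1" "0 \<le> w" "w < m"
  shows "\<exists>b. pat c (\<lambda>j. d (b + e * j)) m {0, w} (1, 0)"
proof (cases "e = 1")
  case True
  then show ?thesis using assms by (intro exI[of _ a]) (auto simp: pat_def algebra_simps)
next
  case False
  then have e: "e = - 1" using assms by simp
  have "x mod m = 0 \<or> x mod m = w \<longleftrightarrow> (w - x) mod m = 0 \<or> (w - x) mod m = w" for x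
  proof -
    have w: "w mod m = w" using assms(3,4) by simp
    have "(w - x) mod m = 0 \<longleftrightarrow> x mod m = w"
      using mod_eq_dvd_iff[of w m x] w by (auto simp: dvd_eq_mod_eq_0)
    moreover have "(w - x) mod m = w \<longleftrightarrow> x mod m = 0"
      using mod_eq_dvd_iff[of "w - x" m w] w by (simp add: dvd_eq_mod_eq_0[symmetric])
    ultimately show ?thesis by auto
  qed
  then have "(x mod m \<in> {0, w}) = ((w - x) mod m \<in> {0, w})" for x by simp
  from this[of "_ - _"] have "(w + k - j) mod m \<in> {0, w} \<longleftrightarrow> (j - k) mod m \<in> {0, w}" for k j
    by (simp only: diff_diff_eq2)
  moreover have "I (c k) (d (a + w + e * j)) \<longleftrightarrow> (w + k - j) mod m \<in> {0, w}" for k j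
    using assms(1) e by (simp add: pat_def algebra_simps)
  ultimately show ?thesis unfolding pat_def by (intro exI[of _ "a + w"]) simp
qed

lemma tri_pat:
  assumes w: "P.is_cycle w 3" and d: "B.is_cycle d m"
  shows "\<exists>p\<in>set offsets3. pat w d 3 {0} p"
proof -
  have "I (w (k + 3)) x = I (w k) x" for k x
    using P.cycle_eq_iff[OF w, of "k + 3" k] by simp
  moreover have "of_bool (I (w k) (d 0)) + of_bool (I (w k) (d 1)) + of_bool (I (w k) (d 2)) = (1 :: int)" for k
    using triangle_wave[OF w d, of k 1] by simp
  moreover have "of_bool (I (w 0) (d j)) + of_bool (I (w 1) (d j)) + of_bool (I (w 2) (d j)) = (1 :: int)" for j
    using triangle_sum[OF w B.cycle_in[OF d], of 1 j] by simp
  ultimately obtain e a where ea: "e = 1 \<or> e = - 1" "\<forall>k j. I (w k) (d j) \<longleftrightarrow> (j - e * k - a) mod 3 = 0"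
    using affine_pattern3[of "\<lambda>k j. I (w k) (d j)"] triangle_period[OF w d] by blast
  then have "pat w d 3 {0} (e, a mod 3)" by (intro pat_mod) (simp add: pat_def)
  moreover have "a mod 3 = 0 \<or> a mod 3 = 1 \<or> a mod 3 = 2" by presburger
  then have "(e, a mod 3) \<in> set offsets3" using ea(1) by (auto simp: offsets3_def)
  ultimately show ?thesis by blast
qed

text \<open>Solving k = e j + a for j gives j = e k - e a, because e e = 1: the orientation is kept
  and the offset becomes \<open>- e * a\<close>.\<close>

lemma pat_dual3:
  assumes "biadjacency.pat (\<lambda>x u. I u x) t c 3 {0} p" "p \<in> set offsets3"
  shows "\<exists>p\<in>set offsets3. pat c t 3 {0} p"
proof -
  obtain e a where p: "p = (e, a)" by fastforce
  have ea: "e = 1 \<or> e = - 1" using assms(2) p by (auto simp: offsets3_def)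
  have "I (c k) (t j) \<longleftrightarrow> (k - e * j - a) mod 3 = 0" for k j
    using assms(1) p unfolding biadjacency.pat_def[OF dual] by simp
  moreover have "(k - e * j - a) mod 3 = 0 \<longleftrightarrow> (j - e * k - (- e * a)) mod 3 = 0" for k j
    using ea by (auto, presburger+)
  ultimately have "pat c t 3 {0} (e, - e * a)" by (simp add: pat_def)
  then have "pat c t 3 {0} (e, (- e * a) mod 3)" by (rule pat_mod)
  moreover have "(- e * a) mod 3 = 0 \<or> (- e * a) mod 3 = 1 \<or> (- e * a) mod 3 = 2" by presburger
  then have "(e, (- e * a) mod 3) \<in> set offsets3" using ea by (auto simp: offsets3_def)
  ultimately show ?thesis by blast
qed

lemma tri_pat_block:
  assumes c: "P.is_cycle c n" and t: "B.is_cycle t 3"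
  shows "\<exists>p\<in>set offsets3. pat c t 3 {0} p"
  using biadjacency.tri_pat[OF dual t c] pat_dual3 by blast

lemma codeg_apart:
  assumes C: "P.closed C" and u: "u \<in> C" and v: "v \<in> P" "v \<notin> C"
  shows "codeg u v = 2"
proof -
  have clo: "\<And>x y. x \<in> C \<Longrightarrow> R x y \<Longrightarrow> y \<in> C" and "u \<in> P" using C u by (auto simp: P.closed_def)
  have "u \<noteq> v" "\<not> R u v" using u v clo by auto
  moreover have "{w. R u w \<and> R w v} = {}" using u v clo by blast
  then have "card {w. R u w \<and> R w v} = 0" by (simp only: card.empty)
  ultimately show ?thesis using codeg_P[OF \<open>u \<in> P\<close> v(1)] by (simp add: codeg_def del: card_eq_0_iff)
qed

lemma codeg_cycle_1:
  assumes "P.is_cycle c n" "6 \<le> n"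
  shows "codeg (c 0) (c 1) = 1"
proof -
  have "\<not> int n dvd 1" "\<not> int n dvd 2" "\<not> int n dvd 3"
    using assms(2) by (auto dest: zdvd_imp_le)
  then show ?thesis
    using codeg_cycle[OF assms(1), of 0 1] by (simp add: of_bool_def)
qed

end

section \<open>The hexagonal case: the two types of patterns between hexagons\<close>

context hexagonal
begin

lemma hex_pat:
  assumes c: "P.is_cycle c 6" and d: "d = d2 \<or> d = d3"
  shows "\<exists>p\<in>set offsets6. \<exists>w\<in>{1, 2}. pat c d 6 {0, w} p"
proof -
  obtain e a w where *: "e = 1 \<or> e = - 1" "w = 1 \<or> w = 2" "\<forall>k j. I (c k) (d j) \<longleftrightarrow> (j - e * k - a) mod 6 \<in> {0, w}"
    using hex_pattern[OF c order_refl d] by blast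
  then have "pat c d 6 {0, w} (e, a mod 6)" by (intro pat_mod) (simp add: pat_def)
  moreover have "a mod 6 = 0 \<or> a mod 6 = 1 \<or> a mod 6 = 2 \<or> a mod 6 = 3 \<or> a mod 6 = 4 \<or> a mod 6 = 5" by presburger
  then have "(e, a mod 6) \<in> set offsets6" using *(1) by (auto simp: offsets6_def)
  ultimately show ?thesis using *(2) by blast
qed

lemma pat_1_common: "pat c d 6 {0, 1} p \<Longrightarrow> p \<in> set offsets6 \<Longrightarrow> \<exists>k. I (c k) (d 0) \<and> I (c k) (d 1)"
  \<comment> \<open>For this index orientation times index plus offset is 0, the orientation being
    its own inverse.\<close>
  by (rule exI[of _ "- fst p * snd p"]) (auto simp: pat_def offsets6_def)

lemma pat_1_common': "pat c d 6 {0, 1} p \<Longrightarrow> p \<in> set offsets6 \<Longrightarrow> \<exists>j. I (c 0) (d j) \<and> I (c 1) (d j)"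
  by (rule exI[of _ "snd p + (if fst p = 1 then 1 else 0)"]) (auto simp: pat_def offsets6_def)

lemma pat_2_not_common: "pat c d 6 {0, 2} p \<Longrightarrow> \<not> (I (c k) (d 0) \<and> I (c k) (d 1))"
proof -
  have "\<not> (x mod 6 \<in> {0, 2} \<and> (1 + x) mod 6 \<in> {0, 2})" for x :: int by (simp, presburger)
  note * = this[of "0 - fst p * k - snd p"]
  assume p: "pat c d 6 {0, 2} p"
  have "1 - fst p * k - snd p = 1 + (0 - fst p * k - snd p)" by simp
  then have "I (c k) (d 1) \<longleftrightarrow> (1 + (0 - fst p * k - snd p)) mod 6 \<in> {0, 2}"
    using p by (simp only: pat_def)
  moreover have "I (c k) (d 0) \<longleftrightarrow> (0 - fst p * k - snd p) mod 6 \<in> {0, 2}"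
    using p by (simp only: pat_def)
  ultimately show ?thesis using * by metis
qed

lemma pat_2_not_common': "pat c d 6 {0, 2} p \<Longrightarrow> p \<in> set offsets6 \<Longrightarrow> \<not> (I (c 0) (d j) \<and> I (c 1) (d j))"
proof -
  assume p: "pat c d 6 {0, 2} p" "p \<in> set offsets6"
  have "\<not> (x mod 6 \<in> {0, 2} \<and> (x - e) mod 6 \<in> {0, 2})" if "e = 1 \<or> e = - 1" for x e :: int
    using that by (auto, presburger+)
  note * = this[of "fst p" "j - snd p"]
  have "j - fst p * 0 - snd p = j - snd p" "j - fst p * 1 - snd p = j - snd p - fst p" by simp_all
  then have "I (c 0) (d j) \<longleftrightarrow> (j - snd p) mod 6 \<in> {0, 2}" "I (c 1) (d j) \<longleftrightarrow> (j - snd p - fst p) mod 6 \<in> {0, 2}"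
    using p(1) by (metis pat_def)+
  moreover have "fst p = 1 \<or> fst p = - 1" using p(2) by (auto simp: offsets6_def)
  ultimately show ?thesis using * by metis
qed

text \<open>The adjacent blocks \<open>d 0\<close> and \<open>d 1\<close> have a single common
  point. A hexagon with the pattern {0, 1} provides one, a hexagon with {0, 2} none and a triangle
  none, so exactly one of the two hexagons has the first type.\<close>

lemma hex_types_point:
  assumes c: "P.is_cycle c1 6" "P.is_cycle c2 6" "range c1 \<inter> range c2 = {}" "P = range c1 \<union> range c2 \<union> P.tris"
    and d: "d = d2 \<or> d = d3" and p: "p1 \<in> set offsets6" "p2 \<in> set offsets6"
    and pat: "pat c1 d 6 {0, w1} p1" "pat c2 d 6 {0, w2} p2" "w1 \<in> {1, 2}" "w2 \<in> {1, 2}"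
  shows "w1 \<noteq> w2"
proof
  assume eq: "w1 = w2"
  have dc: "B.is_cycle d 6" using d d2 d3 by auto
  have 1: "card {u \<in> P. I u (d 0) \<and> I u (d 1)} = 1"
    using biadjacency.codeg_cycle_1[OF dual dc] by (simp add: card_dual_codeg)
  show False
  proof (cases "w1 = 1")
    case True
    then obtain k l where "I (c1 k) (d 0) \<and> I (c1 k) (d 1)" "I (c2 l) (d 0) \<and> I (c2 l) (d 1)"
      using pat_1_common pat p eq by metis
    moreover have "c1 k \<noteq> c2 l" using c(3) by blast
    ultimately have "card {c1 k, c2 l} = 2" "{c1 k, c2 l} \<subseteq> {u \<in> P. I u (d 0) \<and> I u (d 1)}"
      using P.cycle_in c by auto
    then show False using 1 P.fin card_mono[of "{u \<in> P. I u (d 0) \<and> I u (d 1)}" "{c1 k, c2 l}"] by simp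
  next
    case False
    then have "w1 = 2" "w2 = 2" using pat eq by auto
    obtain u where u: "u \<in> P" "I u (d 0)" "I u (d 1)" using 1 by (auto simp: card_1_singleton_iff)
    then have "u \<in> P.tris"
      using c(4) pat_2_not_common pat(1,2) \<open>w1 = 2\<close> \<open>w2 = 2\<close> by blast
    then obtain w m where w: "P.is_cycle w m" "w 0 = u" using P.cycle_exists P.tris_subset by blast
    then have "P.is_cycle w 3" using P.cycle_tris_iff \<open>u \<in> P.tris\<close> by metis
    then show False using triangle_wave[of w d 6 0 1] dc u w by (simp add: of_bool_def split: if_splits)
  qed
qed

text \<open>The dual argument: the adjacent points \<open>c 0\<close> and \<open>c 1\<close> have a
  single common block.\<close>

lemma hex_types_block:
  assumes c: "P.is_cycle c 6" and p: "p2 \<in> set offsets6" "p3 \<in> set offsets6"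
    and pat: "pat c d2 6 {0, w2} p2" "pat c d3 6 {0, w3} p3" "w2 \<in> {1, 2}" "w3 \<in> {1, 2}"
    and disj: "range d2 \<inter> range d3 = {}"
  shows "w2 \<noteq> w3"
proof
  assume eq: "w2 = w3"
  have 1: "card {x \<in> B. I (c 0) x \<and> I (c 1) x} = 1"
    using codeg_cycle_1[OF c] by (simp add: codeg_def)
  show False
  proof (cases "w2 = 1")
    case True
    then obtain k l where "I (c 0) (d2 k) \<and> I (c 1) (d2 k)" "I (c 0) (d3 l) \<and> I (c 1) (d3 l)"
      using pat_1_common' pat p eq by metis
    moreover have "d2 k \<noteq> d3 l" using disj by blast
    ultimately have "card {d2 k, d3 l} = 2" "{d2 k, d3 l} \<subseteq> {x \<in> B. I (c 0) x \<and> I (c 1) x}"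
      using B.cycle_in d2 d3 by auto
    then show False using 1 B.fin card_mono[of "{x \<in> B. I (c 0) x \<and> I (c 1) x}" "{d2 k, d3 l}"] by simp
  next
    case False
    then have "w2 = 2" "w3 = 2" using pat eq by auto
    obtain x where x: "x \<in> B" "I (c 0) x" "I (c 1) x" using 1 by (auto simp: card_1_singleton_iff)
    then have "x \<in> range t2 \<union> range t3"
      using cover pat_2_not_common' pat(1,2) p \<open>w2 = 2\<close> \<open>w3 = 2\<close> by blast
    then obtain t j where t: "B.is_cycle t 3" "x = t j" using t2 t3 by blast
    then show False using biadjacency.triangle_wave[OF dual t(1) c, where k = j and j = 1] x
      by (simp add: of_bool_def split: if_splits)
  qed
qed

lemma point_cycles:
  obtains c1 c2 w1 w2 where "P.is_cycle c1 6" "P.is_cycle c2 6" "P.is_cycle w1 3" "P.is_cycle w2 3"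
    "range c1 \<inter> range c2 = {}" "P.tris = range w1 \<union> range w2" "range w1 \<inter> range w2 = {}"
    "P = range c1 \<union> range c2 \<union> P.tris"
proof -
  have clo: "P.closed P" using P.wf2 by (auto simp: P.closed_def)
  have hex: "\<exists>c. P.is_cycle c 6 \<and> range c \<subseteq> C" if C: "P.closed C" "C \<inter> P.tris = {}" "card C > 0" for C
  proof -
    obtain u where u: "u \<in> C" using C(3) by (metis card.empty ex_in_conv less_irrefl)
    then have "u \<in> P" "u \<notin> P.tris" using C by (auto simp: P.closed_def)
    then obtain c n where c: "P.is_cycle c n" "c 0 = u" "6 \<le> n" using long_cycle by blast
    then have "n = 6" using hex_length by blast
    then show ?thesis using c u P.closed_cycle_subset[OF c(1) C(1)] by auto
  qed
  have tri: "\<exists>c. P.is_cycle c 3 \<and> range c \<subseteq> C" if C: "P.closed C" "C \<subseteq> P.tris" "card C > 0" for C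
  proof -
    obtain u where u: "u \<in> C" using C(3) by (metis card.empty ex_in_conv less_irrefl)
    then obtain c n where c: "P.is_cycle c n" "c 0 = u" using P.cycle_exists C P.tris_subset by blast
    then have "n = 3" using P.cycle_tris_iff[OF c(1), of 0] u C by auto
    then show ?thesis using c u P.closed_cycle_subset[OF c(1) C(1)] by auto
  qed
  have diff: "card (C - range c) = card C - n" if "P.is_cycle c n" "range c \<subseteq> C" "C \<subseteq> P" for c n C
  proof -
    have "finite C" using that(3) P.fin finite_subset by blast
    then show ?thesis using that P.card_range_cycle[OF that(1)] by (simp add: card_Diff_subset finite_subset)
  qed
  have rest: "range c = C" if "P.is_cycle c n" "range c \<subseteq> C" "card C = n" "C \<subseteq> P" for c n C
    using that P.card_range_cycle[OF that(1)] P.fin by (intro card_subset_eq) (auto intro: finite_subset)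
  have card12: "card (P - P.tris) = 12"
    using P.tris_subset card_tris_P card_P P.fin by (simp add: card_Diff_subset finite_subset)
  have clo1: "P.closed (P - P.tris)" by (intro P.closed_diff clo P.closed_tris)
  obtain c1 where c1: "P.is_cycle c1 6" "range c1 \<subseteq> P - P.tris"
    using hex[OF clo1] card12 by auto
  have clo2: "P.closed (P - P.tris - range c1)" by (intro P.closed_diff clo1 P.closed_cycle[OF c1(1)])
  have card6: "card (P - P.tris - range c1) = 6" using diff[OF c1] card12 by auto
  obtain c2 where c2: "P.is_cycle c2 6" "range c2 \<subseteq> P - P.tris - range c1"
    using hex[OF clo2] card6 by auto
  have r2: "range c2 = P - P.tris - range c1" using rest[OF c2 card6] by auto
  obtain w1 where w1: "P.is_cycle w1 3" "range w1 \<subseteq> P.tris"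
    using tri[OF P.closed_tris] card_tris_P by auto
  have clo3: "P.closed (P.tris - range w1)" by (intro P.closed_diff P.closed_tris P.closed_cycle[OF w1(1)])
  have card3: "card (P.tris - range w1) = 3" using diff[OF w1 P.tris_subset] card_tris_P by simp
  obtain w2 where w2: "P.is_cycle w2 3" "range w2 \<subseteq> P.tris - range w1"
    using tri[OF clo3] card3 by auto
  have r3: "range w2 = P.tris - range w1" using rest[OF w2 card3] P.tris_subset by auto
  show ?thesis
    using that[OF c1(1) c2(1) w1(1) w2(1)] c1(2) w1(2) P.tris_subset unfolding r2 r3 by blast
qed

end

section \<open>The hexagonal case: normalised labellings\<close>

context hexagonal
begin

lemma inter_d2_d3: "range d2 \<inter> range d3 = {}"
proof -
  have "card (range d2 \<union> range d3) \<ge> 12"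
  proof -
    have "card B \<le> card (range d2 \<union> range d3) + card (range t2 \<union> range t3)"
      unfolding cover by (metis (no_types, lifting) Un_assoc Un_left_commute card_Un_le)
    moreover have "card (range t2 \<union> range t3) \<le> 6"
      using card_Un_le[of "range t2" "range t3"] B.card_range_cycle[OF t2] B.card_range_cycle[OF t3] by simp
    ultimately show ?thesis using card_B by simp
  qed
  moreover have "finite (range d2)" "finite (range d3)"
    using B.range_cycle[OF d2] B.range_cycle[OF d3] by simp_all
  ultimately have "card (range d2 \<inter> range d3) = 0"
    using card_Un_Int[of "range d2" "range d3"] B.card_range_cycle[OF d2] B.card_range_cycle[OF d3]
    by (simp del: card_0_eq card_eq_0_iff)
  then show ?thesis using \<open>finite (range d2)\<close> by simp
qed

text \<open>The order of the cycles is that of \<open>hex1_point\<close>, \<open>hex2_point\<close>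
  and \<open>tri_point\<close>.\<close>

definition block_list :: "'b list" where
  "block_list = map d3 [0, 1, 2, 3, 4, 5] @ map t3 [0, 1, 2] @ map d2 [0, 1, 2, 3, 4, 5] @ map t2 [0, 1, 2]"

lemma set_block_list: "set block_list = B"
proof -
  have 6: "{0..<int 6} = {0, 1, 2, 3, 4, 5}" and 3: "{0..<int 3} = {0, 1, 2}" by auto
  show ?thesis unfolding cover block_list_def
    using B.range_cycle[OF d2] B.range_cycle[OF d3] B.range_cycle[OF t2] B.range_cycle[OF t3]
    unfolding 6 3 by auto
qed

lemma distinct_block_list: "distinct block_list"
  by (rule card_distinct) (simp add: set_block_list card_B, simp add: block_list_def)

lemma common_block_list: "common (map (I u) block_list) (map (I v) block_list) = codeg u v"
  using common_map[OF distinct_block_list] by (simp add: set_block_list codeg_def)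

lemma hex_row_pat: "pat c d 6 {0, w} p \<Longrightarrow> map (\<lambda>j. I (c k) (d j)) [0, 1, 2, 3, 4, 5] = hex_row p w k"
  by (simp add: pat_def hex_row_def)

lemma tri_row_pat: "pat c d 3 {0} p \<Longrightarrow> map (\<lambda>j. I (c k) (d j)) js = tri_row p js k"
  by (simp add: pat_def tri_row_def)

end

context biadjacency
begin

text \<open>A labelling of all points and blocks by cycles with prescribed incidences.\<close>

definition hex_labelling where
  "hex_labelling c1 c2 w1 w2 d2 t2 d3 t3 \<longleftrightarrow>
    P.is_cycle c1 6 \<and> P.is_cycle c2 6 \<and> P.is_cycle w1 3 \<and> P.is_cycle w2 3 \<and>
    P = range c1 \<union> range c2 \<union> (range w1 \<union> range w2) \<and>
    pat c1 d3 6 {0, 1} (1, 0) \<and> pat c1 d2 6 {0, 2} (1, 2) \<and> pat c1 t3 3 {0} (1, 0) \<and> pat c1 t2 3 {0} (1, 0) \<and>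
    pat c2 d3 6 {0, 2} (1, 0) \<and> pat c2 d2 6 {0, 1} (1, 0) \<and> pat c2 t3 3 {0} (1, 0) \<and> pat c2 t2 3 {0} (1, 1) \<and>
    pat w1 d3 3 {0} (1, 0) \<and> pat w1 d2 3 {0} (1, 0) \<and> pat w1 t3 3 {0} (1, 1) \<and> pat w1 t2 3 {0} (1, 0) \<and>
    pat w2 d3 3 {0} (1, 0) \<and> pat w2 d2 3 {0} (1, 2) \<and> pat w2 t3 3 {0} (1, 2) \<and> pat w2 t2 3 {0} (1, 1)"

end

context hexagonal
begin

text \<open>Codegree 2 between different cycles supplies the hypotheses of the searches. The rows of
  \<open>w1\<close> and \<open>w2\<close> differ, since equal rows would mean a codegree of 6; so
  the two solutions for triangles both occur.\<close>

lemma normalised_solutions: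
  assumes c: "P.is_cycle c1 6" "P.is_cycle c2 6" and w: "P.is_cycle w1 3" "P.is_cycle w2 3"
    and apart: "range c1 \<inter> range c2 = {}" "range w1 \<inter> range w2 = {}"
    and p: "p \<in> set offsets6" "p1 \<in> set offsets3" "p2 \<in> set offsets3" "q1 \<in> set offsets3" "q2 \<in> set offsets3"
      "q3 \<in> set offsets3" "r1 \<in> set offsets3" "r2 \<in> set offsets3" "r3 \<in> set offsets3"
    and c1: "pat c1 d3 6 {0, 1} (1, 0)" "pat c1 d2 6 {0, 2} p" "pat c1 t3 3 {0} (1, 0)" "pat c1 t2 3 {0} (1, 0)"
    and c2: "pat c2 d3 6 {0, 2} (1, 0)" "pat c2 d2 6 {0, 1} (1, 0)" "pat c2 t3 3 {0} p1" "pat c2 t2 3 {0} p2"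
    and w1: "pat w1 d3 3 {0} (1, 0)" "pat w1 t3 3 {0} q1" "pat w1 d2 3 {0} q2" "pat w1 t2 3 {0} q3"
    and w2: "pat w2 d3 3 {0} (1, 0)" "pat w2 t3 3 {0} r1" "pat w2 d2 3 {0} r2" "pat w2 t2 3 {0} r3"
  shows "p = (1, 2)"
    "p1 = (1, 0) \<and> p2 = (1, 1) \<and>
       {(q1, q2, q3), (r1, r2, r3)} = {((1, 1), (1, 0), (1, 0)), ((1, 2), (1, 2), (1, 1))} \<or>
     p1 = (1, 1) \<and> p2 = (1, 0) \<and>
       {(q1, q2, q3), (r1, r2, r3)} = {((1, 0), (1, 0), (1, 1)), ((1, 1), (1, 2), (1, 2))}"
proof -
  have row_c1: "map (I (c1 k)) block_list = hex1_point p k" for k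
    using hex_row_pat[OF c1(1), of k] hex_row_pat[OF c1(2), of k]
      tri_row_pat[OF c1(3), of k "[0, 1, 2]"] tri_row_pat[OF c1(4), of k "[0, 1, 2]"]
    by (simp add: block_list_def hex1_point_def)
  have row_c2: "map (I (c2 k)) block_list = hex2_point p1 p2 k" for k
    using hex_row_pat[OF c2(1), of k] hex_row_pat[OF c2(2), of k]
      tri_row_pat[OF c2(3), of k "[0, 1, 2]"] tri_row_pat[OF c2(4), of k "[0, 1, 2]"]
    by (simp add: block_list_def hex2_point_def)
  have row_w1: "map (I (w1 k)) block_list = tri_point q1 q2 q3 k" for k
    using tri_row_pat[OF w1(1), of k "[0, 1, 2, 3, 4, 5]"] tri_row_pat[OF w1(3), of k "[0, 1, 2, 3, 4, 5]"]
      tri_row_pat[OF w1(2), of k "[0, 1, 2]"] tri_row_pat[OF w1(4), of k "[0, 1, 2]"]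
    by (simp add: block_list_def tri_point_def)
  have row_w2: "map (I (w2 k)) block_list = tri_point r1 r2 r3 k" for k
    using tri_row_pat[OF w2(1), of k "[0, 1, 2, 3, 4, 5]"] tri_row_pat[OF w2(3), of k "[0, 1, 2, 3, 4, 5]"]
      tri_row_pat[OF w2(2), of k "[0, 1, 2]"] tri_row_pat[OF w2(4), of k "[0, 1, 2]"]
    by (simp add: block_list_def tri_point_def)
  have wt: "w1 k \<in> P.tris" "w2 k \<in> P.tris" "c1 l \<notin> P.tris" "c2 l \<notin> P.tris" for k l
    using P.cycle_tris_iff[OF w(1)] P.cycle_tris_iff[OF w(2)] P.cycle_tris_iff[OF c(1)] P.cycle_tris_iff[OF c(2)] by auto
  have "c2 l \<notin> range c1" "w2 l \<notin> range w1" for l using apart by blast+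
  then have cc: "codeg (c1 k) (c2 l) = 2" and ww: "codeg (w1 k) (w2 l) = 2" for k l
    using codeg_apart[OF P.closed_cycle[OF c(1)]] codeg_apart[OF P.closed_cycle[OF w(1)]]
      P.cycle_in[OF c(2)] P.cycle_in[OF w(2)] by auto
  have wc: "codeg (w1 k) (c1 l) = 2" "codeg (w1 k) (c2 l) = 2" "codeg (w2 k) (c1 l) = 2" "codeg (w2 k) (c2 l) = 2" for k l
    using codeg_apart[OF P.closed_tris] wt P.cycle_in[OF c(1)] P.cycle_in[OF c(2)] by auto
  have "common (hex1_point p k) (hex2_point p1 p2 l) = 2" for k l
    using cc[of k l] common_block_list[of "c1 k" "c2 l"] by (simp add: row_c1 row_c2)
  then have 1: "p = (1, 2) \<and> (p1 = (1, 0) \<and> p2 = (1, 1) \<or> p1 = (1, 1) \<and> p2 = (1, 0))"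
    using hex_points_search p(1,2,3) unfolding list_all_iff by blast
  then show "p = (1, 2)" by blast
  have w1s: "common (tri_point q1 q2 q3 k) (hex1_point (1, 2) l) = 2 \<and>
      common (tri_point q1 q2 q3 k) (hex2_point p1 p2 l) = 2" for k l
    using wc(1,2)[of k l] common_block_list[of "w1 k" "c1 l"] common_block_list[of "w1 k" "c2 l"] 1
    by (simp add: row_c1 row_c2 row_w1)
  have w2s: "common (tri_point r1 r2 r3 k) (hex1_point (1, 2) l) = 2 \<and>
      common (tri_point r1 r2 r3 k) (hex2_point p1 p2 l) = 2" for k l
    using wc(3,4)[of k l] common_block_list[of "w2 k" "c1 l"] common_block_list[of "w2 k" "c2 l"] 1
    by (simp add: row_c1 row_c2 row_w2)
  have ne: "(q1, q2, q3) \<noteq> (r1, r2, r3)"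
  proof
    assume "(q1, q2, q3) = (r1, r2, r3)"
    then have "map (I (w1 0)) block_list = map (I (w2 0)) block_list"
      unfolding row_w1 row_w2 by simp
    then have "codeg (w1 0) (w2 0) = codeg (w1 0) (w1 0)"
      using common_block_list by metis
    then show False
      using ww[of 0 0] deg_P[OF P.cycle_in[OF w(1)], of 0] by (simp add: codeg_def)
  qed
  from 1 consider "p1 = (1, 0)" "p2 = (1, 1)" | "p1 = (1, 1)" "p2 = (1, 0)" by blast
  then show "p1 = (1, 0) \<and> p2 = (1, 1) \<and>
       {(q1, q2, q3), (r1, r2, r3)} = {((1, 1), (1, 0), (1, 0)), ((1, 2), (1, 2), (1, 1))} \<or>
     p1 = (1, 1) \<and> p2 = (1, 0) \<and>
       {(q1, q2, q3), (r1, r2, r3)} = {((1, 0), (1, 0), (1, 1)), ((1, 1), (1, 2), (1, 2))}"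
  proof cases
    case 1
    have "(q1, q2, q3) = ((1, 1), (1, 0), (1, 0)) \<or> (q1, q2, q3) = ((1, 2), (1, 2), (1, 1))"
      using tri_points_search[unfolded list_all_iff, rule_format, OF p(4,5,6)] w1s 1 by simp
    moreover have "(r1, r2, r3) = ((1, 1), (1, 0), (1, 0)) \<or> (r1, r2, r3) = ((1, 2), (1, 2), (1, 1))"
      using tri_points_search[unfolded list_all_iff, rule_format, OF p(7,8,9)] w2s 1 by simp
    ultimately show ?thesis using ne 1 by auto
  next
    case 2
    have "(q1, q2, q3) = ((1, 0), (1, 0), (1, 1)) \<or> (q1, q2, q3) = ((1, 1), (1, 2), (1, 2))"
      using tri_points_search'[unfolded list_all_iff, rule_format, OF p(4,5,6)] w1s 2 by simp
    moreover have "(r1, r2, r3) = ((1, 0), (1, 0), (1, 1)) \<or> (r1, r2, r3) = ((1, 1), (1, 2), (1, 2))"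
      using tri_points_search'[unfolded list_all_iff, rule_format, OF p(7,8,9)] w2s 2 by simp
    ultimately show ?thesis using ne 2 by auto
  qed
qed

text \<open>Seven of the sixteen patterns can be normalised, those of a spanning tree on the eight
  cycles: \<open>c1\<close>, \<open>c2\<close>, \<open>w1\<close>, \<open>w2\<close> are adjusted to
  \<open>d3\<close>, then \<open>d2\<close> to \<open>c2\<close>, and \<open>t2\<close>,
  \<open>t3\<close> to \<open>c1\<close>. The searches determine the other nine up to a reflection
  of everything and an exchange of the two triangles of points.\<close>

lemma labelling_aux:
  assumes c: "P.is_cycle c1 6" "P.is_cycle c2 6" and w: "P.is_cycle w1 3" "P.is_cycle w2 3"
    and apart: "range c1 \<inter> range c2 = {}" "range w1 \<inter> range w2 = {}"
    and cov: "P = range c1 \<union> range c2 \<union> (range w1 \<union> range w2)"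
    and p: "p \<in> set offsets6" "q \<in> set offsets6" "pat c1 d3 6 {0, 1} p" "pat c2 d3 6 {0, 2} q"
  shows "\<exists>c1 c2 w1 w2 x2 s2 x3 s3. hex_labelling c1 c2 w1 w2 x2 s2 x3 s3 \<and>
    B.is_cycle x2 6 \<and> B.is_cycle s2 3 \<and> B.is_cycle x3 6 \<and> B.is_cycle s3 3 \<and>
    range x2 = range d2 \<and> range s2 = range t2 \<and> range x3 = range d3 \<and> range s3 = range t3"
proof -
  have unit: "fst p = 1 \<or> fst p = - 1" if "p \<in> set offsets6 \<or> p \<in> set offsets3" for p
    using that by (auto simp: offsets6_def offsets3_def)
  have point: "\<exists>c'. P.is_cycle c' n \<and> range c' = range c \<and> pat c' d m W (1, 0)"
    if "P.is_cycle c n" "pat c d m W p" "p \<in> set offsets6 \<or> p \<in> set offsets3" for c n p m W and d :: "int \<Rightarrow> 'b"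
  proof -
    have "pat (\<lambda>k. c (- fst p * snd p + fst p * k)) d m W (1, 0)"
      using pat_point_reparam[of c d m W "fst p" "snd p"] that unit[OF that(3)] by simp
    then show ?thesis
      using P.cycle_reparam[OF that(1) unit[OF that(3)], of "- fst p * snd p"]
        P.range_cycle_reparam[OF that(1) unit[OF that(3)], of "- fst p * snd p"] by blast
  qed
  have block: "\<exists>d'. B.is_cycle d' n \<and> range d' = range d \<and> pat c d' m {0, v} (1, 0)"
    if d: "B.is_cycle d n" "pat c d m {0, v} p" "p \<in> set offsets6 \<or> p \<in> set offsets3" "0 \<le> v" "v < m"
    for c d n p m v
  proof -
    obtain b where "pat c (\<lambda>j. d (b + fst p * j)) m {0, v} (1, 0)"
      using pat_block_reparam[of c d m v "fst p" "snd p"] d unit[OF d(3)] by auto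
    then show ?thesis
      using B.cycle_reparam[OF d(1) unit[OF d(3)], of b] B.range_cycle_reparam[OF d(1) unit[OF d(3)], of b] by blast
  qed
  obtain c1' where c1': "P.is_cycle c1' 6" "range c1' = range c1" "pat c1' d3 6 {0, 1} (1, 0)"
    using point[OF c(1) p(3)] p by blast
  obtain c2' where c2': "P.is_cycle c2' 6" "range c2' = range c2" "pat c2' d3 6 {0, 2} (1, 0)"
    using point[OF c(2) p(4)] p by blast
  have o: "(1, 0) \<in> set offsets6" "(1, 0) \<in> set offsets3" by (simp_all add: offsets6_def offsets3_def)
  obtain r v where r: "r \<in> set offsets6" "v \<in> {1, 2}" "pat c2' d2 6 {0, v} r"
    using hex_pat[OF c2'(1), of d2] by blast
  then have "v = 1" using hex_types_block[OF c2'(1) r(1) o(1) r(3) c2'(3) r(2)] inter_d2_d3 by auto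
  then obtain x2 where x2: "B.is_cycle x2 6" "range x2 = range d2" "pat c2' x2 6 {0, 1} (1, 0)"
    using block[OF d2 r(3)] r(1) by auto
  have "\<exists>s. B.is_cycle s 3 \<and> range s = range t \<and> pat c1' s 3 {0} (1, 0)" if t: "B.is_cycle t 3" for t
  proof -
    obtain r where "r \<in> set offsets3" "pat c1' t 3 {0} r" using tri_pat_block[OF c1'(1) t] by blast
    then show ?thesis using block[OF t, of c1' 3 0 r] by simp
  qed
  from this[OF t2] this[OF t3] obtain s2 s3 where
    s2: "B.is_cycle s2 3" "range s2 = range t2" "pat c1' s2 3 {0} (1, 0)" and
    s3: "B.is_cycle s3 3" "range s3 = range t3" "pat c1' s3 3 {0} (1, 0)" by blast
  have "\<exists>w'. P.is_cycle w' 3 \<and> range w' = range w \<and> pat w' d3 3 {0} (1, 0)" if w: "P.is_cycle w 3" for w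
  proof -
    obtain r where "r \<in> set offsets3" "pat w d3 3 {0} r" using tri_pat[OF w d3] by blast
    then show ?thesis using point[OF w] by blast
  qed
  from this[OF w(1)] this[OF w(2)] obtain w1' w2' where
    w1': "P.is_cycle w1' 3" "range w1' = range w1" "pat w1' d3 3 {0} (1, 0)" and
    w2': "P.is_cycle w2' 3" "range w2' = range w2" "pat w2' d3 3 {0} (1, 0)" by blast
  interpret H: hexagonal P R B S I x2 s2 d3 s3
    by unfold_locales (use x2 s2 s3 d3 cover in auto)
  obtain p' v where p': "p' \<in> set offsets6" "v \<in> {1, 2}" "pat c1' x2 6 {0, v} p'"
    using H.hex_pat[OF c1'(1), of x2] by blast
  then have "v = 2" using H.hex_types_block[OF c1'(1) p'(1) o(1) p'(3) c1'(3) p'(2)] H.inter_d2_d3 by auto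
  note p'(3)[unfolded this]
  note pats = tri_pat_block[OF c2'(1) s3(1)] tri_pat_block[OF c2'(1) s2(1)]
    tri_pat[OF w1'(1) s3(1)] tri_pat[OF w1'(1) x2(1)] tri_pat[OF w1'(1) s2(1)]
    tri_pat[OF w2'(1) s3(1)] tri_pat[OF w2'(1) x2(1)] tri_pat[OF w2'(1) s2(1)]
  obtain p1 p2 q1 q2 q3 r1 r2 r3 where
    mem: "p1 \<in> set offsets3" "p2 \<in> set offsets3" "q1 \<in> set offsets3" "q2 \<in> set offsets3"
      "q3 \<in> set offsets3" "r1 \<in> set offsets3" "r2 \<in> set offsets3" "r3 \<in> set offsets3" and
    pt: "pat c2' s3 3 {0} p1" "pat c2' s2 3 {0} p2" "pat w1' s3 3 {0} q1" "pat w1' x2 3 {0} q2"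
      "pat w1' s2 3 {0} q3" "pat w2' s3 3 {0} r1" "pat w2' x2 3 {0} r2" "pat w2' s2 3 {0} r3"
    using pats by metis
  have apart': "range c1' \<inter> range c2' = {}" "range w1' \<inter> range w2' = {}"
    using apart c1' c2' w1' w2' by auto
  note sol = H.normalised_solutions[OF c1'(1) c2'(1) w1'(1) w2'(1) apart' p'(1) mem
      c1'(3) p'(3)[unfolded \<open>v = 2\<close>] s3(3) s2(3) c2'(3) x2(3) pt(1,2) w1'(3) pt(3,4,5) w2'(3) pt(6,7,8)]
  have cov': "P = range c1' \<union> range c2' \<union> (range w1' \<union> range w2')"
    using cov c1' c2' w1' w2' by simp
  have pc1: "pat c1' x2 6 {0, 2} (1, 2)" using p'(3) \<open>v = 2\<close> sol(1) by simp
  note ranges = x2(1) s2(1) d3 s3(1) x2(2) s2(2) s3(2)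
  have refl_pat: "pat (\<lambda>k. c (\<alpha> + - 1 * k)) (\<lambda>j. d (\<beta> + - 1 * j)) m W (1, b)"
    if "pat c d m W (1, a)" "\<And>k j. (\<beta> - j - (\<alpha> - k) - a) mod m \<in> W \<longleftrightarrow> (j - k - b) mod m \<in> W"
    for c and d :: "int \<Rightarrow> 'b" and m W a b \<alpha> \<beta>
    using that by (simp add: pat_def)
  \<comment> \<open>The second solution becomes the first when all cycles are reversed. The starting
    points 5 and 1 below restore the normalised offsets, and \<open>wB\<close> becomes the first
    triangle.\<close>
  have reflected: ?thesis
    if wA: "P.is_cycle wA 3" "pat wA d3 3 {0} (1, 0)" "pat wA s3 3 {0} (1, 0)" "pat wA x2 3 {0} (1, 0)" "pat wA s2 3 {0} (1, 1)"
      and wB: "P.is_cycle wB 3" "pat wB d3 3 {0} (1, 0)" "pat wB s3 3 {0} (1, 1)" "pat wB x2 3 {0} (1, 2)" "pat wB s2 3 {0} (1, 2)"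
      and AB: "range wA \<union> range wB = range w1' \<union> range w2'" and p12: "p1 = (1, 1)" "p2 = (1, 0)"
    for wA wB
  proof -
    define b1 b2 a1 a2 y2 u2 y3 u3 where
      "b1 = (\<lambda>k. c1' (0 + - 1 * k))" and "b2 = (\<lambda>k. c2' (5 + - 1 * k))" and
      "a1 = (\<lambda>k. wB (1 + - 1 * k))" and "a2 = (\<lambda>k. wA (1 + - 1 * k))" and
      "y2 = (\<lambda>j. x2 (0 + - 1 * j))" and "u2 = (\<lambda>j. s2 (0 + - 1 * j))" and
      "y3 = (\<lambda>j. d3 (1 + - 1 * j))" and "u3 = (\<lambda>j. s3 (0 + - 1 * j))"
    note defs = this
    have m: "(- 1 :: int) = 1 \<or> (- 1 :: int) = - 1" by simp
    have Pc: "P.is_cycle b1 6" "P.is_cycle b2 6" "P.is_cycle a1 3" "P.is_cycle a2 3"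
      "range b1 = range c1'" "range b2 = range c2'" "range a1 = range wB" "range a2 = range wA"
      unfolding defs
      by (rule P.cycle_reparam[OF c1'(1) m] P.cycle_reparam[OF c2'(1) m] P.cycle_reparam[OF wB(1) m]
        P.cycle_reparam[OF wA(1) m] P.range_cycle_reparam[OF c1'(1) m] P.range_cycle_reparam[OF c2'(1) m]
        P.range_cycle_reparam[OF wB(1) m] P.range_cycle_reparam[OF wA(1) m])+
    have Bc: "B.is_cycle y2 6" "B.is_cycle u2 3" "B.is_cycle y3 6" "B.is_cycle u3 3"
      "range y2 = range x2" "range u2 = range s2" "range y3 = range d3" "range u3 = range s3"
      unfolding defs
      by (rule B.cycle_reparam[OF x2(1) m] B.cycle_reparam[OF s2(1) m] B.cycle_reparam[OF d3 m]
        B.cycle_reparam[OF s3(1) m] B.range_cycle_reparam[OF x2(1) m] B.range_cycle_reparam[OF s2(1) m]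
        B.range_cycle_reparam[OF d3 m] B.range_cycle_reparam[OF s3(1) m])+
    have cov2: "P = range b1 \<union> range b2 \<union> (range a1 \<union> range a2)"
      using cov' AB Pc by auto
    have "pat b1 y3 6 {0, 1} (1, 0)" unfolding defs by (rule refl_pat[OF c1'(3)]) (simp, presburger)
    moreover have "pat b1 y2 6 {0, 2} (1, 2)" unfolding defs by (rule refl_pat[OF pc1]) (simp, presburger)
    moreover have "pat b1 u3 3 {0} (1, 0)" unfolding defs by (rule refl_pat[OF s3(3)]) (simp, presburger)
    moreover have "pat b1 u2 3 {0} (1, 0)" unfolding defs by (rule refl_pat[OF s2(3)]) (simp, presburger)
    moreover have "pat b2 y3 6 {0, 2} (1, 0)" unfolding defs by (rule refl_pat[OF c2'(3)]) (simp, presburger)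
    moreover have "pat b2 y2 6 {0, 1} (1, 0)" unfolding defs by (rule refl_pat[OF x2(3)]) (simp, presburger)
    moreover have "pat b2 u3 3 {0} (1, 0)" unfolding defs by (rule refl_pat[OF pt(1)[unfolded p12]]) (simp, presburger)
    moreover have "pat b2 u2 3 {0} (1, 1)" unfolding defs by (rule refl_pat[OF pt(2)[unfolded p12]]) (simp, presburger)
    moreover have "pat a1 y3 3 {0} (1, 0)" unfolding defs by (rule refl_pat[OF wB(2)]) (simp, presburger)
    moreover have "pat a1 y2 3 {0} (1, 0)" unfolding defs by (rule refl_pat[OF wB(4)]) (simp, presburger)
    moreover have "pat a1 u3 3 {0} (1, 1)" unfolding defs by (rule refl_pat[OF wB(3)]) (simp, presburger)
    moreover have "pat a1 u2 3 {0} (1, 0)" unfolding defs by (rule refl_pat[OF wB(5)]) (simp, presburger)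
    moreover have "pat a2 y3 3 {0} (1, 0)" unfolding defs by (rule refl_pat[OF wA(2)]) (simp, presburger)
    moreover have "pat a2 y2 3 {0} (1, 2)" unfolding defs by (rule refl_pat[OF wA(4)]) (simp, presburger)
    moreover have "pat a2 u3 3 {0} (1, 2)" unfolding defs by (rule refl_pat[OF wA(3)]) (simp, presburger)
    moreover have "pat a2 u2 3 {0} (1, 1)" unfolding defs by (rule refl_pat[OF wA(5)]) (simp, presburger)
    ultimately have "hex_labelling b1 b2 a1 a2 y2 u2 y3 u3"
      unfolding hex_labelling_def using Pc(1-4) cov2 by blast
    then show ?thesis using Bc ranges by metis
  qed
  from sol(2) consider
    "p1 = (1, 0)" "p2 = (1, 1)" "(q1, q2, q3) = ((1, 1), (1, 0), (1, 0))" "(r1, r2, r3) = ((1, 2), (1, 2), (1, 1))"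
    | "p1 = (1, 0)" "p2 = (1, 1)" "(r1, r2, r3) = ((1, 1), (1, 0), (1, 0))" "(q1, q2, q3) = ((1, 2), (1, 2), (1, 1))"
    | "p1 = (1, 1)" "p2 = (1, 0)" "(q1, q2, q3) = ((1, 0), (1, 0), (1, 1))" "(r1, r2, r3) = ((1, 1), (1, 2), (1, 2))"
    | "p1 = (1, 1)" "p2 = (1, 0)" "(r1, r2, r3) = ((1, 0), (1, 0), (1, 1))" "(q1, q2, q3) = ((1, 1), (1, 2), (1, 2))"
    by (auto simp: doubleton_eq_iff)
  then show ?thesis
  proof cases
    case 1
    then have "hex_labelling c1' c2' w1' w2' x2 s2 d3 s3"
      unfolding hex_labelling_def using c1' c2' w1' w2' s2 s3 x2 pt pc1 cov' by simp
    then show ?thesis using ranges by blast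
  next
    case 2
    then have "hex_labelling c1' c2' w2' w1' x2 s2 d3 s3"
      unfolding hex_labelling_def using c1' c2' w1' w2' s2 s3 x2 pt pc1 cov' by auto
    then show ?thesis using ranges by blast
  next
    case 3
    then show ?thesis using reflected[OF w1'(1) w1'(3) _ _ _ w2'(1) w2'(3)] pt by simp
  next
    case 4
    then show ?thesis using reflected[OF w2'(1) w2'(3) _ _ _ w1'(1) w1'(3)] pt by (simp add: Un_commute)
  qed
qed

text \<open>Exactly one of the two hexagons of points has the pattern {0, 1} against
  \<open>d3\<close>; it is the one to be called first.\<close>

theorem hexagonal_labelling:
  "\<exists>c1 c2 w1 w2 x2 s2 x3 s3. hex_labelling c1 c2 w1 w2 x2 s2 x3 s3 \<and>
    B.is_cycle x2 6 \<and> B.is_cycle s2 3 \<and> B.is_cycle x3 6 \<and> B.is_cycle s3 3 \<and>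
    range x2 = range d2 \<and> range s2 = range t2 \<and> range x3 = range d3 \<and> range s3 = range t3"
proof -
  obtain c1 c2 w1 w2 where c: "P.is_cycle c1 6" "P.is_cycle c2 6" and w: "P.is_cycle w1 3" "P.is_cycle w2 3"
    and inter: "range c1 \<inter> range c2 = {}" and tris: "P.tris = range w1 \<union> range w2"
    and inter2: "range w1 \<inter> range w2 = {}" and cov: "P = range c1 \<union> range c2 \<union> P.tris"
    using point_cycles .
  have cov1: "P = range c1 \<union> range c2 \<union> (range w1 \<union> range w2)"
    and cov2: "P = range c2 \<union> range c1 \<union> (range w1 \<union> range w2)" using cov tris by auto
  obtain p v where p: "p \<in> set offsets6" "v \<in> {1, 2}" "pat c1 d3 6 {0, v} p"
    using hex_pat[OF c(1), of d3] by blast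
  obtain q v' where q: "q \<in> set offsets6" "v' \<in> {1, 2}" "pat c2 d3 6 {0, v'} q"
    using hex_pat[OF c(2), of d3] by blast
  have "v \<noteq> v'" using hex_types_point[OF c inter cov _ p(1) q(1) p(3) q(3) p(2) q(2)] by simp
  then consider "v = 1" "v' = 2" | "v = 2" "v' = 1" using p(2) q(2) by auto
  then show ?thesis
  proof cases
    case 1
    then show ?thesis using labelling_aux[OF c w inter inter2 cov1 p(1) q(1)] p q by simp
  next
    case 2
    then show ?thesis
      using labelling_aux[OF c(2,1) w _ inter2 cov2 q(1) p(1)] inter p q by (simp add: Int_commute)
  qed
qed

end

section \<open>The triangle case: rows of permutations of Z/3\<close>

text \<open>A row holds one permutation of Z/3 for each triangle of blocks and stands for a triangle
  of points. An agreement is a common block of point \<open>k\<close> of one triangle and point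
  \<open>l\<close> of the other, so \<open>compat\<close> says that all these codegrees are
  2.\<close>

fun agreements :: "nat \<Rightarrow> nat \<Rightarrow> int list list \<Rightarrow> int list list \<Rightarrow> nat" where
  "agreements k l (p # ps) (q # qs) = (if p ! k = q ! l then Suc (agreements k l ps qs) else agreements k l ps qs)"
| "agreements k l _ _ = 0"

definition compat :: "int list list \<Rightarrow> int list list \<Rightarrow> bool" where
  "compat r s \<longleftrightarrow> list_all (\<lambda>k. list_all (\<lambda>l. agreements k l r s = 2) [0, 1, 2]) [0, 1, 2]"

definition even_perms :: "int list list" where
  "even_perms = [[0, 1, 2], [1, 2, 0], [2, 0, 1]]"

definition perms3 :: "int list list" where
  "perms3 = [[0, 1, 2], [1, 2, 0], [2, 0, 1], [0, 2, 1], [1, 0, 2], [2, 1, 0]]"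

text \<open>Agreements with a row consisting of identities, the form to which row 0 is
  normalised.\<close>

definition hits :: "int \<Rightarrow> nat \<Rightarrow> int list list \<Rightarrow> nat" where
  "hits k l r = length (filter (\<lambda>p. p ! l = k) r)"

definition admissible :: "int list list \<Rightarrow> bool" where
  "admissible r \<longleftrightarrow> list_all (\<lambda>k. list_all (\<lambda>l. hits k l r \<le> 2) [0, 1, 2]) [0, 1, 2]"

text \<open>A backtracking search that abandons a partial row with too many hits. Hits only grow
  when the row is extended, so no admissible row is lost; see
  \<open>all_extensionsD\<close>.\<close>

primrec all_extensions :: "nat \<Rightarrow> int list list \<Rightarrow> (int list list \<Rightarrow> bool) \<Rightarrow> bool" where
  "all_extensions 0 r Q = Q r"
| "all_extensions (Suc n) r Q =
     list_all (\<lambda>p. if admissible (p # r) then all_extensions n (p # r) Q else True) perms3"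

lemma all_extensionsD:
  "all_extensions n r Q \<Longrightarrow> length s = n \<Longrightarrow> set s \<subseteq> set perms3 \<Longrightarrow> admissible (s @ r) \<Longrightarrow> Q (s @ r)"
proof (induction n arbitrary: r s)
  case (Suc n)
  obtain s' p where s: "s = s' @ [p]" using Suc.prems(2) by (cases s rule: rev_cases) auto
  have "hits k l (p # r) \<le> hits k l (s @ r)" for k l
    by (simp add: hits_def s)
  then have "admissible (p # r)"
    using Suc.prems(4) by (fastforce simp: admissible_def intro: order_trans)
  then have "all_extensions n (p # r) Q"
    using Suc.prems(1,3) by (simp add: list_all_iff s)
  then show ?case using Suc.IH[of "p # r" s'] Suc.prems(2-4) by (simp add: s)
qed simp

text \<open>The rows that are compatible both with the identity row and with \<open>mixed_row\<close>.\<close>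

definition mixed_row :: "int list list" where
  "mixed_row = tl perms3 @ [[0, 1, 2]]"

definition mixed_partners :: "int list list list" where
  "mixed_partners = map (map ((!) perms3)) [[2, 1, 0, 2, 1, 0], [2, 1, 1, 0, 2, 0], [2, 1, 2, 1, 0, 0], [2, 1, 3, 5, 4, 0], [2, 1, 4, 3, 5, 0], [2, 1, 5, 4, 3, 0]]"

text \<open>A row compatible with the identities that contains an odd permutation lists all six
  permutations once, so a reordering of the columns makes it \<open>mixed_row\<close>; the second
  part restricts the rows beside it.\<close>

lemma rows_search:
  "all_extensions 5 [[0, 1, 2]] (\<lambda>r.
     if list_all (\<lambda>k. list_all (\<lambda>l. hits k l r = 2) [0, 1, 2]) [0, 1, 2]
     then (list_all (\<lambda>p. p \<in> set even_perms) r \<or> distinct r) \<and>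
       (if compat mixed_row r then r \<in> set mixed_partners else True)
     else True)"
  by code_simp

text \<open>Beside the row of identities and \<open>mixed_row\<close> there is room for at most one
  further row, whereas four are needed.\<close>

lemma mixed_partners_search:
  "list_all (\<lambda>r. list_all (\<lambda>s. \<not> compat r s) mixed_partners) mixed_partners"
  by code_simp

text \<open>The condition on two rows of a generalised Hadamard matrix of order 6 over Z/3.\<close>

definition balanced_diff :: "int list \<Rightarrow> int list \<Rightarrow> bool" where
  "balanced_diff x y \<longleftrightarrow>
     list_all (\<lambda>t. length (filter (\<lambda>(a, b). (a - b - t) mod 3 = 0) (zip x y)) = 2) [0, 1, 2]"

text \<open>The \<open>g - 1\<close> entries in between put the second zero at position
  \<open>g\<close>.\<close>

definition zero_at :: "nat \<Rightarrow> int list list" where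
  "zero_at g = map (\<lambda>ys. 0 # take (g - 1) ys @ 0 # drop (g - 1) ys) (List.n_lists 4 [1, 2])"

text \<open>Row 0 is zero and row 1 is normalised to [0, 0, 1, 1, 2, 2]. The nested filters discard
  a row before the next one is chosen. The two solutions differ by exchanging the indices 4 and 5 in
  both rows and columns.\<close>

lemma pentagon_search:
  "list_all (\<lambda>x2. list_all (\<lambda>x3. list_all (\<lambda>x4. list_all (\<lambda>x5.
     [x2, x3, x4, x5] = [[0, 1, 0, 2, 1, 2], [0, 1, 2, 0, 2, 1], [0, 2, 1, 2, 0, 1], [0, 2, 2, 1, 1, 0]] \<or>
     [x2, x3, x4, x5] = [[0, 1, 0, 2, 2, 1], [0, 1, 2, 0, 1, 2], [0, 2, 2, 1, 0, 1], [0, 2, 1, 2, 1, 0]])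
     (filter (\<lambda>x. balanced_diff [0, 0, 1, 1, 2, 2] x \<and> balanced_diff x2 x \<and> balanced_diff x3 x \<and> balanced_diff x4 x) (zero_at 5)))
     (filter (\<lambda>x. balanced_diff [0, 0, 1, 1, 2, 2] x \<and> balanced_diff x2 x \<and> balanced_diff x3 x) (zero_at 4)))
     (filter (\<lambda>x. balanced_diff [0, 0, 1, 1, 2, 2] x \<and> balanced_diff x2 x) (zero_at 3)))
     (filter (\<lambda>x. balanced_diff [0, 0, 1, 1, 2, 2] x) (zero_at 2))"
  by code_simp

section \<open>The triangle case: labellings by affine patterns\<close>

context two_regular
begin

lemma tri_decomposition:
  assumes "closed C" "C \<subseteq> tris" "card C = 3 * n"
  shows "\<exists>p. (\<forall>g<n. is_cycle (p g) 3) \<and> (\<Union>g<n. range (p g)) = C \<and>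
    (\<forall>g<n. \<forall>h<n. g \<noteq> h \<longrightarrow> range (p g) \<inter> range (p h) = {})"
  using assms
proof (induction n arbitrary: C)
  case 0
  have "finite C" using finite_subset[OF 0(2) finite_subset[OF tris_subset fin]] .
  then show ?case using 0 by simp
next
  case (Suc n)
  have CV: "C \<subseteq> V" using Suc.prems tris_subset by blast
  have "C \<noteq> {}" using Suc.prems(3) by auto
  then obtain u where u: "u \<in> C" by blast
  then obtain c m where c: "is_cycle c m" "c 0 = u" using cycle_exists CV by blast
  have "c 0 \<in> tris" using c u Suc.prems by auto
  then have m: "m = 3" using cycle_tris_iff[OF c(1)] by simp
  have sub: "range c \<subseteq> C" using closed_cycle_subset[OF c(1) Suc.prems(1)] c u by simp
  have "card (C - range c) = 3 * n"
    using card_Diff_subset[OF finite_subset[OF sub finite_subset[OF CV fin]] sub]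
      Suc.prems(3) card_range_cycle[OF c(1)] m by simp
  moreover have "C - range c \<subseteq> tris" using Suc.prems(2) by auto
  ultimately obtain p where p: "\<forall>g<n. is_cycle (p g) 3" "(\<Union>g<n. range (p g)) = C - range c"
    "\<forall>g<n. \<forall>h<n. g \<noteq> h \<longrightarrow> range (p g) \<inter> range (p h) = {}"
    using Suc.IH[OF closed_diff[OF Suc.prems(1) closed_cycle[OF c(1)]]] by metis
  have "range (p g) \<inter> range c = {}" if "g < n" for g using p(2) that by blast
  then show ?case
    using p c(1) m sub
    by (intro exI[of _ "p(n := c)"]) (auto simp: less_Suc_eq lessThan_Suc)
qed

end

context biadjacency
begin

text \<open>A point lies in exactly one block of each triangle of blocks, at the position \<alpha>
  or \<beta>; common blocks are thus counted by the triangles on which the positions agree.\<close>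

lemma codeg_classes:
  assumes b: "\<And>h. h < n \<Longrightarrow> B.is_cycle (b h) 3" and cov: "(\<Union>h<n. range (b h)) = B"
    and disj: "\<And>g h. g < n \<Longrightarrow> h < n \<Longrightarrow> g \<noteq> h \<Longrightarrow> range (b g) \<inter> range (b h) = {}"
    and u: "\<And>h j. h < n \<Longrightarrow> I u (b h j) \<longleftrightarrow> (j - \<alpha> h) mod 3 = 0"
    and v: "\<And>h j. h < n \<Longrightarrow> I v (b h j) \<longleftrightarrow> (j - \<beta> h) mod 3 = 0"
  shows "codeg u v = card {h. h < n \<and> (\<alpha> h - \<beta> h) mod 3 = 0}"
proof -
  have eq: "b h i = b h j \<longleftrightarrow> (i - j) mod 3 = 0" if "h < n" for h i j
    using B.cycle_eq_iff[OF b[OF that], of i j] by (simp add: dvd_eq_mod_eq_0)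
  have "{x \<in> B. I u x \<and> I v x} = (\<lambda>h. b h (\<alpha> h)) ` {h. h < n \<and> (\<alpha> h - \<beta> h) mod 3 = 0}"
  proof (intro equalityI subsetI)
    fix x assume x: "x \<in> {x \<in> B. I u x \<and> I v x}"
    then obtain h j where h: "h < n" "x = b h j" using cov by blast
    then have "(j - \<alpha> h) mod 3 = 0" "(j - \<beta> h) mod 3 = 0" using x u v by auto
    moreover from this have "(\<alpha> h - \<beta> h) mod 3 = 0" by presburger
    ultimately show "x \<in> (\<lambda>h. b h (\<alpha> h)) ` {h. h < n \<and> (\<alpha> h - \<beta> h) mod 3 = 0}"
      using h eq by (intro image_eqI[of _ _ h]) auto
  next
    fix x assume "x \<in> (\<lambda>h. b h (\<alpha> h)) ` {h. h < n \<and> (\<alpha> h - \<beta> h) mod 3 = 0}"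
    then show "x \<in> {x \<in> B. I u x \<and> I v x}" using u v cov by auto
  qed
  moreover have "inj_on (\<lambda>h. b h (\<alpha> h)) {h. h < n \<and> (\<alpha> h - \<beta> h) mod 3 = 0}"
    by (rule inj_onI) (use disj in blast)
  ultimately show ?thesis unfolding codeg_def by (simp add: card_image)
qed

definition tri_labelling :: "(nat \<Rightarrow> int \<Rightarrow> 'a) \<Rightarrow> (nat \<Rightarrow> int \<Rightarrow> 'b) \<Rightarrow> bool" where
  "tri_labelling p b \<longleftrightarrow> (\<forall>g<6. P.is_cycle (p g) 3) \<and> (\<forall>h<6. B.is_cycle (b h) 3) \<and>
     (\<Union>g<6. range (p g)) = P \<and> (\<Union>h<6. range (b h)) = B \<and>
     (\<forall>g<6. \<forall>h<6. g \<noteq> h \<longrightarrow> range (p g) \<inter> range (p h) = {}) \<and>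
     (\<forall>g<6. \<forall>h<6. g \<noteq> h \<longrightarrow> range (b g) \<inter> range (b h) = {})"

definition affine_labelling where
  "affine_labelling p b q \<longleftrightarrow> tri_labelling p b \<and>
     (\<forall>g<6. \<forall>h<6. q g h \<in> set offsets3 \<and> pat (p g) (b h) 3 {0} (q g h)) \<and>
     (\<forall>g<6. q g 0 = (1, 0)) \<and> (\<forall>h<6. q 0 h = (1, 0))"

text \<open>The normalised patterns are the eleven edges of a spanning tree on the twelve triangles:
  all triangles of points are adjusted to \<open>b 0\<close>, and then the triangles of blocks other
  than \<open>b 0\<close> to the first triangle of points.\<close>

lemma affine_labelling_exists:
  assumes tl: "tri_labelling p b"
  shows "\<exists>p' b' q. affine_labelling p' b' q \<and> (\<forall>h<6. range (b' h) = range (b h))"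
proof -
  have pc: "P.is_cycle (p g) 3" if "g < 6" for g using tl that by (auto simp: tri_labelling_def)
  have bc: "B.is_cycle (b h) 3" if "h < 6" for h using tl that by (auto simp: tri_labelling_def)
  have unit: "fst p = 1 \<or> fst p = - 1" if "p \<in> set offsets3" for p
    using that by (auto simp: offsets3_def)
  have "\<exists>c. P.is_cycle c 3 \<and> range c = range (p g) \<and> pat c (b 0) 3 {0} (1, 0)" if g: "g < 6" for g
  proof -
    obtain r where r: "r \<in> set offsets3" "pat (p g) (b 0) 3 {0} r"
      using tri_pat[OF pc[OF g] bc[of 0]] by auto
    have "pat (\<lambda>k. p g (- fst r * snd r + fst r * k)) (b 0) 3 {0} (1, 0)"
      using pat_point_reparam[of "p g" "b 0" 3 "{0}" "fst r" "snd r"] r unit by simp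
    then show ?thesis
      using P.cycle_reparam[OF pc[OF g] unit[OF r(1)], of "- fst r * snd r"]
        P.range_cycle_reparam[OF pc[OF g] unit[OF r(1)], of "- fst r * snd r"] by blast
  qed
  then obtain p' where p': "\<And>g. g < 6 \<Longrightarrow> P.is_cycle (p' g) 3" "\<And>g. g < 6 \<Longrightarrow> range (p' g) = range (p g)"
    "\<And>g. g < 6 \<Longrightarrow> pat (p' g) (b 0) 3 {0} (1, 0)"
    by metis
  have "\<exists>d. B.is_cycle d 3 \<and> range d = range (b h) \<and> pat (p' 0) d 3 {0} (1, 0) \<and> (h = 0 \<longrightarrow> d = b 0)"
    if h: "h < 6" for h
  proof (cases "h = 0")
    case True
    then show ?thesis using bc[of 0] p'(3)[of 0] by auto
  next
    case False
    obtain r where r: "r \<in> set offsets3" "pat (p' 0) (b h) 3 {0} r"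
      using tri_pat[OF p'(1)[of 0] bc[OF h]] by auto
    obtain a where "pat (p' 0) (\<lambda>j. b h (a + fst r * j)) 3 {0} (1, 0)"
      using pat_block_reparam[of "p' 0" "b h" 3 0 "fst r" "snd r"] r unit by auto
    then show ?thesis
      using B.cycle_reparam[OF bc[OF h] unit[OF r(1)], of a]
        B.range_cycle_reparam[OF bc[OF h] unit[OF r(1)], of a] False by blast
  qed
  then obtain b' where b': "\<And>h. h < 6 \<Longrightarrow> B.is_cycle (b' h) 3" "\<And>h. h < 6 \<Longrightarrow> range (b' h) = range (b h)"
    "\<And>h. h < 6 \<Longrightarrow> pat (p' 0) (b' h) 3 {0} (1, 0)" "b' 0 = b 0"
    by (metis zero_less_numeral)
  have "\<exists>q. q \<in> set offsets3 \<and> pat (p' g) (b' h) 3 {0} q \<and> (g = 0 \<or> h = 0 \<longrightarrow> q = (1, 0))"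
    if "g < 6" "h < 6" for g h
  proof (cases "g = 0 \<or> h = 0")
    case True
    have "(1, 0) \<in> set offsets3" by (simp add: offsets3_def)
    then show ?thesis using True b'(3,4) p'(3) that by metis
  next
    case False
    then show ?thesis using tri_pat[OF p'(1)[OF that(1)] b'(1)[OF that(2)]] by blast
  qed
  then obtain q where q: "\<And>g h. g < 6 \<Longrightarrow> h < 6 \<Longrightarrow> q g h \<in> set offsets3 \<and> pat (p' g) (b' h) 3 {0} (q g h) \<and>
      (g = 0 \<or> h = 0 \<longrightarrow> q g h = (1, 0))"
    by metis
  have "tri_labelling p' b'"
    using tl p'(1,2) b'(1,2) unfolding tri_labelling_def by simp
  then have "affine_labelling p' b' q"
    unfolding affine_labelling_def using q q[of _ 0] q[of 0] by simp
  then show ?thesis using b'(2) by blast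
qed

lemma affine_labelling_codeg:
  assumes al: "affine_labelling p b q" and g: "g < 6" "g' < 6" "g \<noteq> g'"
  shows "card {h. h < 6 \<and> (fst (q g h) * k + snd (q g h) - (fst (q g' h) * l + snd (q g' h))) mod 3 = 0} = 2"
proof -
  have tl: "tri_labelling p b" and pt: "\<And>g h. g < 6 \<Longrightarrow> h < 6 \<Longrightarrow> pat (p g) (b h) 3 {0} (q g h)"
    using al by (auto simp: affine_labelling_def)
  have I: "I (p g k) (b h j) \<longleftrightarrow> (j - (fst (q g h) * k + snd (q g h))) mod 3 = 0" if "g < 6" "h < 6" for g h k j
    using pt[OF that] by (simp add: pat_def algebra_simps)
  have "codeg (p g k) (p g' l) = card {h. h < 6 \<and> (fst (q g h) * k + snd (q g h) - (fst (q g' h) * l + snd (q g' h))) mod 3 = 0}"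
    by (rule codeg_classes[of 6 b]) (use tl I g in \<open>auto simp: tri_labelling_def\<close>)
  moreover have "codeg (p g k) (p g' l) = 2"
  proof (rule codeg_apart[of "range (p g)"])
    have pc: "P.is_cycle (p g) 3" "P.is_cycle (p g') 3" using tl g by (simp_all add: tri_labelling_def)
    show "P.closed (range (p g))" by (rule P.closed_cycle[OF pc(1)])
    show "p g' l \<in> P" by (rule P.cycle_in[OF pc(2)])
    show "p g' l \<notin> range (p g)" using tl g unfolding tri_labelling_def by blast
  qed simp
  ultimately show ?thesis by simp
qed

end

text \<open>The affine permutation of Z/3 with the given slope and offset; it is even precisely for
  slope 1.\<close>

definition perm_of :: "int \<times> int \<Rightarrow> int list" where
  "perm_of p = [snd p mod 3, (fst p + snd p) mod 3, (fst p * 2 + snd p) mod 3]"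

lemma perm_of_nth: "k < 3 \<Longrightarrow> perm_of p ! k = (fst p * int k + snd p) mod 3"
proof -
  assume "k < 3"
  then have "k = 0 \<or> k = 1 \<or> k = 2" by auto
  then show ?thesis by (auto simp: perm_of_def)
qed

lemma perm_of_search:
  "list_all (\<lambda>p. perm_of p \<in> set perms3 \<and> (perm_of p \<in> set even_perms \<longrightarrow> fst p = 1)) offsets3"
  by code_simp

lemma perm_of_offsets3: "p \<in> set offsets3 \<Longrightarrow> perm_of p \<in> set perms3"
  and perm_of_even: "p \<in> set offsets3 \<Longrightarrow> perm_of p \<in> set even_perms \<Longrightarrow> fst p = 1"
  using perm_of_search unfolding list_all_iff by blast+

lemma agreements_map:
  "distinct hs \<Longrightarrow> agreements k l (map f hs) (map g hs) = card {h \<in> set hs. f h ! k = g h ! l}"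
proof (induction hs)
  case (Cons a hs)
  have "{h \<in> set (a # hs). f h ! k = g h ! l} =
    (if f a ! k = g a ! l then insert a else id) {h \<in> set hs. f h ! k = g h ! l}" by auto
  then show ?case using Cons by auto
qed simp

lemma hits_map:
  assumes "distinct hs"
  shows "hits k l (map f hs) = card {h \<in> set hs. f h ! l = k}"
proof -
  have "hits k l (map f hs) = length (filter (\<lambda>h. f h ! l = k) hs)"
    by (simp add: hits_def filter_map comp_def)
  also have "\<dots> = card (set (filter (\<lambda>h. f h ! l = k) hs))"
    using assms by (simp only: distinct_card[OF distinct_filter])
  finally show ?thesis by (simp only: set_filter)
qed

context biadjacency
begin

text \<open>An odd permutation makes its row a list of all six. Reordering the columns turns this
  row into \<open>mixed_row\<close> and keeps row 0, so two of the remaining rows would be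
  compatible members of \<open>mixed_partners\<close>.\<close>

lemma affine_labelling_even:
  assumes al: "affine_labelling p b q" and g: "g < 6" "h < 6"
  shows "fst (q g h) = 1"
proof -
  define f where "f g h = perm_of (q g h)" for g h
  have off: "\<And>g h. g < 6 \<Longrightarrow> h < 6 \<Longrightarrow> q g h \<in> set offsets3"
    and q0: "\<And>g. g < 6 \<Longrightarrow> q g 0 = (1, 0)" "\<And>h. h < 6 \<Longrightarrow> q 0 h = (1, 0)"
    using al by (auto simp: affine_labelling_def)
  have f0: "\<And>g. g < 6 \<Longrightarrow> f g 0 = [0, 1, 2]" "\<And>h. h < 6 \<Longrightarrow> f 0 h = [0, 1, 2]"
    using q0 by (simp_all add: f_def perm_of_def)
  have fp: "f g h \<in> set perms3" if "g < 6" "h < 6" for g h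
    using perm_of_offsets3[OF off[OF that]] by (simp add: f_def)
  have agree: "card {h. h < 6 \<and> f g h ! k = f g' h ! l} = 2"
    if "g < 6" "g' < 6" "g \<noteq> g'" "k < 3" "l < 3" for g g' k l
  proof -
    have "(x - y) mod 3 = 0 \<longleftrightarrow> x mod 3 = y mod 3" for x y :: int by presburger
    then show ?thesis
      using affine_labelling_codeg[OF al that(1-3), of "int k" "int l"]
      by (simp only: f_def perm_of_nth[OF that(4)] perm_of_nth[OF that(5)])
  qed
  have main: "compat (map (f g) hs) (map (f g') hs)" if "g < 6" "g' < 6" "g \<noteq> g'" "distinct hs" "set hs = {..<6}" for g g' hs
  proof -
    have "agreements k l (map (f g) hs) (map (f g') hs) = 2" if "k < 3" "l < 3" for k l
      unfolding agreements_map[OF \<open>distinct hs\<close>] \<open>set hs = {..<6}\<close>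
      using agree[OF \<open>g < 6\<close> \<open>g' < 6\<close> \<open>g \<noteq> g'\<close> that] by simp
    then show ?thesis by (simp add: compat_def)
  qed
  have hits2: "list_all (\<lambda>k. list_all (\<lambda>l. hits k l (map (f g) hs) = 2) [0, 1, 2]) [0, 1, 2]"
    if "g < 6" "g \<noteq> 0" "distinct hs" "set hs = {..<6}" for g hs
  proof -
    have "hits (int k) l (map (f g) hs) = 2" if "k < 3" "l < 3" for k l
    proof -
      have "k = 0 \<or> k = 1 \<or> k = 2" using that by auto
      then have "f 0 h ! k = int k" if "h < 6" for h using f0(2)[OF that] by auto
      then have "{h. h < 6 \<and> f g h ! l = f 0 h ! k} = {h \<in> {..<6}. f g h ! l = int k}"
        by auto
      then show ?thesis
        unfolding hits_map[OF \<open>distinct hs\<close>] \<open>set hs = {..<6}\<close>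
        using agree[OF \<open>g < 6\<close> _ \<open>g \<noteq> 0\<close> that(2,1)] by simp
    qed
    from this[of 0] this[of 1] this[of 2] show ?thesis by simp
  qed
  have search: "(list_all (\<lambda>p. p \<in> set even_perms) (map (f g) hs) \<or> distinct (map (f g) hs)) \<and>
      (compat mixed_row (map (f g) hs) \<longrightarrow> map (f g) hs \<in> set mixed_partners)"
    if g: "g < 6" "g \<noteq> 0" and hs: "distinct (hs' @ [0])" "set (hs' @ [0]) = {..<6}" "hs = hs' @ [0]" for g hs hs'
  proof -
    have h2: "list_all (\<lambda>k. list_all (\<lambda>l. hits k l (map (f g) hs) = 2) [0, 1, 2]) [0, 1, 2]"
      by (rule hits2[OF g]) (use hs in simp_all)
    have "length hs' = 5" using hs distinct_card[of "hs' @ [0]"] by simp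
    moreover have "set (map (f g) hs') \<subseteq> set perms3" using fp[OF g(1)] hs(2) by auto
    moreover have "admissible (map (f g) hs' @ [[0, 1, 2]])"
      using h2 hs(3) f0(1)[OF g(1)] by (simp add: admissible_def)
    ultimately show ?thesis
      using all_extensionsD[OF rows_search, of "map (f g) hs'"] h2 hs(3) f0(1)[OF g(1)] by simp
  qed
  have even_rows: "list_all (\<lambda>p. p \<in> set even_perms) (map (f g) [1, 2, 3, 4, 5, 0])" if g: "g < 6" "g \<noteq> 0" for g
  proof (rule ccontr)
    assume "\<not> ?thesis"
    moreover have "set ([1, 2, 3, 4, 5] @ [0]) = {..<6 :: nat}" by auto
    ultimately have "distinct (map (f g) [1, 2, 3, 4, 5, 0])"
      using search[OF g, of "[1, 2, 3, 4, 5]" "[1, 2, 3, 4, 5, 0]"] by auto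
    then have inj: "inj_on (f g) {..<6}"
    proof -
      assume d: "distinct (map (f g) [1, 2, 3, 4, 5, 0])"
      have "set [1, 2, 3, 4, 5, 0] = {..<6 :: nat}" by auto
      then show ?thesis using d unfolding distinct_map by simp
    qed
    have "card (set perms3) = 6" by (simp add: perms3_def)
    then have im: "f g ` {..<6} = set perms3"
      using fp[OF g(1)] inj by (intro card_subset_eq) (auto simp: card_image)
    \<comment> \<open>\<open>v x\<close> is the column in which row \<open>g\<close> has the
      permutation \<open>x\<close>.\<close>
    define v where "v = the_inv_into {..<6} (f g)"
    have v: "v x < 6" "f g (v x) = x" if "x \<in> set perms3" for x
      using the_inv_into_into[OF inj, of x "{..<6}"] f_the_inv_into_f[OF inj, of x] that im by (auto simp: v_def)
    have v0: "v [0, 1, 2] = 0"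
      using the_inv_into_f_f[OF inj, of 0] f0(1)[OF g(1)] by (simp add: v_def)
    \<comment> \<open>Column 0, where every row has the identity, goes to the end, where the search
      starts.\<close>
    define hs where "hs = map v (tl perms3) @ [0]"
    have hs': "hs = map v mixed_row" by (simp add: hs_def mixed_row_def v0)
    have mr: "set mixed_row = set perms3" "distinct mixed_row" by (auto simp: mixed_row_def perms3_def)
    have "inj_on v (set perms3)" using v(2) by (metis inj_onI)
    then have dist: "distinct hs" unfolding hs' distinct_map using mr by simp
    have "set hs = {..<6}"
      using dist v(1) mr distinct_card[OF dist] unfolding hs' by (intro card_subset_eq) (auto simp: mixed_row_def perms3_def)
    have row: "map (f g) hs = mixed_row"
      unfolding hs' map_map by (rule map_idI) (simp add: v(2) mr(1))
    have partner: "map (f g') hs \<in> set mixed_partners" if "g' < 6" "g' \<noteq> 0" "g' \<noteq> g" for g'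
    proof -
      have "compat mixed_row (map (f g') hs)"
        using main[OF g(1) that(1) that(3)[symmetric] dist \<open>set hs = {..<6}\<close>] unfolding row .
      then show ?thesis
        using search[OF that(1,2) dist[unfolded hs_def] \<open>set hs = {..<6}\<close>[unfolded hs_def] hs_def] by blast
    qed
    obtain g1 g2 where "g1 < 6" "g1 \<noteq> 0" "g1 \<noteq> g" "g2 < 6" "g2 \<noteq> 0" "g2 \<noteq> g" "g1 \<noteq> g2"
    proof (cases "g = 1 \<or> g = 2")
      case True
      then show ?thesis using that[of 3 4] by auto
    next
      case False
      then show ?thesis using that[of 1 2] by auto
    qed
    then show False
      using partner[of g1] partner[of g2] main[of g1 g2 hs] dist \<open>set hs = {..<6}\<close> mixed_partners_search
      by (auto simp: list_all_iff)
  qed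
  show ?thesis
  proof (cases "g = 0")
    case True
    then show ?thesis using q0 g by simp
  next
    case False
    have "h \<in> set [1, 2, 3, 4, 5, 0]" using g by auto
    then have "f g h \<in> set even_perms"
      using even_rows[OF g(1) False] unfolding list_all_iff by auto
    then show ?thesis using perm_of_even[OF off[OF g]] by (simp add: f_def)
  qed
qed

end

text \<open>Off the first row and column, the entries 1 form a pentagon in the complete graph on the five
  remaining indices and the entries 2 the complementary pentagon.\<close>

definition pentagon :: "int list list" where
  "pentagon = [[0, 0, 0, 0, 0, 0], [0, 0, 1, 1, 2, 2], [0, 1, 0, 2, 1, 2],
     [0, 1, 2, 0, 2, 1], [0, 2, 1, 2, 0, 1], [0, 2, 2, 1, 1, 0]]"

lemma card_eq_2_unique:
  assumes "card A = 2" "x \<in> A"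
  shows "\<exists>!y. y \<in> A \<and> y \<noteq> x"
  using assms by (auto simp: card_2_iff)

section \<open>The triangle case: the matrix of offsets modulo 3\<close>

context biadjacency
begin

text \<open>All orientations are 1, so only the matrix \<open>a\<close> of offsets over Z/3 is left;
  by \<open>pure_labelling_row\<close> it is a generalised Hadamard matrix.\<close>

definition pure_labelling where
  "pure_labelling p b a \<longleftrightarrow> tri_labelling p b \<and> (\<forall>g<6. \<forall>h<6. pat (p g) (b h) 3 {0} (1, a g h))"

lemma pure_labelling_row:
  assumes pl: "pure_labelling p b a" and g: "g < 6" "g' < 6" "g \<noteq> g'"
  shows "card {h. h < 6 \<and> (a g h - a g' h - t) mod 3 = 0} = 2"
proof -
  have tl: "tri_labelling p b" using pl by (simp add: pure_labelling_def)
  have I: "I (p g k) (b h j) \<longleftrightarrow> (j - (k + a g h)) mod 3 = 0" if "g < 6" "h < 6" for g h k j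
    using pl that by (simp add: pure_labelling_def pat_def algebra_simps)
  have pc: "P.is_cycle (p g) 3" "P.is_cycle (p g') 3" using tl g by (simp_all add: tri_labelling_def)
  have "codeg (p g 0) (p g' t) = card {h. h < 6 \<and> (0 + a g h - (t + a g' h)) mod 3 = 0}"
    by (rule codeg_classes[of 6 b]) (use tl I g in \<open>auto simp: tri_labelling_def\<close>)
  moreover have "codeg (p g 0) (p g' t) = 2"
  proof (rule codeg_apart[of "range (p g)"])
    show "P.closed (range (p g))" by (rule P.closed_cycle[OF pc(1)])
    show "p g' t \<in> P" by (rule P.cycle_in[OF pc(2)])
    show "p g' t \<notin> range (p g)" using tl g unfolding tri_labelling_def by blast
  qed simp
  ultimately show ?thesis by (simp add: algebra_simps)
qed

lemma pure_labelling_dual: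
  assumes "pure_labelling p b a"
  shows "biadjacency.pure_labelling B S P R (\<lambda>x u. I u x) b p (\<lambda>h g. - a g h)"
proof -
  interpret D: biadjacency B S P R "\<lambda>x u. I u x" by (rule dual)
  have "(j - k - x) mod 3 = 0 \<longleftrightarrow> (k - j + x) mod 3 = 0" for j k x :: int by presburger
  then show ?thesis
    using assms unfolding pure_labelling_def D.pure_labelling_def tri_labelling_def D.tri_labelling_def
      pat_def D.pat_def by simp
qed

lemma pure_labelling_column:
  assumes "pure_labelling p b a" "h < 6" "h' < 6" "h \<noteq> h'"
  shows "card {g. g < 6 \<and> (a g h' - a g h - t) mod 3 = 0} = 2"
  using biadjacency.pure_labelling_row[OF dual pure_labelling_dual[OF assms(1)] assms(2-4), of t]
  by (simp add: algebra_simps)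

lemma pure_labelling_perm:
  assumes pl: "pure_labelling p b a" and \<pi>: "bij_betw \<pi> {..<6} {..<6}" and \<tau>: "bij_betw \<tau> {..<6} {..<6}"
  shows "pure_labelling (\<lambda>g. p (\<pi> g)) (\<lambda>h. b (\<tau> h)) (\<lambda>g h. a (\<pi> g) (\<tau> h))"
proof -
  have 1: "\<pi> g < 6" "\<tau> g < 6" if "g < 6" for g
    using \<pi> \<tau> that by (auto simp: bij_betw_def)
  have 2: "\<pi> g \<noteq> \<pi> h" "\<tau> g \<noteq> \<tau> h" if "g < 6" "h < 6" "g \<noteq> h" for g h
    using \<pi> \<tau> that by (auto simp: bij_betw_def inj_on_def)
  have im: "\<pi> ` {..<6} = {..<6}" "\<tau> ` {..<6} = {..<6}" using \<pi> \<tau> by (simp_all only: bij_betw_def)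
  have "(\<Union>g<6. range (p (\<pi> g))) = (\<Union>g\<in>\<pi> ` {..<6}. range (p g))" "(\<Union>g<6. range (b (\<tau> g))) = (\<Union>g\<in>\<tau> ` {..<6}. range (b g))"
    by blast+
  then have 3: "(\<Union>g<6. range (p (\<pi> g))) = (\<Union>g<6. range (p g))" "(\<Union>g<6. range (b (\<tau> g))) = (\<Union>g<6. range (b g))"
    by (simp_all only: im)
  show ?thesis
    using pl 1 2 unfolding pure_labelling_def tri_labelling_def 3 by simp
qed

text \<open>Reversing all cycles negates the matrix; the reduction modulo 3 keeps its entries among
  0, 1, 2.\<close>

lemma pure_labelling_reflect:
  assumes pl: "pure_labelling p b a"
  shows "pure_labelling (\<lambda>g k. p g (0 + - 1 * k)) (\<lambda>h j. b h (0 + - 1 * j)) (\<lambda>g h. (- a g h) mod 3)"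
proof -
  have m: "(- 1 :: int) = 1 \<or> (- 1 :: int) = - 1" by simp
  have tl: "tri_labelling p b" using pl by (simp add: pure_labelling_def)
  have pc: "P.is_cycle (p g) 3" "B.is_cycle (b g) 3" if "g < 6" for g
    using tl that by (auto simp: tri_labelling_def)
  have r: "range (\<lambda>k. p g (0 + - 1 * k)) = range (p g)" "range (\<lambda>k. b g (0 + - 1 * k)) = range (b g)" if "g < 6" for g
    using P.range_cycle_reparam[OF pc(1)[OF that] m, of 0] B.range_cycle_reparam[OF pc(2)[OF that] m, of 0] by blast+
  have cy: "P.is_cycle (\<lambda>k. p g (0 + - 1 * k)) 3" "B.is_cycle (\<lambda>k. b g (0 + - 1 * k)) 3" if "g < 6" for g
    using P.cycle_reparam[OF pc(1)[OF that] m, of 0] B.cycle_reparam[OF pc(2)[OF that] m, of 0] by blast+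
  have "tri_labelling (\<lambda>g k. p g (0 + - 1 * k)) (\<lambda>h j. b h (0 + - 1 * j))"
    using tl r cy unfolding tri_labelling_def by simp
  moreover have "(0 + - 1 * j - (0 + - 1 * k) - x) mod 3 = 0 \<longleftrightarrow> (j - k - (- x) mod 3) mod 3 = 0" for j k x :: int
    by presburger
  ultimately show ?thesis
    using pl unfolding pure_labelling_def pat_def by simp
qed

lemma pure_labelling_exists:
  assumes tl: "tri_labelling p b"
  obtains p' b' a where "pure_labelling p' b' a" "\<And>h. h < 6 \<Longrightarrow> range (b' h) = range (b h)"
    "\<And>g h. g < 6 \<Longrightarrow> h < 6 \<Longrightarrow> a g h \<in> {0, 1, 2}"
    "\<And>g. g < 6 \<Longrightarrow> a g 0 = 0" "\<And>h. h < 6 \<Longrightarrow> a 0 h = 0"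
proof -
  obtain p' b' q where al: "affine_labelling p' b' q" and r: "\<And>h. h < 6 \<Longrightarrow> range (b' h) = range (b h)"
    using affine_labelling_exists[OF tl] by blast
  have q: "\<And>g h. g < 6 \<Longrightarrow> h < 6 \<Longrightarrow> q g h \<in> set offsets3 \<and> pat (p' g) (b' h) 3 {0} (q g h)"
    "\<And>g. g < 6 \<Longrightarrow> q g 0 = (1, 0)" "\<And>h. h < 6 \<Longrightarrow> q 0 h = (1, 0)" and tl': "tri_labelling p' b'"
    using al by (auto simp: affine_labelling_def)
  have "q g h = (1, snd (q g h))" if "g < 6" "h < 6" for g h
    using affine_labelling_even[OF al that] by (simp add: prod_eq_iff)
  then have "pure_labelling p' b' (\<lambda>g h. snd (q g h))"
    unfolding pure_labelling_def using tl' q(1) by metis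
  moreover have "snd (q g h) \<in> {0, 1, 2}" if "g < 6" "h < 6" for g h
    using q(1)[OF that] by (auto simp: offsets3_def)
  ultimately show ?thesis using that r q(2,3) by force
qed

text \<open>Every row and every column other than the first ones contains one further zero; we move these
  zeros to the diagonal.\<close>

lemma zero_diagonal_labelling:
  assumes tl: "tri_labelling p b"
  obtains p' b' a where "pure_labelling p' b' a" "\<And>h. h < 6 \<Longrightarrow> range (b' h) = range (b h)"
    "\<And>g h. g < 6 \<Longrightarrow> h < 6 \<Longrightarrow> a g h = (0 :: int) \<longleftrightarrow> g = 0 \<or> h = 0 \<or> g = h"
    "\<And>g h. g < 6 \<Longrightarrow> h < 6 \<Longrightarrow> a g h \<in> {0, 1, 2}"
proof -
  obtain p' b' a where pl: "pure_labelling p' b' a" and r: "\<And>h. h < 6 \<Longrightarrow> range (b' h) = range (b h)"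
    and a: "\<And>g h. g < 6 \<Longrightarrow> h < 6 \<Longrightarrow> a g h \<in> {0, 1, 2}"
    and a0: "\<And>g. g < 6 \<Longrightarrow> a g 0 = 0" "\<And>h. h < 6 \<Longrightarrow> a 0 h = 0"
    using pure_labelling_exists[OF tl] by blast
  have z: "a g h mod 3 = 0 \<longleftrightarrow> a g h = 0" if "g < 6" "h < 6" for g h
    using a[OF that] by auto
  have col: "\<exists>!g. (g < 6 \<and> a g h = 0) \<and> g \<noteq> 0" if h: "h < 6" "h \<noteq> 0" for h
  proof -
    have "card {g. g < 6 \<and> a g h mod 3 = 0} = 2"
    proof -
      have "{g. g < 6 \<and> (a g h - a g 0 - 0) mod 3 = 0} = {g. g < 6 \<and> a g h mod 3 = 0}"
        using a0(1) by auto
      then show ?thesis using pure_labelling_column[OF pl _ h(1), of 0 0] h(2) by simp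
    qed
    moreover have "{g. g < 6 \<and> a g h mod 3 = 0} = {g. g < 6 \<and> a g h = 0}"
      by (intro Collect_cong conj_cong refl z h(1))
    ultimately have "card {g. g < 6 \<and> a g h = 0} = 2" by (simp only:)
    moreover have "0 \<in> {g. g < 6 \<and> a g h = 0}" using a0(2)[OF h(1)] by simp
    ultimately have "\<exists>!g. g \<in> {g. g < 6 \<and> a g h = 0} \<and> g \<noteq> 0" by (rule card_eq_2_unique)
    then show ?thesis by (simp only: mem_Collect_eq)
  qed
  have row: "\<exists>!h. (h < 6 \<and> a g h = 0) \<and> h \<noteq> 0" if g: "g < 6" "g \<noteq> 0" for g
  proof -
    have "card {h. h < 6 \<and> a g h mod 3 = 0} = 2"
    proof -
      have "{h. h < 6 \<and> (a g h - a 0 h - 0) mod 3 = 0} = {h. h < 6 \<and> a g h mod 3 = 0}"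
        using a0(2) by auto
      then show ?thesis using pure_labelling_row[OF pl g(1), of 0 0] g(2) by simp
    qed
    moreover have "{h. h < 6 \<and> a g h mod 3 = 0} = {h. h < 6 \<and> a g h = 0}"
      by (intro Collect_cong conj_cong refl z g(1))
    ultimately have "card {h. h < 6 \<and> a g h = 0} = 2" by (simp only:)
    moreover have "0 \<in> {h. h < 6 \<and> a g h = 0}" using a0(1)[OF g(1)] by simp
    ultimately have "\<exists>!h. h \<in> {h. h < 6 \<and> a g h = 0} \<and> h \<noteq> 0" by (rule card_eq_2_unique)
    then show ?thesis by (simp only: mem_Collect_eq)
  qed
  define \<sigma> where "\<sigma> h = (if h = 0 then 0 else THE g. (g < 6 \<and> a g h = 0) \<and> g \<noteq> 0)" for h
  have \<sigma>: "\<sigma> h < 6" "a (\<sigma> h) h = 0" "\<sigma> h \<noteq> 0" if "h < 6" "h \<noteq> 0" for h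
    using theI'[OF col[OF that]] that by (auto simp: \<sigma>_def)
  have \<sigma>_eq: "g = \<sigma> h" if "g < 6" "h < 6" "h \<noteq> 0" "a g h = 0" "g \<noteq> 0" for g h
    using col[OF that(2,3)] \<sigma>[OF that(2,3)] that by blast
  have inj: "inj_on \<sigma> {..<6}"
  proof (rule inj_onI)
    fix h h' assume h: "h \<in> {..<6}" "h' \<in> {..<6}" "\<sigma> h = \<sigma> h'"
    show "h = h'"
    proof (cases "h = 0 \<or> h' = 0")
      case True
      moreover have "\<sigma> 0 = 0" by (simp add: \<sigma>_def)
      ultimately show ?thesis using \<sigma>(3)[of h] \<sigma>(3)[of h'] h by (metis lessThan_iff)
    next
      case False
      then show ?thesis using row[of "\<sigma> h"] \<sigma>[of h] \<sigma>[of h'] h by auto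
    qed
  qed
  have lt: "\<sigma> h < 6" if "h < 6" for h using \<sigma>(1)[of h] that by (cases "h = 0") (auto simp: \<sigma>_def)
  have "\<sigma> ` {..<6} = {..<6}"
    using inj lt by (intro card_subset_eq) (auto simp: card_image)
  then have bij: "bij_betw \<sigma> {..<6} {..<6}" using inj by (simp add: bij_betw_def)
  \<comment> \<open>Only rows are permuted: the columns carry the valency classes of the
    blocks.\<close>
  have "pure_labelling (\<lambda>g. p' (\<sigma> g)) b' (\<lambda>g h. a (\<sigma> g) h)"
    using pure_labelling_perm[OF pl bij, of id] by (simp add: bij_betw_id)
  moreover have "a (\<sigma> g) h = 0 \<longleftrightarrow> g = 0 \<or> h = 0 \<or> g = h" if gh: "g < 6" "h < 6" for g h
  proof (cases "g = 0 \<or> h = 0")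
    case True
    then show ?thesis using a0 gh lt[of g] by (auto simp: \<sigma>_def)
  next
    case False
    have "a (\<sigma> g) h = 0 \<longleftrightarrow> \<sigma> g = \<sigma> h"
      using \<sigma>_eq[of "\<sigma> g" h] \<sigma>[of g] \<sigma>[of h] False gh by auto
    also have "\<dots> \<longleftrightarrow> g = h" using inj gh by (auto simp: inj_on_def)
    finally show ?thesis using False by simp
  qed
  ultimately show ?thesis using that r a lt by blast
qed

lemma below_6: "h < 6 \<longleftrightarrow> h = 0 \<or> h = 1 \<or> h = 2 \<or> h = 3 \<or> h = 4 \<or> h = (5 :: nat)"
  by auto

lemma pure_labelling_balanced:
  assumes pl: "pure_labelling p b a" and g: "g < 6" "g' < 6" "g \<noteq> g'"
  shows "balanced_diff (map (a g) [0..<6]) (map (a g') [0..<6])"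
proof -
  have "length (filter (\<lambda>(x, y). (x - y - t) mod 3 = 0) (zip (map (a g) [0..<6]) (map (a g') [0..<6]))) = 2" for t
  proof -
    have "zip (map (a g) [0..<6]) (map (a g') [0..<6]) = map (\<lambda>h. (a g h, a g' h)) [0..<6]"
      by (simp add: zip_map_map zip_same_conv_map)
    then have "length (filter (\<lambda>(x, y). (x - y - t) mod 3 = 0) (zip (map (a g) [0..<6]) (map (a g') [0..<6])))
        = length (filter (\<lambda>h. (a g h - a g' h - t) mod 3 = 0) [0..<6])"
      by (simp only: filter_map length_map comp_def prod.case)
    also have "\<dots> = card (set (filter (\<lambda>h. (a g h - a g' h - t) mod 3 = 0) [0..<6]))"
      by (rule distinct_card[symmetric]) simp
    also have "set (filter (\<lambda>h. (a g h - a g' h - t) mod 3 = 0) [0..<6]) = {h. h < 6 \<and> (a g h - a g' h - t) mod 3 = 0}"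
      by (simp only: set_filter set_upt atLeastLessThan_iff) blast
    finally show ?thesis using pure_labelling_row[OF pl g] by simp
  qed
  then show ?thesis unfolding balanced_diff_def list_all_iff by blast
qed

lemma swap_bij: "x < 6 \<Longrightarrow> y < 6 \<Longrightarrow> bij_betw (id(x := y, y := x)) {..<6} {..<(6 :: nat)}"
  by (rule bij_betw_byWitness[where f' = "id(x := y, y := x)"]) auto

text \<open>Two kinds of symmetry preserve the zero diagonal and the classes: exchanging two of the
  indices 3, 4, 5 in rows and columns together, and the reflection of everything. They bring row 1
  into the form needed by \<open>pentagon_search\<close> and then identify its two
  solutions.\<close>

lemma pentagon_labelling:
  assumes tl: "tri_labelling p b"
    and B3: "\<And>h. h < 3 \<Longrightarrow> range (b h) \<subseteq> B3" and B2: "\<And>h. 3 \<le> h \<Longrightarrow> h < 6 \<Longrightarrow> range (b h) \<subseteq> B2"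
  shows "\<exists>p b. pure_labelling p b (\<lambda>g h. pentagon ! g ! h) \<and>
    (\<forall>h<3. range (b h) \<subseteq> B3) \<and> (\<forall>h. 3 \<le> h \<longrightarrow> h < 6 \<longrightarrow> range (b h) \<subseteq> B2)"
proof -
  define good where "good p b a \<longleftrightarrow> pure_labelling p b a \<and>
    (\<forall>h<3. range (b h) \<subseteq> B3) \<and> (\<forall>h. 3 \<le> h \<longrightarrow> h < 6 \<longrightarrow> range (b h) \<subseteq> B2) \<and>
    (\<forall>g<6. \<forall>h<6. a g h \<in> {0, 1, 2} \<and> (a g h = (0 :: int) \<longleftrightarrow> g = 0 \<or> h = 0 \<or> g = h))" for p b a
  obtain p1 b1 a1 where 1: "good p1 b1 a1"
  proof (rule zero_diagonal_labelling[OF tl])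
    fix p' b' a
    assume *: "pure_labelling p' b' a" "\<And>h. h < 6 \<Longrightarrow> range (b' h) = range (b h)"
      "\<And>g h. g < 6 \<Longrightarrow> h < 6 \<Longrightarrow> a g h = (0 :: int) \<longleftrightarrow> g = 0 \<or> h = 0 \<or> g = h"
      "\<And>g h. g < 6 \<Longrightarrow> h < 6 \<Longrightarrow> a g h \<in> {0, 1, 2}"
    have "range (b' h) \<subseteq> B3" if "h < 3" for h using *(2)[of h] B3[OF that] that by simp
    moreover have "range (b' h) \<subseteq> B2" if "3 \<le> h" "h < 6" for h using *(2)[OF that(2)] B2[OF that] by simp
    ultimately have "good p' b' a" unfolding good_def using *(1,3,4) by blast
    then show thesis by (rule that)
  qed
  have swap: "good (\<lambda>g. p ((id(x := y, y := x)) g)) (\<lambda>h. b ((id(x := y, y := x)) h))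
      (\<lambda>g h. a ((id(x := y, y := x)) g) ((id(x := y, y := x)) h))"
    if gd: "good p b a" and xy: "3 \<le> x" "x < 6" "3 \<le> y" "y < 6" for p b a x y
  proof -
    let ?t = "id(x := y, y := x)"
    have "pure_labelling (\<lambda>g. p (?t g)) (\<lambda>h. b (?t h)) (\<lambda>g h. a (?t g) (?t h))"
    proof (rule pure_labelling_perm[where \<pi> = ?t and \<tau> = ?t])
      show "pure_labelling p b a" using gd unfolding good_def by blast
      show "bij_betw ?t {..<6} {..<6}" "bij_betw ?t {..<6} {..<6}" using xy by (simp_all only: swap_bij)
    qed
    moreover have "\<forall>h<3. range (b (?t h)) \<subseteq> B3"
    proof (intro allI impI)
      fix h :: nat assume "h < 3"
      moreover from this have "?t h = h" using xy by auto
      ultimately show "range (b (?t h)) \<subseteq> B3" using gd by (simp only: good_def)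
    qed
    moreover have "\<forall>h. 3 \<le> h \<longrightarrow> h < 6 \<longrightarrow> range (b (?t h)) \<subseteq> B2"
    proof (intro allI impI)
      fix h :: nat assume "3 \<le> h" "h < 6"
      then have "3 \<le> ?t h" "?t h < 6" using xy by auto
      then show "range (b (?t h)) \<subseteq> B2" using gd unfolding good_def by blast
    qed
    moreover have "a (?t g) (?t h) \<in> {0, 1, 2} \<and> (a (?t g) (?t h) = 0 \<longleftrightarrow> g = 0 \<or> h = 0 \<or> g = h)"
      if "g < 6" "h < 6" for g h
    proof -
      have "?t g < 6" "?t h < 6" "?t g = 0 \<longleftrightarrow> g = 0" "?t h = 0 \<longleftrightarrow> h = 0" "?t g = ?t h \<longleftrightarrow> g = h"
        using xy that by auto
      then show ?thesis using gd unfolding good_def by metis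
    qed
    ultimately show ?thesis unfolding good_def by blast
  qed
  have reflect: "good (\<lambda>g k. p g (0 + - 1 * k)) (\<lambda>h j. b h (0 + - 1 * j)) (\<lambda>g h. (- a g h) mod 3)"
    if gd: "good p b a" for p b a
  proof -
    have pl: "pure_labelling p b a" using gd by (simp add: good_def)
    have r: "range (\<lambda>j. b h (0 + - 1 * j)) = range (b h)" if "h < 6" for h
      using B.range_cycle_reparam[of "b h" 3 "- 1" 0] pl that
      by (simp add: pure_labelling_def tri_labelling_def)
    have A1: "\<forall>h<3. range (\<lambda>j. b h (0 + - 1 * j)) \<subseteq> B3"
    proof (intro allI impI)
      fix h :: nat assume h: "h < 3"
      then have "range (b h) \<subseteq> B3" using gd unfolding good_def by blast
      then show "range (\<lambda>j. b h (0 + - 1 * j)) \<subseteq> B3" using r[of h] h by simp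
    qed
    have A2: "\<forall>h. 3 \<le> h \<longrightarrow> h < 6 \<longrightarrow> range (\<lambda>j. b h (0 + - 1 * j)) \<subseteq> B2"
    proof (intro allI impI)
      fix h :: nat assume h: "3 \<le> h" "h < 6"
      then have "range (b h) \<subseteq> B2" using gd unfolding good_def by blast
      then show "range (\<lambda>j. b h (0 + - 1 * j)) \<subseteq> B2" using r[OF h(2)] by simp
    qed
    have A3: "\<forall>g<6. \<forall>h<6. (- a g h) mod 3 \<in> {0, 1, 2} \<and> ((- a g h) mod 3 = 0 \<longleftrightarrow> g = 0 \<or> h = 0 \<or> g = h)"
    proof (intro allI impI)
      fix g h :: nat assume "g < 6" "h < 6"
      then have "a g h \<in> {0, 1, 2}" "a g h = 0 \<longleftrightarrow> g = 0 \<or> h = 0 \<or> g = h"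
        using gd unfolding good_def by blast+
      then show "(- a g h) mod 3 \<in> {0, 1, 2} \<and> ((- a g h) mod 3 = 0 \<longleftrightarrow> g = 0 \<or> h = 0 \<or> g = h)" by auto
    qed
    show ?thesis
      unfolding good_def by (intro conjI pure_labelling_reflect[OF pl] A1 A2 A3)
  qed
  have nz: "a g h = 1 \<or> a g h = 2" if gd: "good p b a" and gh: "g < 6" "h < 6" "g \<noteq> 0" "h \<noteq> 0" "g \<noteq> h" for p b a g h
  proof -
    have "a g h \<in> {0, 1, 2}" "a g h = 0 \<longleftrightarrow> g = 0 \<or> h = 0 \<or> g = h"
      using gd gh(1,2) unfolding good_def by blast+
    then show ?thesis using gh(3-5) by auto
  qed
  \<comment> \<open>Index 2 is in another class than 3, 4, 5 and cannot be exchanged with them, so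
    its entry is normalised by the reflection.\<close>
  obtain p2 b2 a2 where 2: "good p2 b2 a2" "a2 1 2 = 1"
  proof (cases "a1 1 2 = 1")
    case True
    show ?thesis by (rule that[OF 1 True])
  next
    case False
    then have a12: "a1 1 2 = 2" using nz[OF 1, of 1 2] by simp
    show ?thesis by (rule that[OF reflect[OF 1]]) (simp only: a12, simp)
  qed
  have entries: "a g 0 = 0" "a 0 g = 0" "a g g = 0" if "good p b a" "g < 6" for p b a g
  proof -
    have "a g 0 = 0 \<longleftrightarrow> g = 0 \<or> (0::nat) = 0 \<or> g = 0" "a 0 g = 0 \<longleftrightarrow> (0::nat) = 0 \<or> g = 0 \<or> 0 = g"
      "a g g = 0 \<longleftrightarrow> g = 0 \<or> g = 0 \<or> g = g"
      using that zero_less_numeral[where ?'a = nat] unfolding good_def by blast+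
    then show "a g 0 = 0" "a 0 g = 0" "a g g = 0" by simp_all
  qed
  have upt6: "[0..<6] = [0, 1, 2, 3, 4, 5]" by (simp add: upt_rec)
  \<comment> \<open>The difference of row 1 and the zero row contains every residue twice, so
    exactly one more 1 stands among the last three entries.\<close>
  have row1: "a 1 3 = 1 \<and> a 1 4 = 2 \<and> a 1 5 = 2 \<or> a 1 3 = 2 \<and> a 1 4 = 1 \<and> a 1 5 = 2 \<or> a 1 3 = 2 \<and> a 1 4 = 2 \<and> a 1 5 = 1"
    if gd: "good p b a" and a12: "a 1 2 = 1" for p b a
  proof -
    have "balanced_diff (map (a 1) [0..<6]) (map (a 0) [0..<6])"
      using gd by (intro pure_labelling_balanced[of p b]) (simp_all add: good_def)
    then have "balanced_diff [0, 0, 1, a 1 3, a 1 4, a 1 5] [0, 0, 0, 0, 0, 0]"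
      using entries[OF gd] a12 unfolding upt6 by simp
    moreover have "a 1 3 = 1 \<or> a 1 3 = 2" "a 1 4 = 1 \<or> a 1 4 = 2" "a 1 5 = 1 \<or> a 1 5 = 2"
      using nz[OF gd] by simp_all
    ultimately show ?thesis by (auto simp: balanced_diff_def)
  qed
  obtain p3 b3 a3 where 3: "good p3 b3 a3" "a3 1 2 = 1" "a3 1 3 = 1" "a3 1 4 = 2" "a3 1 5 = 2"
    using row1[OF 2]
  proof (elim disjE conjE)
    assume *: "a2 1 3 = 1" "a2 1 4 = 2" "a2 1 5 = 2"
    show thesis by (rule that[OF 2 *])
  next
    assume *: "a2 1 3 = 2" "a2 1 4 = 1" "a2 1 5 = 2"
    show thesis by (rule that[OF swap[OF 2(1), of 3 4]]) (use 2(2) * in simp_all)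
  next
    assume *: "a2 1 3 = 2" "a2 1 4 = 2" "a2 1 5 = 1"
    show thesis by (rule that[OF swap[OF 2(1), of 3 5]]) (use 2(2) * in simp_all)
  qed
  define x where "x g = map (a3 g) [0..<6]" for g
  have x1: "x 1 = [0, 0, 1, 1, 2, 2]"
    using 3 entries[OF 3(1)] unfolding x_def upt6 by simp
  have bal: "balanced_diff (x g) (x g')" if "g < 6" "g' < 6" "g \<noteq> g'" for g g'
  proof -
    have "pure_labelling p3 b3 a3" using 3(1) unfolding good_def by blast
    then show ?thesis unfolding x_def using that by (rule pure_labelling_balanced)
  qed
  have mem: "x g \<in> set (zero_at g)" if g: "g = 2 \<or> g = 3 \<or> g = 4 \<or> g = 5" for g
  proof -
    define hs where "hs = filter (\<lambda>h. h \<noteq> 0 \<and> h \<noteq> g) [0, 1, 2, 3, 4, 5]"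
    have hs: "set hs = {1..<6} - {g}" using g by (auto simp: hs_def)
    define ys where "ys = map (a3 g) hs"
    have ys: "set ys \<subseteq> {1, 2}"
    proof
      fix y assume "y \<in> set ys"
      then obtain h where h: "y = a3 g h" "h \<in> {1..<6} - {g}" unfolding ys_def set_map hs by blast
      then show "y \<in> {1, 2}" using nz[OF 3(1), of g h] g by auto
    qed
    have "length ys = 4" using g by (auto simp: ys_def hs_def)
    moreover have "x g = 0 # take (g - 1) ys @ 0 # drop (g - 1) ys"
      unfolding x_def ys_def hs_def upt6
      using g by (elim disjE) (simp_all add: entries[OF 3(1)] numeral_eq_Suc)
    ultimately show ?thesis
      using ys unfolding zero_at_def by (auto simp: set_n_lists)
  qed
  have X: "[x 2, x 3, x 4, x 5] = [[0, 1, 0, 2, 1, 2], [0, 1, 2, 0, 2, 1], [0, 2, 1, 2, 0, 1], [0, 2, 2, 1, 1, 0]] \<or>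
     [x 2, x 3, x 4, x 5] = [[0, 1, 0, 2, 2, 1], [0, 1, 2, 0, 1, 2], [0, 2, 2, 1, 0, 1], [0, 2, 1, 2, 1, 0]]"
  proof -
    have m2: "x 2 \<in> set (filter (\<lambda>x. balanced_diff [0, 0, 1, 1, 2, 2] x) (zero_at 2))"
      using mem[of 2] bal[of 1 2] x1 by simp
    have m3: "x 3 \<in> set (filter (\<lambda>y. balanced_diff [0, 0, 1, 1, 2, 2] y \<and> balanced_diff (x 2) y) (zero_at 3))"
      using mem[of 3] bal[of 1 3] bal[of 2 3] x1 by simp
    have m4: "x 4 \<in> set (filter (\<lambda>y. balanced_diff [0, 0, 1, 1, 2, 2] y \<and> balanced_diff (x 2) y \<and> balanced_diff (x 3) y) (zero_at 4))"
      using mem[of 4] bal[of 1 4] bal[of 2 4] bal[of 3 4] x1 by simp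
    have m5: "x 5 \<in> set (filter (\<lambda>y. balanced_diff [0, 0, 1, 1, 2, 2] y \<and> balanced_diff (x 2) y \<and> balanced_diff (x 3) y \<and> balanced_diff (x 4) y) (zero_at 5))"
      using mem[of 5] bal[of 1 5] bal[of 2 5] bal[of 3 5] bal[of 4 5] x1 by simp
    show ?thesis by (rule pentagon_search[unfolded list_all_iff, THEN bspec, THEN bspec, THEN bspec, THEN bspec, OF m2 m3 m4 m5])
  qed
  have finish: ?thesis if gd: "good p b a" and "\<And>g h. g < 6 \<Longrightarrow> h < 6 \<Longrightarrow> a g h = pentagon ! g ! h" for p b a
    using that unfolding good_def pure_labelling_def by (intro exI[of _ p] exI[of _ b]) simp
  have rows: "[a3 g 0, a3 g 1, a3 g 2, a3 g 3, a3 g 4, a3 g 5] = x g" for g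
    unfolding x_def upt6 by simp
  have x0: "x 0 = [0, 0, 0, 0, 0, 0]" using entries[OF 3(1)] unfolding x_def upt6 by simp
  note R = rows[of 0, unfolded x0] rows[of 1, unfolded x1] rows[of 2] rows[of 3] rows[of 4] rows[of 5]
  from X show ?thesis
  proof
    assume "[x 2, x 3, x 4, x 5] = [[0, 1, 0, 2, 1, 2], [0, 1, 2, 0, 2, 1], [0, 2, 1, 2, 0, 1], [0, 2, 2, 1, 1, 0]]"
    then show ?thesis using R by (intro finish[OF 3(1)]) (auto simp: below_6 pentagon_def)
  next
    assume "[x 2, x 3, x 4, x 5] = [[0, 1, 0, 2, 2, 1], [0, 1, 2, 0, 1, 2], [0, 2, 2, 1, 0, 1], [0, 2, 1, 2, 1, 0]]"
    then show ?thesis using R by (intro finish[OF swap[OF 3(1), of 4 5]]) (auto simp: below_6 pentagon_def)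
  qed
qed

end

section \<open>The three valency classes and the edges between them\<close>

text \<open>\<open>degree\<close> and \<open>codegree\<close> are the diagonal and the other entries
  of A^2 + A - 6 = 2 c c^T. No eigenvalue is mentioned, so that the locale can also be verified by
  counting for the two explicit graphs.\<close>

locale three_valency_graph =
  fixes V :: "'a set" and E :: "'a \<Rightarrow> 'a \<Rightarrow> bool" and c :: "'a \<Rightarrow> nat"
  assumes fin: "finite V"
    and wf: "E u v \<Longrightarrow> u \<in> V"
    and sym: "E u v \<Longrightarrow> E v u"
    and irrefl: "\<not> E u u"
    and c_range: "u \<in> V \<Longrightarrow> c u \<in> {1, 2, 3}"
    and card_classes: "card {u \<in> V. c u = 1} = 9" "card {u \<in> V. c u = 2} = 9" "card {u \<in> V. c u = 3} = 18"
    and degree: "u \<in> V \<Longrightarrow> card {v. E u v} = 2 * (c u)\<^sup>2 + 6"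
    and codegree: "u \<in> V \<Longrightarrow> v \<in> V \<Longrightarrow> u \<noteq> v \<Longrightarrow>
      card {w. E u w \<and> E w v} + of_bool (E u v) = 2 * c u * c v"
begin

definition W :: "nat \<Rightarrow> 'a set" where "W i = {u \<in> V. c u = i}"
definition a :: "'a \<Rightarrow> 'a \<Rightarrow> int" where "a u v = of_bool (E u v)"
definition d :: "nat \<Rightarrow> 'a \<Rightarrow> int" where "d i u = (\<Sum>v\<in>W i. a u v)"
definition paths :: "nat \<Rightarrow> 'a \<Rightarrow> 'a \<Rightarrow> int" where "paths i u v = (\<Sum>w\<in>W i. a u w * a w v)"

lemma W: "finite (W i)" "W i \<subseteq> V" "card (W 1) = 9" "card (W 2) = 9" "card (W 3) = 18"
  using fin card_classes by (auto simp: W_def)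

lemma V_eq: "V = W 1 \<union> (W 2 \<union> W 3)"
  using c_range by (auto simp: W_def)

lemma sum_V: "(\<Sum>v\<in>V. f v) = (\<Sum>v\<in>W 1. f v) + (\<Sum>v\<in>W 2. f v) + (\<Sum>v\<in>W 3. f v :: int)"
proof -
  have "W 1 \<inter> (W 2 \<union> W 3) = {}" "W 2 \<inter> W 3 = {}" by (auto simp: W_def)
  then have "sum f (W 1 \<union> (W 2 \<union> W 3)) = (\<Sum>v\<in>W 1. f v) + (\<Sum>v\<in>W 2. f v) + (\<Sum>v\<in>W 3. f v)"
    using W(1) by (simp add: sum.union_disjoint)
  moreover have "sum f V = sum f (W 1 \<union> (W 2 \<union> W 3))" by (rule arg_cong[OF V_eq])
  ultimately show ?thesis by simp
qed

lemma a_sym: "a u v = a v u"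
  using sym by (auto simp: a_def)

lemma a_irrefl [simp]: "a u u = 0"
  using irrefl by (simp add: a_def)

lemma a_sq [simp]: "a u v * a u v = a u v"
  by (simp add: a_def)

lemma card_nbs: "int (card {v. E u v}) = (\<Sum>v\<in>V. a u v)"
proof -
  have "{v. E u v} = {v \<in> V. E u v}" using wf sym by blast
  then show ?thesis unfolding a_def using int_card_filter[OF fin, of "E u"] by simp
qed

lemma card_paths: "int (card {w. E u w \<and> E w v}) = (\<Sum>w\<in>V. a u w * a w v)"
proof -
  have "{w. E u w \<and> E w v} = {w \<in> V. E u w \<and> E w v}" using wf by blast
  then show ?thesis unfolding a_def using int_card_filter[OF fin, of "\<lambda>w. E u w \<and> E w v"]
    by (simp only: of_bool_conj)
qed

lemma two_paths:
  assumes "u \<in> V" "v \<in> V"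
  shows "(\<Sum>w\<in>V. a u w * a w v) = 2 * int (c u) * int (c v) - a u v + (if u = v then 6 else 0)"
proof (cases "u = v")
  case True
  have "(\<Sum>w\<in>V. a u w * a w v) = (\<Sum>w\<in>V. a u w)"
    using True by (intro sum.cong refl) (simp add: a_sym[of _ v])
  then show ?thesis using degree[OF assms(1)] card_nbs[of u] True by (simp add: power2_eq_square)
next
  case False
  have "int (card {w. E u w \<and> E w v}) + a u v = 2 * int (c u) * int (c v)"
    using arg_cong[OF codegree[OF assms False], of int] by (simp add: a_def)
  then show ?thesis unfolding card_paths using False by simp
qed

lemma sum_paths: "u \<in> V \<Longrightarrow> v \<in> V \<Longrightarrow>
    paths 1 u v + paths 2 u v + paths 3 u v = 2 * int (c u) * int (c v) - a u v + (if u = v then 6 else 0)"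
  using two_paths[of u v] by (simp add: sum_V paths_def)

lemma sum_d: "u \<in> V \<Longrightarrow> d 1 u + d 2 u + d 3 u = 2 * (int (c u))\<^sup>2 + 6"
  using degree[of u] card_nbs[of u] by (simp add: sum_V d_def)

text \<open>The vector of weights is an eigenvector for the eigenvalue 20.\<close>

lemma weighted_degree:
  assumes u: "u \<in> V"
  shows "d 1 u + 2 * d 2 u + 3 * d 3 u = 20 * int (c u)"
proof -
  define s where "s u = (\<Sum>v\<in>V. a u v * int (c v))" for u
  have delta: "(\<Sum>w\<in>V. (if w = v then 6 else 0) * f w) = 6 * f v" "(\<Sum>w\<in>V. (if v = w then 6 else 0) * f w) = 6 * f v"
    if "v \<in> V" for v and f :: "'a \<Rightarrow> int"
  proof -
    have "(\<Sum>w\<in>V. (if w = v then 6 else 0) * f w) = (\<Sum>w\<in>V. if w = v then 6 * f w else 0)"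
      "(\<Sum>w\<in>V. (if v = w then 6 else 0) * f w) = (\<Sum>w\<in>V. if w = v then 6 * f w else 0)"
      by (intro sum.cong; simp)+
    then show "(\<Sum>w\<in>V. (if w = v then 6 else 0) * f w) = 6 * f v" "(\<Sum>w\<in>V. (if v = w then 6 else 0) * f w) = 6 * f v"
      using that fin by simp_all
  qed
  \<comment> \<open>A commutes with A^2 = 2 c c^T - A + 6, so (A c) c^T is symmetric and A c is a
    multiple of c.\<close>
  have comm: "s u * int (c v) = int (c u) * s v" if "u \<in> V" "v \<in> V" for u v
  proof -
    have "(\<Sum>w\<in>V. a u w * (\<Sum>x\<in>V. a w x * a x v)) = (\<Sum>x\<in>V. (\<Sum>w\<in>V. a u w * a w x) * a x v)"
      unfolding sum_distrib_left sum_distrib_right by (subst sum.swap) (simp add: mult.assoc)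
    moreover have "(\<Sum>w\<in>V. a u w * (\<Sum>x\<in>V. a w x * a x v))
        = (\<Sum>w\<in>V. a u w * (2 * int (c w) * int (c v) - a w v + (if w = v then 6 else 0)))"
      using that by (intro sum.cong refl) (simp add: two_paths)
    moreover have "\<dots> = 2 * s u * int (c v) - (\<Sum>w\<in>V. a u w * a w v) + 6 * a u v"
      using delta(1)[OF that(2), of "a u"]
      by (simp add: s_def algebra_simps sum.distrib sum_subtractf sum_distrib_left)
    moreover have "(\<Sum>x\<in>V. (\<Sum>w\<in>V. a u w * a w x) * a x v)
        = (\<Sum>x\<in>V. (2 * int (c u) * int (c x) - a u x + (if u = x then 6 else 0)) * a x v)"
      using that by (intro sum.cong refl) (simp add: two_paths)
    moreover have "\<dots> = 2 * int (c u) * s v - (\<Sum>w\<in>V. a u w * a w v) + 6 * a u v"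
      using delta(2)[OF that(1), of "\<lambda>x. a x v"] a_sym
      by (simp add: s_def algebra_simps sum.distrib sum_subtractf sum_distrib_left)
    ultimately show ?thesis by simp
  qed
  obtain z where z: "z \<in> V" "c z = 1" using W(3) unfolding W_def by (metis (mono_tags, lifting) Collect_empty_eq card.empty zero_neq_numeral)
  define l where "l = s z"
  have s: "s u = l * int (c u)" if "u \<in> V" for u using comm[OF that z(1)] z(2) by (simp add: l_def)
  have "(\<Sum>w\<in>V. a z w * s w) = (\<Sum>w\<in>V. a z w * (l * int (c w)))"
    by (intro sum.cong) (simp_all add: s)
  also have "\<dots> = l * s z" by (simp add: s_def sum_distrib_left algebra_simps)
  finally have 1: "(\<Sum>w\<in>V. a z w * s w) = l\<^sup>2" by (simp add: l_def power2_eq_square)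
  have "(\<Sum>w\<in>V. a z w * s w) = (\<Sum>x\<in>V. (\<Sum>w\<in>V. a z w * a w x) * int (c x))"
    unfolding s_def sum_distrib_left sum_distrib_right by (subst sum.swap) (simp add: mult.assoc)
  also have "\<dots> = (\<Sum>x\<in>V. (2 * int (c z) * int (c x) - a z x + (if z = x then 6 else 0)) * int (c x))"
    using z by (intro sum.cong refl) (simp add: two_paths)
  also have "\<dots> = 2 * (\<Sum>x\<in>V. (int (c x))\<^sup>2) - s z + 6"
    using delta(2)[OF z(1), of "\<lambda>x. int (c x)"] z(2)
    by (simp add: s_def algebra_simps sum.distrib sum_subtractf sum_distrib_left power2_eq_square)
  \<comment> \<open>The sum is 9 * 1 + 9 * 4 + 18 * 9. It yields l^2 = 2 * 207 + 6 - l, with the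
    roots 20 and - 21.\<close>
  also have "(\<Sum>x\<in>V. (int (c x))\<^sup>2) = 207"
  proof -
    have "(\<Sum>x\<in>W i. (int (c x))\<^sup>2) = int (card (W i)) * (int i)\<^sup>2" for i
      by (simp add: W_def)
    then show ?thesis unfolding sum_V using W by simp
  qed
  finally have "l\<^sup>2 = 420 - l" using 1 by (simp add: l_def)
  then have "(l - 20) * (l + 21) = 0" by (simp add: algebra_simps power2_eq_square)
  moreover have "l \<ge> 0" unfolding l_def s_def by (intro sum_nonneg) (simp add: a_def)
  ultimately have "l = 20" by simp
  moreover have "s u = d 1 u + 2 * d 2 u + 3 * d 3 u"
  proof -
    have "(\<Sum>v\<in>W i. a u v * int (c v)) = int i * d i u" for i
      unfolding d_def sum_distrib_left by (intro sum.cong) (auto simp: W_def)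
    then show ?thesis unfolding s_def sum_V by simp
  qed
  ultimately show ?thesis using s[OF u] by simp
qed

lemma d_nonneg: "d i u \<ge> 0"
  unfolding d_def a_def by (intro sum_nonneg) simp

lemma a_zero_of_d: "d i u = 0 \<Longrightarrow> v \<in> W i \<Longrightarrow> a u v = 0"
  unfolding d_def using W(1)[of i] by (subst (asm) sum_nonneg_eq_0_iff) (auto simp: a_def)

lemma paths_nonneg: "paths i u v \<ge> 0"
  unfolding paths_def a_def by (intro sum_nonneg) simp

lemma paths_lower_bound: "d i u + d i v - int (card (W i)) \<le> paths i u v"
proof -
  have "(\<Sum>w\<in>W i. a u w + a v w - 1) \<le> paths i u v"
    unfolding paths_def by (intro sum_mono) (auto simp: a_def sym)
  then show ?thesis by (simp add: d_def sum.distrib sum_subtractf)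
qed

text \<open>A vertex of \<open>W 2\<close> with a neighbour in \<open>W 1\<close> must have 1, 0 and
  13 neighbours in the three classes. By parity \<open>x\<close> has a second neighbour
  \<open>v\<close> in \<open>W 2\<close>. Then \<open>w\<close> and \<open>v\<close> are not
  adjacent and have 8 common neighbours, but at least 13 + 13 - 18 = 8 of them lie in
  \<open>W 3\<close>, and \<open>x\<close> is another one.\<close>

lemma no_12_edges:
  assumes x: "x \<in> W 1" and w: "w \<in> W 2"
  shows "a x w = 0"
proof (rule ccontr)
  assume "a x w \<noteq> 0"
  then have xw: "a x w = 1" by (simp add: a_def split: if_splits)
  have V: "x \<in> V" "c x = 1" using x by (simp_all add: W_def)
  have type2: "d 3 v = 13 \<and> d 2 v = 0" if v: "v \<in> W 2" "a x v = 1" for v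
  proof -
    have "v \<in> V" "c v = 2" using v by (simp_all add: W_def)
    then have "d 1 v + d 2 v + d 3 v = 14" "d 1 v + 2 * d 2 v + 3 * d 3 v = 40"
      using sum_d[of v] weighted_degree[of v] by simp_all
    moreover have "d 1 v \<noteq> 0" using a_zero_of_d[OF _ x] v a_sym[of x v] by force
    ultimately show ?thesis using d_nonneg[of 1 v] d_nonneg[of 2 v] by presburger
  qed
  have "d 1 x + d 2 x + d 3 x = 8" "d 1 x + 2 * d 2 x + 3 * d 3 x = 20"
    using sum_d[OF V(1)] weighted_degree[OF V(1)] V(2) by simp_all
  then have "even (d 2 x)" by presburger
  have "\<exists>v\<in>W 2. v \<noteq> w \<and> a x v = 1"
  proof (rule ccontr)
    assume no: "\<not> ?thesis"
    have "d 2 x = a x w + (\<Sum>v\<in>W 2 - {w}. a x v)"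
      unfolding d_def using w W(1) by (simp add: sum.remove)
    also have "(\<Sum>v\<in>W 2 - {w}. a x v) = 0"
      using no by (intro sum.neutral) (auto simp: a_def)
    finally show False using xw \<open>even (d 2 x)\<close> by simp
  qed
  then obtain v where v: "v \<in> W 2" "v \<noteq> w" "a x v = 1" by blast
  have nadj: "a w v = 0" using type2[OF w xw] a_zero_of_d v(1) by blast
  have VV: "w \<in> V" "v \<in> V" "c w = 2" "c v = 2" using w v by (simp_all add: W_def)
  have "paths 1 w v + paths 2 w v + paths 3 w v = 8"
    using sum_paths[OF VV(1,2)] VV nadj v(2) by auto
  moreover have "8 \<le> paths 3 w v"
    using paths_lower_bound[of 3 w v] type2[OF w xw] type2[OF v(1,3)] W by simp
  moreover have "1 \<le> paths 1 w v"
  proof -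
    have "a w x * a x v \<le> paths 1 w v"
      unfolding paths_def by (rule member_le_sum[OF x]) (auto simp: a_def W(1))
    then show ?thesis using xw v(3) a_sym[of x w] by simp
  qed
  ultimately show False using paths_nonneg[of 2 w v] by simp
qed

lemma d_W1: assumes "x \<in> W 1" shows "d 1 x = 2" "d 2 x = 0" "d 3 x = 6"
proof -
  have V: "x \<in> V" "c x = 1" using assms by (simp_all add: W_def)
  show "d 2 x = 0" unfolding d_def using no_12_edges[OF assms] by simp
  then show "d 1 x = 2" "d 3 x = 6"
    using sum_d[OF V(1)] weighted_degree[OF V(1)] V(2) by simp_all
qed

lemma d_W2: assumes "x \<in> W 2" shows "d 1 x = 0" "d 2 x = 2" "d 3 x = 12"
proof -
  have V: "x \<in> V" "c x = 2" using assms by (simp_all add: W_def)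
  show "d 1 x = 0" unfolding d_def using no_12_edges[OF _ assms] a_sym[of x] by simp
  then show "d 2 x = 2" "d 3 x = 12"
    using sum_d[OF V(1)] weighted_degree[OF V(1)] V(2) by simp_all
qed

text \<open>Double counting gives the sum 54 and the sum of squares 162 for \<open>d 1\<close> over
  18 vertices, so its variance about the mean 3 is zero. The other two numbers follow from the two
  linear equations.\<close>

lemma d_W3: assumes u: "u \<in> W 3" shows "d 1 u = 3" "d 2 u = 6" "d 3 u = 15"
proof -
  have s1: "(\<Sum>u\<in>W 3. d 1 u) = 54"
  proof -
    have "(\<Sum>u\<in>W 3. d 1 u) = (\<Sum>x\<in>W 1. d 3 x)"
      unfolding d_def by (subst sum.swap) (intro sum.cong refl a_sym)
    then show ?thesis using W d_W1(3) by simp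
  qed
  have sq: "(\<Sum>u\<in>W i. (d 1 u)\<^sup>2) = (\<Sum>x\<in>W 1. \<Sum>y\<in>W 1. paths i x y)" for i
  proof -
    have "(\<Sum>u\<in>W i. (d 1 u)\<^sup>2) = (\<Sum>u\<in>W i. \<Sum>x\<in>W 1. \<Sum>y\<in>W 1. a x u * a u y)"
      unfolding d_def power2_eq_square sum_product using a_sym by (intro sum.cong refl) simp
    also have "\<dots> = (\<Sum>x\<in>W 1. \<Sum>u\<in>W i. \<Sum>y\<in>W 1. a x u * a u y)" by (rule sum.swap)
    also have "\<dots> = (\<Sum>x\<in>W 1. \<Sum>y\<in>W 1. paths i x y)"
      unfolding paths_def by (intro sum.cong refl sum.swap)
    finally show ?thesis .
  qed
  have p2: "paths 2 x y = 0" if "x \<in> W 1" for x y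
    unfolding paths_def using no_12_edges[OF that] by simp
  have "(\<Sum>x\<in>W 1. \<Sum>y\<in>W 1. paths 1 x y) + (\<Sum>x\<in>W 1. \<Sum>y\<in>W 1. paths 3 x y)
      = (\<Sum>x\<in>W 1. \<Sum>y\<in>W 1. 2 - a x y + (if x = y then 6 else 0))"
    unfolding sum.distrib[symmetric]
  proof (intro sum.cong refl)
    fix x y assume "x \<in> W 1" "y \<in> W 1"
    then show "paths 1 x y + paths 3 x y = 2 - a x y + (if x = y then 6 else 0)"
      using sum_paths[of x y] p2 by (auto simp: W_def)
  qed
  also have "\<dots> = (\<Sum>x\<in>W 1. 18 - d 1 x + 6)"
    using W by (intro sum.cong refl) (simp add: sum.distrib sum_subtractf d_def)
  also have "\<dots> = 198" using W d_W1(1) by simp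
  finally have "(\<Sum>u\<in>W 1. (d 1 u)\<^sup>2) + (\<Sum>u\<in>W 3. (d 1 u)\<^sup>2) = 198" unfolding sq .
  moreover have "(\<Sum>u\<in>W 1. (d 1 u)\<^sup>2) = 36" using W d_W1(1) by simp
  ultimately have s2: "(\<Sum>u\<in>W 3. (d 1 u)\<^sup>2) = 162" by simp
  have "(\<Sum>u\<in>W 3. (d 1 u - 3)\<^sup>2) = (\<Sum>u\<in>W 3. (d 1 u)\<^sup>2 - 6 * d 1 u + 9)"
    by (intro sum.cong) (simp_all add: power2_diff)
  also have "\<dots> = 0" using s1 s2 W by (simp add: sum.distrib sum_subtractf sum_distrib_left[symmetric])
  finally have "(d 1 u - 3)\<^sup>2 = 0" using u W(1) by (subst (asm) sum_nonneg_eq_0_iff) auto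
  then show d1: "d 1 u = 3" by simp
  have V: "u \<in> V" "c u = 3" using u by (simp_all add: W_def)
  show "d 2 u = 6" "d 3 u = 15"
    using d1 sum_d[OF V(1)] weighted_degree[OF V(1)] V(2) by simp_all
qed

end

section \<open>The incidence structure of the graph\<close>

context three_valency_graph
begin

text \<open>A vertex of valency 14 has 12 neighbours among the 18 vertices of valency 24; the
  complement leaves 6, as for valency 8. Likewise \<open>R\<close> is non-adjacency because its
  valency is 17 - 15 = 2.\<close>

definition Inc :: "'a \<Rightarrow> 'a \<Rightarrow> bool" where "Inc u x \<longleftrightarrow> (E u x \<longleftrightarrow> c x = 1)"
definition R :: "'a \<Rightarrow> 'a \<Rightarrow> bool" where "R u v \<longleftrightarrow> u \<in> W 3 \<and> v \<in> W 3 \<and> u \<noteq> v \<and> \<not> E u v"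
definition B :: "'a set" where "B = W 1 \<union> W 2"
definition S :: "'a \<Rightarrow> 'a \<Rightarrow> bool" where "S x y \<longleftrightarrow> x \<in> B \<and> y \<in> B \<and> E x y"

lemma W_disjoint: "W 1 \<inter> W 2 = {}"
  by (auto simp: W_def)

lemma card_B_eq: "finite B \<Longrightarrow> int (card {x \<in> B. Q x}) = (\<Sum>x\<in>W 1. of_bool (Q x)) + (\<Sum>x\<in>W 2. of_bool (Q x))"
  unfolding int_card_filter B_def using W(1) W_disjoint by (intro sum.union_disjoint) auto

lemma finite_B: "finite B"
  by (simp add: B_def W)

lemma Inc_W1: "x \<in> W 1 \<Longrightarrow> of_bool (Inc u x) = a u x"
  and Inc_W2: "x \<in> W 2 \<Longrightarrow> of_bool (Inc u x) = 1 - a u x"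
  by (auto simp: Inc_def a_def W_def)

lemma R_eq: "u \<in> W 3 \<Longrightarrow> v \<in> W 3 \<Longrightarrow> of_bool (R u v) = 1 - of_bool (u = v) - a u v"
  by (auto simp: R_def a_def irrefl)

lemma card_R: "int (card {v. R u v \<and> Q v}) = (\<Sum>v\<in>W 3. of_bool (R u v) * of_bool (Q v))"
proof -
  have "{v. R u v \<and> Q v} = {v \<in> W 3. R u v \<and> Q v}" by (auto simp: R_def)
  then show ?thesis by (simp only: int_card_filter[OF W(1)] of_bool_conj)
qed

lemma S_eq: "x \<in> B \<Longrightarrow> y \<in> B \<Longrightarrow> of_bool (S x y) = a x y"
  by (simp add: S_def a_def)

lemma card_S: "x \<in> B \<Longrightarrow> int (card {y. S x y \<and> Q y}) = (\<Sum>y\<in>W 1. a x y * of_bool (Q y)) + (\<Sum>y\<in>W 2. a x y * of_bool (Q y))"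
proof -
  assume x: "x \<in> B"
  have "{y. S x y \<and> Q y} = {y \<in> B. S x y \<and> Q y}" by (auto simp: S_def)
  then have "int (card {y. S x y \<and> Q y}) = (\<Sum>y\<in>W 1. of_bool (S x y \<and> Q y)) + (\<Sum>y\<in>W 2. of_bool (S x y \<and> Q y))"
    using card_B_eq[OF finite_B] by simp
  also have "(\<Sum>y\<in>W 1. of_bool (S x y \<and> Q y)) = (\<Sum>y\<in>W 1. a x y * of_bool (Q y))"
    using x by (intro sum.cong refl) (simp add: S_def a_def B_def)
  also have "(\<Sum>y\<in>W 2. of_bool (S x y \<and> Q y)) = (\<Sum>y\<in>W 2. a x y * of_bool (Q y))"
    using x by (intro sum.cong refl) (simp add: S_def a_def B_def)
  finally show ?thesis .
qed

lemma sum_delta_mult: "u \<in> W i \<Longrightarrow> (\<Sum>w\<in>W i. of_bool (u = w) * f w) = (f u :: int)"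
proof -
  assume u: "u \<in> W i"
  have "(\<Sum>w\<in>W i. of_bool (u = w) * f w) = (\<Sum>w\<in>W i. if u = w then f w else 0)"
    by (intro sum.cong) auto
  then show ?thesis using u W(1)[of i] by simp
qed

lemma no_21: "x \<in> W 1 \<Longrightarrow> y \<in> W 2 \<Longrightarrow> a y x = 0"
  using no_12_edges a_sym by metis

lemma sum_R:
  assumes u: "u \<in> W 3"
  shows "(\<Sum>w\<in>W 3. of_bool (R u w) * f w) = (\<Sum>w\<in>W 3. f w) - f u - (\<Sum>w\<in>W 3. a u w * f w)"
proof -
  have "(\<Sum>w\<in>W 3. of_bool (R u w) * f w) = (\<Sum>w\<in>W 3. f w - of_bool (u = w) * f w - a u w * f w)"
    using u by (intro sum.cong) (simp_all add: R_eq algebra_simps)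
  then show ?thesis using sum_delta_mult[OF u, of f] by (simp only: sum_subtractf)
qed

lemma cV: "u \<in> W i \<Longrightarrow> u \<in> V" "u \<in> W i \<Longrightarrow> c u = i"
  by (auto simp: W_def)

lemma sum_Inc_W3_1: "x \<in> W 1 \<Longrightarrow> (\<Sum>u\<in>W 3. of_bool (Inc u x)) = (6 :: int)"
  using d_W1(3)[of x] by (simp add: Inc_W1 d_def a_sym[of _ x])

lemma sum_Inc_W3_2: "x \<in> W 2 \<Longrightarrow> (\<Sum>u\<in>W 3. of_bool (Inc u x)) = (6 :: int)"
  using d_W2(3)[of x] W(5) by (simp add: Inc_W2 d_def a_sym[of _ x] sum_subtractf)

text \<open>Apart from the degrees, each axiom is the count \<open>sum_paths\<close> of two-paths
  between two of the classes, with the complements expanded. Mixed terms vanish because there are no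
  edges between \<open>W 1\<close> and \<open>W 2\<close>.\<close>

lemma biadjacency: "biadjacency (W 3) R B S Inc"
proof
  show "finite (W 3)" "card (W 3) = 18" "finite B" using W finite_B by auto
  show "card B = 18" using W W_disjoint by (simp add: B_def card_Un_disjoint)
  show "R u v \<Longrightarrow> u \<in> W 3" "R u v \<Longrightarrow> R v u" "\<not> R u u" for u v using sym by (auto simp: R_def)
  show "S u v \<Longrightarrow> u \<in> B" "S u v \<Longrightarrow> S v u" "\<not> S u u" for u v using sym irrefl by (auto simp: S_def)
  show R2: "card {v. R u v} = 2" if u: "u \<in> W 3" for u
  proof -
    have "int (card {v. R u v}) = (\<Sum>v\<in>W 3. of_bool (R u v) * 1)"
      using card_R[of u "\<lambda>_. True"] by simp
    also have "\<dots> = 2" unfolding sum_R[OF u] using W(5) d_W3(3)[OF u] by (simp add: d_def)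
    finally show ?thesis by simp
  qed
  show "card {y. S x y} = 2" if x: "x \<in> B" for x
  proof -
    have "int (card {y. S x y}) = d 1 x + d 2 x"
      using card_S[OF x, of "\<lambda>_. True"] by (simp add: d_def)
    then show ?thesis using x d_W1[of x] d_W2[of x] by (auto simp: B_def)
  qed
  show "card {x \<in> B. Inc u x} = 6" if u: "u \<in> W 3" for u
  proof -
    have "int (card {x \<in> B. Inc u x}) = d 1 u + (9 - d 2 u)"
      unfolding card_B_eq[OF finite_B] using W(4) by (simp add: Inc_W1 Inc_W2 d_def sum_subtractf)
    then show ?thesis using d_W3[OF u] by simp
  qed
  show "card {u \<in> W 3. Inc u x} = 6" if x: "x \<in> B" for x
  proof -
    have "int (card {u \<in> W 3. Inc u x}) = 6"
      using x sum_Inc_W3_1[of x] sum_Inc_W3_2[of x] unfolding int_card_filter[OF W(1)] B_def by blast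
    then show ?thesis by simp
  qed
  show "card {v. R u v \<and> Inc v x} = card {y. S x y \<and> Inc u y}" if u: "u \<in> W 3" and x: "x \<in> B" for u x
  proof -
    have uV: "u \<in> V" "c u = 3" using cV[OF u] by auto
    have L: "int (card {v. R u v \<and> Inc v x}) = 6 - of_bool (Inc u x) - (\<Sum>v\<in>W 3. a u v * of_bool (Inc v x))"
      unfolding card_R sum_R[OF u] using x sum_Inc_W3_1[of x] sum_Inc_W3_2[of x] by (auto simp: B_def)
    from x consider "x \<in> W 1" | "x \<in> W 2" by (auto simp: B_def)
    then have "int (card {v. R u v \<and> Inc v x}) = int (card {y. S x y \<and> Inc u y})"
    proof cases
      case 1
      have xV: "x \<in> V" "c x = 1" "u \<noteq> x" using cV[OF 1] uV by auto
      have "paths 2 u x = 0" unfolding paths_def using no_21[OF 1] by simp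
      then have "paths 1 u x + paths 3 u x = 6 - a u x"
        using sum_paths[OF uV(1) xV(1)] uV xV by simp
      moreover have "(\<Sum>v\<in>W 3. a u v * of_bool (Inc v x)) = paths 3 u x"
        unfolding paths_def using 1 by (simp add: Inc_W1)
      moreover have "int (card {y. S x y \<and> Inc u y}) = paths 1 u x"
        unfolding card_S[OF x] paths_def using no_12_edges[OF 1] a_sym[of x] by (simp add: Inc_W1 mult.commute)
      ultimately show ?thesis unfolding L using 1 by (simp add: Inc_W1)
    next
      case 2
      have xV: "x \<in> V" "c x = 2" "u \<noteq> x" using cV[OF 2] uV by auto
      have "paths 1 u x = 0" unfolding paths_def using no_12_edges[OF _ 2] by simp
      then have "paths 2 u x + paths 3 u x = 12 - a u x"
        using sum_paths[OF uV(1) xV(1)] uV xV by simp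
      moreover have "(\<Sum>v\<in>W 3. a u v * of_bool (Inc v x)) = d 3 u - paths 3 u x"
        unfolding paths_def d_def using 2 by (simp add: Inc_W2 algebra_simps sum_subtractf)
      moreover have "int (card {y. S x y \<and> Inc u y}) = d 2 x - paths 2 u x"
        unfolding card_S[OF x] paths_def d_def using no_21[OF _ 2] a_sym[of x]
        by (simp add: Inc_W1 Inc_W2 algebra_simps sum_subtractf)
      ultimately show ?thesis unfolding L using 2 d_W3[OF u] d_W2[OF 2] by (simp add: Inc_W2)
    qed
    then show ?thesis by simp
  qed
  show "card {x \<in> B. Inc u x \<and> Inc v x} + of_bool (R u v) + card {w. R u w \<and> R w v} = 2"
    if uv: "u \<in> W 3" "v \<in> W 3" "u \<noteq> v" for u v
  proof -
    have V: "u \<in> V" "c u = 3" "v \<in> V" "c v = 3" using cV[OF uv(1)] cV[OF uv(2)] by auto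
    have "int (card {x \<in> B. Inc u x \<and> Inc v x})
        = (\<Sum>x\<in>W 1. a u x * a x v) + (\<Sum>x\<in>W 2. 1 - a u x - a v x + a u x * a x v)"
      unfolding card_B_eq[OF finite_B] of_bool_conj
      by (simp add: Inc_W1 Inc_W2 a_sym[of v] algebra_simps)
    also have "\<dots> = paths 1 u v + paths 2 u v - 3"
      using W(4) d_W3[OF uv(1)] d_W3[OF uv(2)] by (simp add: paths_def d_def sum.distrib sum_subtractf)
    finally have 1: "int (card {x \<in> B. Inc u x \<and> Inc v x}) = paths 1 u v + paths 2 u v - 3" .
    have "int (card {w. R u w \<and> R w v}) = (\<Sum>w\<in>W 3. of_bool (R u w) * of_bool (R v w))"
      unfolding card_R using sym by (intro sum.cong) (auto simp: R_def)
    also have "\<dots> = (\<Sum>w\<in>W 3. of_bool (R v w)) - of_bool (R v u) - (\<Sum>w\<in>W 3. of_bool (R v w) * a u w)"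
      unfolding sum_R[OF uv(1)] by (simp add: mult.commute)
    also have "(\<Sum>w\<in>W 3. of_bool (R v w)) = int (card {w. R v w})"
      using card_R[of v "\<lambda>_. True"] by simp
    also have "(\<Sum>w\<in>W 3. of_bool (R v w) * a u w) = d 3 u - a u v - paths 3 u v"
      unfolding sum_R[OF uv(2)] paths_def d_def a_sym[of v] by (simp add: mult.commute)
    finally have 2: "int (card {w. R u w \<and> R w v}) = 2 - of_bool (R v u) - 15 + a u v + paths 3 u v"
      using R2[OF uv(2)] d_W3[OF uv(1)] by simp
    have "int (card {x \<in> B. Inc u x \<and> Inc v x} + of_bool (R u v) + card {w. R u w \<and> R w v}) = 2"
      using 1 2 sum_paths[OF V(1,3)] V uv R_eq[OF uv(1,2)] R_eq[OF uv(2,1)] a_sym[of u v] by simp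
    then show ?thesis by linarith
  qed
  show "card {u \<in> W 3. Inc u x \<and> Inc u y} + of_bool (S x y) + card {z. S x z \<and> S z y} = 2"
    if xy: "x \<in> B" "y \<in> B" "x \<noteq> y" for x y
  proof -
    have S2: "int (card {z. S x z \<and> S z y}) = paths 1 x y + paths 2 x y"
      unfolding card_S[OF xy(1)] paths_def using xy(2) by (simp add: S_eq B_def)
    have A: "int (card {u \<in> W 3. Inc u x \<and> Inc u y}) = (\<Sum>u\<in>W 3. of_bool (Inc u x) * of_bool (Inc u y))"
      unfolding int_card_filter[OF W(1)] of_bool_conj ..
    have mixed: "int (card {u \<in> W 3. Inc u x \<and> Inc u y}) = 2 \<and> a x y = 0 \<and> paths 1 x y + paths 2 x y = 0"
      if "x \<in> W 1" "y \<in> W 2" for x y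
    proof -
      have V: "x \<in> V" "c x = 1" "y \<in> V" "c y = 2" "x \<noteq> y" using cV[OF that(1)] cV[OF that(2)] by auto
      have p: "paths 1 x y = 0" "paths 2 x y = 0" unfolding paths_def using no_12_edges that by simp_all
      have "(\<Sum>u\<in>W 3. of_bool (Inc u x) * of_bool (Inc u y)) = d 3 x - paths 3 x y"
        unfolding paths_def d_def using that by (simp add: Inc_W1 Inc_W2 a_sym[of _ x] algebra_simps sum_subtractf)
      then show ?thesis
        unfolding int_card_filter[OF W(1)] of_bool_conj
        using p sum_paths[OF V(1,3)] V no_12_edges[OF that] d_W1[OF that(1)] by simp
    qed
    have "int (card {u \<in> W 3. Inc u x \<and> Inc u y}) + a x y + paths 1 x y + paths 2 x y = 2"
    proof -
      from xy consider "x \<in> W 1" "y \<in> W 1" | "x \<in> W 2" "y \<in> W 2" | "x \<in> W 1" "y \<in> W 2" | "x \<in> W 2" "y \<in> W 1"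
        by (auto simp: B_def)
      then show ?thesis
      proof cases
        case 1
        have V: "x \<in> V" "c x = 1" "y \<in> V" "c y = 1" using cV[OF 1(1)] cV[OF 1(2)] by auto
        have "(\<Sum>u\<in>W 3. of_bool (Inc u x) * of_bool (Inc u y)) = paths 3 x y"
          unfolding paths_def using 1 by (simp add: Inc_W1 a_sym[of _ x])
        then show ?thesis unfolding A using sum_paths[OF V(1,3)] V xy(3) by simp
      next
        case 2
        have V: "x \<in> V" "c x = 2" "y \<in> V" "c y = 2" using cV[OF 2(1)] cV[OF 2(2)] by auto
        have "(\<Sum>u\<in>W 3. of_bool (Inc u x) * of_bool (Inc u y)) = (\<Sum>u\<in>W 3. 1 - a x u - a y u + a x u * a u y)"
          using 2 by (intro sum.cong) (simp_all add: Inc_W2 a_sym[of _ x] a_sym[of _ y] algebra_simps)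
        also have "\<dots> = paths 3 x y - 6"
          using W(5) d_W2[OF 2(1)] d_W2[OF 2(2)] by (simp add: paths_def d_def sum.distrib sum_subtractf)
        finally show ?thesis unfolding A using sum_paths[OF V(1,3)] V xy(3) by simp
      next
        case 3
        then show ?thesis using mixed by simp
      next
        case 4
        have "paths i x y = paths i y x" for i
          unfolding paths_def by (intro sum.cong) (simp_all add: a_sym[of x] a_sym[of y] mult.commute)
        then show ?thesis using mixed[OF 4(2,1)] a_sym[of x y] by (simp add: conj_commute)
      qed
    qed
    then have "int (card {u \<in> W 3. Inc u x \<and> Inc u y} + of_bool (S x y) + card {z. S x z \<and> S z y}) = 2"
      using S2 S_eq[OF xy(1,2)] by simp
    then show ?thesis by linarith
  qed
qed

end

section \<open>From the spectrum to the common neighbours\<close>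

lemma out_degree_with_proj: "out_degree (with_proj G) v = card {w. (v, w) \<in> parcs G}"
proof -
  have "out_arcs (with_proj G) v = Pair v ` {w. (v, w) \<in> parcs G}"
    by (auto simp: out_arcs_def)
  then show ?thesis unfolding out_degree_def by (simp add: card_image inj_on_def)
qed

lemma adjacency_mat_carrier: "adjacency_mat G vs \<in> carrier_mat (length vs) (length vs)"
  by (simp add: adjacency_mat_def)

lemma sum_nth_distinct:
  "distinct vs \<Longrightarrow> (\<Sum>k<length vs. f (vs ! k)) = (\<Sum>v\<in>set vs. f v)"
  by (rule sum.reindex_bij_betw[OF bij_betw_nth]) auto

lemma adjacency_mat_square_index:
  assumes "distinct vs" "i < length vs" "j < length vs"
  shows "(adjacency_mat G vs * adjacency_mat G vs) $$ (i, j)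
    = real (card {w \<in> set vs. (vs ! i, w) \<in> parcs G \<and> (w, vs ! j) \<in> parcs G})"
proof -
  have "(adjacency_mat G vs * adjacency_mat G vs) $$ (i, j)
      = (\<Sum>k<length vs. (if (vs ! i, vs ! k) \<in> parcs G then 1 else 0) * (if (vs ! k, vs ! j) \<in> parcs G then 1 else 0))"
    using assms(2,3) by (simp add: adjacency_mat_def scalar_prod_def atLeast0LessThan)
  also have "\<dots> = (\<Sum>k<length vs. of_bool ((vs ! i, vs ! k) \<in> parcs G \<and> (vs ! k, vs ! j) \<in> parcs G))"
    by (intro sum.cong) auto
  also have "\<dots> = (\<Sum>w\<in>set vs. of_bool ((vs ! i, w) \<in> parcs G \<and> (w, vs ! j) \<in> parcs G))"
    by (rule sum_nth_distinct[OF assms(1)])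
  finally show ?thesis by (simp add: Int_def)
qed

definition weight_of :: "'a pair_pre_digraph \<Rightarrow> 'a \<Rightarrow> nat" where
  "weight_of G v = (if out_degree (with_proj G) v = 24 then 3 else if out_degree (with_proj G) v = 14 then 2 else 1)"

context pair_graph
begin

lemma arcs_sym: "(u, v) \<in> parcs G \<Longrightarrow> (v, u) \<in> parcs G"
  using pair_sym_arcs by (auto simp: symmetric_def dest: symD)

lemma arcs_irrefl: "(u, u) \<notin> parcs G"
  using pair_no_loops by fastforce

lemma two_paths_in_verts: "{w. (u, w) \<in> parcs G \<and> (w, v) \<in> parcs G} = {w \<in> pverts G. (u, w) \<in> parcs G \<and> (w, v) \<in> parcs G}"
  using in_arcsD1 by blast

lemma nbs_two_paths: "{w. (u, w) \<in> parcs G \<and> (w, u) \<in> parcs G} = {w. (u, w) \<in> parcs G}"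
  using arcs_sym by blast

text \<open>On the spectrum x^2 + x - 6 = (x - 2)(x + 3) vanishes except at 20, so
  \<open>symmetric_quadratic_minors\<close> determines the square of each entry from the valencies.
  Off the diagonal the entries are counts, hence nonnegative, and the sign is determined
  too.\<close>

lemma three_valency_graph_of_spectrum:
  assumes va: "has_valency_array G [18, 9, 9] [24, 14, 8]"
    and sp: "graph_spectrum G = replicate_mset 1 20 + replicate_mset 17 2 + replicate_mset 18 (- 3)"
  shows "three_valency_graph (pverts G) (\<lambda>u v. (u, v) \<in> parcs G) (weight_of G)"
proof -
  let ?deg = "out_degree (with_proj G)"
  have fin: "finite (pverts G)" by (rule pair_finite_verts)
  have degs: "?deg v \<in> {24, 14, 8}" if "v \<in> pverts G" for v
    using va that unfolding has_valency_array_def by auto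
  have cards: "card {v \<in> pverts G. ?deg v = 24} = 18" "card {v \<in> pverts G. ?deg v = 14} = 9"
    "card {v \<in> pverts G. ?deg v = 8} = 9"
    using va unfolding has_valency_array_def by (auto simp: numeral_3_eq_3 All_less_Suc)
  have w: "weight_of G v = 3 \<longleftrightarrow> ?deg v = 24" "weight_of G v = 2 \<longleftrightarrow> ?deg v = 14"
    "weight_of G v = 1 \<longleftrightarrow> ?deg v = 8" "?deg v = 2 * (weight_of G v)\<^sup>2 + 6" if "v \<in> pverts G" for v
    using degs[OF that] by (auto simp: weight_of_def)
  have classes: "card {v \<in> pverts G. weight_of G v = 1} = 9" "card {v \<in> pverts G. weight_of G v = 2} = 9"
    "card {v \<in> pverts G. weight_of G v = 3} = 18"
    using cards w by (simp_all cong: conj_cong)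
  have "pverts G = {v \<in> pverts G. ?deg v = 24} \<union> {v \<in> pverts G. ?deg v = 14} \<union> {v \<in> pverts G. ?deg v = 8}"
    using degs by auto
  moreover have "card \<dots> = 36"
    using cards fin by (subst card_Un_disjoint; (subst card_Un_disjoint)?; auto)
  ultimately have card: "card (pverts G) = 36" by simp
  obtain vs where vs: "distinct vs" "set vs = pverts G" using finite_distinct_list[OF fin] by blast
  have len: "length vs = 36" using distinct_card[OF vs(1)] vs(2) card by simp
  define A where "A = adjacency_mat G vs"
  define es where "es = replicate 1 (20 :: real) @ replicate 17 2 @ replicate 18 (- 3)"
  have A: "A \<in> carrier_mat 36 36" using adjacency_mat_carrier[of G vs] len by (simp add: A_def)
  have AT: "transpose_mat A = A"
    by (rule eq_matI) (auto simp: A_def adjacency_mat_def dest: arcs_sym)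
  have "proots (char_poly A) = mset es"
    using sp graph_spectrum_eq[OF vs] by (simp add: A_def es_def)
  then have char: "char_poly A = (\<Prod>a\<leftarrow>es. [:- a, 1:])"
    using A by (intro char_poly_split_of_proots) (auto simp: es_def)
  define M where "M = A * A + 1 \<cdot>\<^sub>m A + (- 6) \<cdot>\<^sub>m 1\<^sub>m 36"
  have minors: "(M $$ (i, j))\<^sup>2 = M $$ (i, i) * M $$ (j, j)" if "i < 36" "j < 36" for i j
    \<comment> \<open>414 = 20^2 + 20 - 6.\<close>
    by (rule symmetric_quadratic_minors[OF A AT char, where b = 1 and c = "- 6" and d = 414 and M = M])
       (use that in \<open>auto simp: es_def M_def sum_list_replicate\<close>)
  have entry: "M $$ (i, j) = real (card {w. (vs ! i, w) \<in> parcs G \<and> (w, vs ! j) \<in> parcs G})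
      + of_bool ((vs ! i, vs ! j) \<in> parcs G) - (if i = j then 6 else 0)" if "i < 36" "j < 36" for i j
    using that A adjacency_mat_square_index[OF vs(1), of i j G] len vs(2) two_paths_in_verts[of "vs ! i" "vs ! j"]
    by (simp add: M_def A_def adjacency_mat_def del: index_mult_mat(1))
  \<comment> \<open>The valencies 24, 14, 8 minus 6 are twice the squares of 3, 2, 1: this is the
    origin of the weights.\<close>
  have diag: "M $$ (i, i) = 2 * (real (weight_of G (vs ! i)))\<^sup>2" if "i < 36" for i
  proof -
    have "vs ! i \<in> pverts G" using that len vs(2) by (metis nth_mem)
    then have "real (card {w. (vs ! i, w) \<in> parcs G}) = 2 * (real (weight_of G (vs ! i)))\<^sup>2 + 6"
      using w(4)[of "vs ! i"] by (simp add: out_degree_with_proj)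
    then show ?thesis using entry[OF that that] arcs_irrefl by (simp add: nbs_two_paths)
  qed
  show ?thesis
  proof
    show "finite (pverts G)" by (rule fin)
    show "u \<in> pverts G" if "(u, v) \<in> parcs G" for u v using that by (rule in_arcsD1)
    show "(v, u) \<in> parcs G" if "(u, v) \<in> parcs G" for u v using that by (rule arcs_sym)
    show "(u, u) \<notin> parcs G" for u by (rule arcs_irrefl)
    show "weight_of G u \<in> {1, 2, 3}" for u by (simp add: weight_of_def)
    show "card {u \<in> pverts G. weight_of G u = 1} = 9" "card {u \<in> pverts G. weight_of G u = 2} = 9"
      "card {u \<in> pverts G. weight_of G u = 3} = 18" by (rule classes)+
    show "card {v. (u, v) \<in> parcs G} = 2 * (weight_of G u)\<^sup>2 + 6" if "u \<in> pverts G" for u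
      using w(4)[OF that] by (simp add: out_degree_with_proj)
    fix u v assume uv: "u \<in> pverts G" "v \<in> pverts G" "u \<noteq> v"
    then obtain i j where ij: "i < 36" "j < 36" "u = vs ! i" "v = vs ! j"
      using vs(2) len by (metis in_set_conv_nth)
    have "(M $$ (i, j))\<^sup>2 = (2 * real (weight_of G u) * real (weight_of G v))\<^sup>2"
      using minors[OF ij(1,2)] diag[OF ij(1)] diag[OF ij(2)] ij by (simp add: power2_eq_square)
    moreover have "M $$ (i, j) = real (card {w. (u, w) \<in> parcs G \<and> (w, v) \<in> parcs G} + of_bool ((u, v) \<in> parcs G))"
      using entry[OF ij(1,2)] ij uv(3) by auto
    ultimately have "real (card {w. (u, w) \<in> parcs G \<and> (w, v) \<in> parcs G} + of_bool ((u, v) \<in> parcs G))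
        = 2 * real (weight_of G u) * real (weight_of G v)"
      by (simp add: power2_eq_iff_nonneg)
    also have "\<dots> = real (2 * weight_of G u * weight_of G v)" by simp
    finally show "card {w. (u, w) \<in> parcs G \<and> (w, v) \<in> parcs G} + of_bool ((u, v) \<in> parcs G)
        = 2 * weight_of G u * weight_of G v"
      by (simp only: of_nat_eq_iff)
  qed
qed

end

section \<open>From the common neighbours back to the spectrum\<close>

lemma sum_list_three_values:
  fixes f :: "'a \<Rightarrow> 'b :: comm_semiring_1"
  assumes "set es \<subseteq> {x, y, z}" "x \<noteq> y" "x \<noteq> z" "y \<noteq> z"
  shows "(\<Sum>a\<leftarrow>es. f a) = of_nat (count (mset es) x) * f x + of_nat (count (mset es) y) * f y + of_nat (count (mset es) z) * f z"
  using assms by (induction es) (auto simp: algebra_simps)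

context pair_graph
begin

text \<open>The product of A^2 + A - 6 = 2 c c^T and A - 20 is zero because c is an eigenvector, so
  only 20, 2 and - 3 are eigenvalues. Their multiplicities are determined by their sum 36, the trace
  0 of A and the trace of A^2 + A.\<close>

lemma spectrum_of_three_valency_graph:
  assumes tv: "three_valency_graph (pverts G) (\<lambda>u v. (u, v) \<in> parcs G) c"
  shows "has_valency_array G [18, 9, 9] [24, 14, 8]"
    "graph_spectrum G = replicate_mset 1 20 + replicate_mset 17 2 + replicate_mset 18 (- 3)"
proof -
  interpret T: three_valency_graph "pverts G" "\<lambda>u v. (u, v) \<in> parcs G" c by (rule tv)
  have deg: "out_degree (with_proj G) v = 2 * (c v)\<^sup>2 + 6" if "v \<in> pverts G" for v
    using T.degree[OF that] by (simp add: out_degree_with_proj)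
  have dc: "out_degree (with_proj G) v = 24 \<longleftrightarrow> c v = 3" "out_degree (with_proj G) v = 14 \<longleftrightarrow> c v = 2"
    "out_degree (with_proj G) v = 8 \<longleftrightarrow> c v = 1" if "v \<in> pverts G" for v
    using deg[OF that] T.c_range[OF that] by auto
  have cards: "card {v \<in> pverts G. out_degree (with_proj G) v = 24} = 18"
    "card {v \<in> pverts G. out_degree (with_proj G) v = 14} = 9"
    "card {v \<in> pverts G. out_degree (with_proj G) v = 8} = 9"
    using T.card_classes dc by (simp_all cong: conj_cong)
  have ex: "\<exists>v\<in>pverts G. out_degree (with_proj G) v = k" if "k \<in> {24, 14, 8}" for k
  proof -
    have "{v \<in> pverts G. out_degree (with_proj G) v = k} \<noteq> {}"
    proof -
      have "k = 24 \<or> k = 14 \<or> k = 8" using that by simp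
      then have "card {v \<in> pverts G. out_degree (with_proj G) v = k} \<noteq> 0"
        using cards by (elim disjE) (metis zero_neq_numeral)+
      then show ?thesis by (metis card.empty)
    qed
    then show ?thesis by blast
  qed
  have "out_degree (with_proj G) ` pverts G = {24, 14, 8}"
  proof (intro equalityI subsetI)
    fix k assume "k \<in> out_degree (with_proj G) ` pverts G"
    then obtain v where v: "v \<in> pverts G" "k = out_degree (with_proj G) v" by blast
    then show "k \<in> {24, 14, 8}" using deg[OF v(1)] T.c_range[OF v(1)] by auto
  next
    fix k :: nat assume "k \<in> {24, 14, 8}"
    from ex[OF this] show "k \<in> out_degree (with_proj G) ` pverts G" by blast
  qed
  moreover have "card {v \<in> pverts G. out_degree (with_proj G) v = [24, 14, 8] ! i} = [18, 9, 9] ! i" if "i < 3" for i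
  proof -
    have "i = 0 \<or> i = 1 \<or> i = 2" using that by auto
    then show ?thesis using cards by (elim disjE) simp_all
  qed
  ultimately show "has_valency_array G [18, 9, 9] [24, 14, 8]"
    unfolding has_valency_array_def by simp
  obtain vs where vs: "distinct vs" "set vs = pverts G" using finite_distinct_list[OF T.fin] by blast
  have card: "card (pverts G) = 36"
    using T.sum_V[of "\<lambda>_. 1"] T.W by simp
  have len: "length vs = 36" using distinct_card[OF vs(1)] vs(2) card by simp
  define A where "A = adjacency_mat G vs"
  have A: "A \<in> carrier_mat 36 36" using adjacency_mat_carrier[of G vs] len by (simp add: A_def)
  define M where "M = A * A + 1 \<cdot>\<^sub>m A + (- 6) \<cdot>\<^sub>m 1\<^sub>m 36"
  have Mc: "M \<in> carrier_mat 36 36" using A by (simp add: M_def)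
  have vsG: "vs ! i \<in> pverts G" if "i < 36" for i using that len vs(2) by (metis nth_mem)
  have Aij: "A $$ (i, j) = of_int (T.a (vs ! i) (vs ! j))" if "i < 36" "j < 36" for i j
    using that len by (simp add: A_def adjacency_mat_def T.a_def)
  have AA: "(A * A) $$ (i, j) = of_int (\<Sum>w\<in>pverts G. T.a (vs ! i) w * T.a w (vs ! j))" if "i < 36" "j < 36" for i j
  proof -
    have "(A * A) $$ (i, j) = real (card {w \<in> set vs. (vs ! i, w) \<in> parcs G \<and> (w, vs ! j) \<in> parcs G})"
      unfolding A_def by (rule adjacency_mat_square_index[OF vs(1)]) (use that len in simp_all)
    also have "\<dots> = real (card {w. (vs ! i, w) \<in> parcs G \<and> (w, vs ! j) \<in> parcs G})"
      by (simp only: vs(2) two_paths_in_verts[symmetric])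
    also have "\<dots> = of_int (\<Sum>w\<in>pverts G. T.a (vs ! i) w * T.a w (vs ! j))"
      unfolding T.card_paths[symmetric] by simp
    finally show ?thesis .
  qed
  have Mij: "M $$ (i, j) = 2 * real (c (vs ! i)) * real (c (vs ! j))" if "i < 36" "j < 36" for i j
    using that A Aij[OF that] AA[OF that] T.two_paths[OF vsG vsG, of i j] vs(1) len
    by (simp add: M_def nth_eq_iff_index_eq del: index_mult_mat(1))
  have eig: "(\<Sum>k<36. real (c (vs ! k)) * A $$ (k, j)) = 20 * real (c (vs ! j))" if j: "j < 36" for j
  proof -
    have "(\<Sum>k<36. real (c (vs ! k)) * A $$ (k, j)) = (\<Sum>k<length vs. real (c (vs ! k)) * of_int (T.a (vs ! k) (vs ! j)))"
      using j len by (intro sum.cong) (simp_all add: Aij)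
    also have "\<dots> = (\<Sum>v\<in>pverts G. real (c v) * of_int (T.a v (vs ! j)))"
      unfolding vs(2)[symmetric] by (rule sum_nth_distinct[OF vs(1)])
    also have "\<dots> = of_int (\<Sum>v\<in>pverts G. int (c v) * T.a (vs ! j) v)"
      by (simp add: T.a_sym[of _ "vs ! j"])
    also have "(\<Sum>v\<in>pverts G. int (c v) * T.a (vs ! j) v) = T.d 1 (vs ! j) + 2 * T.d 2 (vs ! j) + 3 * T.d 3 (vs ! j)"
    proof -
      have "(\<Sum>v\<in>T.W i. int (c v) * T.a (vs ! j) v) = int i * T.d i (vs ! j)" for i
        unfolding T.d_def sum_distrib_left by (intro sum.cong) (auto simp: T.W_def)
      then show ?thesis unfolding T.sum_V by simp
    qed
    finally show ?thesis using T.weighted_degree[OF vsG[OF j]] by simp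
  qed
  have ann: "M * (A + (- 20) \<cdot>\<^sub>m 1\<^sub>m 36) = 0\<^sub>m 36 36"
  proof (rule eq_matI)
    fix i j assume ij: "i < dim_row (0\<^sub>m 36 36 :: real mat)" "j < dim_col (0\<^sub>m 36 36 :: real mat)"
    then have ij: "i < 36" "j < 36" by auto
    have "(M * (A + (- 20) \<cdot>\<^sub>m 1\<^sub>m 36)) $$ (i, j) = (\<Sum>k<36. M $$ (i, k) * (A + (- 20) \<cdot>\<^sub>m 1\<^sub>m 36) $$ (k, j))"
      using ij A Mc by (simp add: scalar_prod_def atLeast0LessThan)
    also have "\<dots> = (\<Sum>k<36. 2 * real (c (vs ! i)) * (real (c (vs ! k)) * A $$ (k, j) - 20 * (if k = j then real (c (vs ! k)) else 0)))"
      using ij A by (intro sum.cong) (auto simp: Mij algebra_simps)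
    also have "\<dots> = 2 * real (c (vs ! i)) * ((\<Sum>k<36. real (c (vs ! k)) * A $$ (k, j)) - 20 * (\<Sum>k<36. if k = j then real (c (vs ! k)) else 0))"
      by (simp only: sum_distrib_left[symmetric] sum_subtractf)
    also have "\<dots> = 0" using eig[OF ij(2)] ij by simp
    finally show "(M * (A + (- 20) \<cdot>\<^sub>m 1\<^sub>m 36)) $$ (i, j) = 0\<^sub>m 36 36 $$ (i, j)" using ij by simp
  qed (use A Mc in auto)
  show "graph_spectrum G = replicate_mset 1 20 + replicate_mset 17 2 + replicate_mset 18 (- 3)"
  proof -
    \<comment> \<open>Over the complex numbers the characteristic polynomial is known to split; the
      roots found there are real and are carried back along the injective embedding.\<close>
    define hom where "hom = (of_real :: real \<Rightarrow> complex)"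
    interpret hom: inj_comm_ring_hom hom
      by unfold_locales (auto simp: hom_def)
    interpret mp: map_poly_inj_comm_ring_hom hom ..
    define C where "C = map_mat hom A"
    have C: "C \<in> carrier_mat 36 36" using A by (simp add: C_def)
    obtain es where es: "char_poly C = (\<Prod>a\<leftarrow>es. [:- a, 1:])" "length es = 36"
      using char_poly_factorized[OF C] by blast
    have lin: "map_mat hom (X + e \<cdot>\<^sub>m Y) = map_mat hom X + hom e \<cdot>\<^sub>m map_mat hom Y"
      if "X \<in> carrier_mat 36 36" "Y \<in> carrier_mat 36 36" for X Y e
      using that by (intro eq_matI) (auto simp: hom.hom_add hom.hom_mult)
    have one: "map_mat hom (1\<^sub>m 36) = 1\<^sub>m 36" by (intro eq_matI) (auto simp: hom_def)
    have CC: "C * C = map_mat hom (A * A)" unfolding C_def using hom.mat_hom_mult[OF A A] by simp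
    have hv: "hom 1 = 1" "hom (- 6) = - 6" "hom (- 20) = - 20" by (simp_all add: hom_def)
    have N: "map_mat hom M = C * C + 1 \<cdot>\<^sub>m C + (- 6) \<cdot>\<^sub>m 1\<^sub>m 36"
    proof -
      have "map_mat hom M = map_mat hom (A * A + 1 \<cdot>\<^sub>m A) + hom (- 6) \<cdot>\<^sub>m map_mat hom (1\<^sub>m 36)"
        unfolding M_def by (rule lin) (use A in auto)
      also have "map_mat hom (A * A + 1 \<cdot>\<^sub>m A) = map_mat hom (A * A) + hom 1 \<cdot>\<^sub>m map_mat hom A"
        by (rule lin) (use A in auto)
      finally show ?thesis by (simp only: CC hv one C_def[symmetric])
    qed
    have L: "map_mat hom (A + (- 20) \<cdot>\<^sub>m 1\<^sub>m 36) = C + (- 20) \<cdot>\<^sub>m 1\<^sub>m 36"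
      using lin[OF A one_carrier_mat, of "- 20"] unfolding hv one C_def .
    have annC: "(C * C + 1 \<cdot>\<^sub>m C + (- 6) \<cdot>\<^sub>m 1\<^sub>m 36) * (C + (- 20) \<cdot>\<^sub>m 1\<^sub>m 36) = 0\<^sub>m 36 36"
    proof -
      have "map_mat hom (M * (A + (- 20) \<cdot>\<^sub>m 1\<^sub>m 36)) = map_mat hom M * map_mat hom (A + (- 20) \<cdot>\<^sub>m 1\<^sub>m 36)"
        by (rule hom.mat_hom_mult[OF Mc]) (use A in auto)
      moreover have "map_mat hom (0\<^sub>m 36 36) = 0\<^sub>m 36 36" by (intro eq_matI) (auto simp: hom_def)
      ultimately show ?thesis unfolding ann N L by simp
    qed
    have roots: "set es \<subseteq> {20, 2, - 3}"
    proof
      fix x assume "x \<in> set es"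
      from char_poly_roots_of_annihilator[OF C es(1) annC this]
      have "(x - 2) * (x + 3) * (x - 20) = 0" by (simp add: algebra_simps power2_eq_square)
      then have "x - 2 = 0 \<or> x + 3 = 0 \<or> x - 20 = 0" by auto
      then show "x \<in> {20, 2, - 3}" by (auto simp: eq_neg_iff_add_eq_0)
    qed
    define x y z where "x = count (mset es) 20" and "y = count (mset es) 2" and "z = count (mset es) (- 3)"
    have three: "(\<Sum>a\<leftarrow>es. f a) = of_nat x * f 20 + of_nat y * f 2 + of_nat z * f (- 3)" for f :: "complex \<Rightarrow> complex"
      unfolding x_def y_def z_def using roots by (rule sum_list_three_values) (simp_all add: complex_eq_iff)
    have Cij: "C $$ (i, j) = hom (A $$ (i, j))" if "i < 36" "j < 36" for i j using that A by (simp add: C_def)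
    have "mat_trace C = 0"
      using C Cij Aij by (simp add: mat_trace_def hom_def)
    then have "of_nat x * 20 + of_nat y * 2 + of_nat z * (- 3) = (0 :: complex)"
      using mat_trace_eq_sum_list[OF C es(1)] three[of "\<lambda>a. a"] by simp
    then have "(of_nat (20 * x + 2 * y) :: complex) = of_nat (3 * z)" by (simp add: algebra_simps)
    then have e2: "20 * x + 2 * y = 3 * z" by (simp only: of_nat_eq_iff)
    have e1: "x + y + z = 36"
    proof -
      have "(of_nat (x + y + z) :: complex) = of_nat 36"
        using three[of "\<lambda>_. 1"] es(2) by (simp add: sum_list_triv)
      then show ?thesis by (simp only: of_nat_eq_iff)
    qed
    \<comment> \<open>This is the sum of the valencies, 18 * 24 + 9 * 14 + 9 * 8 = 630.\<close>
    have tr2: "mat_trace (C * C + 1 \<cdot>\<^sub>m C) = 630"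
    proof -
      have "(C * C + 1 \<cdot>\<^sub>m C) $$ (i, i) = hom (2 * (real (c (vs ! i)))\<^sup>2 + 6)" if "i < 36" for i
      proof -
        have "hom (M $$ (i, i)) = (C * C + 1 \<cdot>\<^sub>m C + (- 6) \<cdot>\<^sub>m 1\<^sub>m 36) $$ (i, i)"
          unfolding N[symmetric] using Mc that by simp
        also have "\<dots> = (C * C + 1 \<cdot>\<^sub>m C) $$ (i, i) - 6" using C that by simp
        finally show ?thesis using Mij[OF that that] by (simp add: hom_def power2_eq_square algebra_simps)
      qed
      then have "mat_trace (C * C + 1 \<cdot>\<^sub>m C) = (\<Sum>i<36. hom (2 * (real (c (vs ! i)))\<^sup>2 + 6))"
        using C by (simp add: mat_trace_def del: index_add_mat(1))
      also have "\<dots> = hom (\<Sum>i<length vs. 2 * (real (c (vs ! i)))\<^sup>2 + 6)"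
        unfolding len by (simp add: hom_def)
      also have "(\<Sum>i<length vs. 2 * (real (c (vs ! i)))\<^sup>2 + 6) = (\<Sum>v\<in>pverts G. 2 * (real (c v))\<^sup>2 + 6)"
        unfolding vs(2)[symmetric] by (rule sum_nth_distinct[OF vs(1)])
      also have "\<dots> = of_int (\<Sum>v\<in>pverts G. 2 * (int (c v))\<^sup>2 + 6)" by simp
      also have "(\<Sum>v\<in>pverts G. 2 * (int (c v))\<^sup>2 + 6) = 630"
      proof -
        have "(\<Sum>v\<in>T.W i. 2 * (int (c v))\<^sup>2 + 6) = (\<Sum>v\<in>T.W i. 2 * (int i)\<^sup>2 + 6)" for i
          by (rule sum.cong) (simp_all add: T.W_def)
        then have "(\<Sum>v\<in>T.W i. 2 * (int (c v))\<^sup>2 + 6) = int (card (T.W i)) * (2 * (int i)\<^sup>2 + 6)" for i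
          by (simp only: sum_constant of_nat_id)
        note s = this
        show ?thesis unfolding T.sum_V s T.W(3,4,5) by simp
      qed
      finally show ?thesis by (simp add: hom_def)
    qed
    have "(of_nat (420 * x + 6 * y + 6 * z) :: complex) = of_nat 630"
      using tr2 mat_trace_quadratic_eq_sum_list[OF C es(1), of 1] three[of "\<lambda>a. a\<^sup>2 + 1 * a"] by (simp add: algebra_simps)
    then have e3: "420 * x + 6 * y + 6 * z = 630" by (simp only: of_nat_eq_iff)
    have xyz: "x = 1" "y = 17" "z = 18" using e1 e2 e3 by linarith+
    define rs where "rs = replicate 1 (20 :: real) @ replicate 17 2 @ replicate 18 (- 3)"
    have linear: "map_poly hom [:- a, 1:] = [:- hom a, 1:]" for a
      by (simp add: map_poly_pCons hom_def)
    have map_prod: "(\<Prod>r\<leftarrow>qs. [:- hom r, 1:]) = map_poly hom (\<Prod>r\<leftarrow>qs. [:- r, 1:])" for qs :: "real list"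
    proof (induction qs)
      case (Cons q qs)
      have "(\<Prod>r\<leftarrow>q # qs. [:- hom r, 1:]) = map_poly hom [:- q, 1:] * map_poly hom (\<Prod>r\<leftarrow>qs. [:- r, 1:])"
        by (simp only: list.map prod_list.Cons linear Cons.IH)
      also have "\<dots> = map_poly hom ([:- q, 1:] * (\<Prod>r\<leftarrow>qs. [:- r, 1:]))"
        by (rule mp.hom_mult[symmetric])
      finally show ?case by (simp only: list.map prod_list.Cons)
    qed (simp add: hom_def)
    have "mset es = mset (map hom rs)"
    proof (rule multiset_eqI)
      fix v
      have "count (mset es) v = 0" if "v \<notin> {20, 2, - 3}" using roots that by (auto simp: count_eq_zero_iff)
      moreover have "(20 :: complex) \<noteq> 2" "(20 :: complex) \<noteq> - 3" "(2 :: complex) \<noteq> - 3" by (simp_all add: complex_eq_iff)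
      ultimately show "count (mset es) v = count (mset (map hom rs)) v"
        using xyz unfolding x_def y_def z_def by (auto simp: rs_def hom_def)
    qed
    then have "mset (map (\<lambda>a. [:- a, 1:]) es) = mset (map (\<lambda>a. [:- a, 1:]) (map hom rs))"
      by (simp only: mset_map)
    then have "char_poly C = (\<Prod>r\<leftarrow>rs. [:- hom r, 1:])"
      unfolding es(1) prod_mset_prod_list[symmetric] by (simp add: comp_def)
    also have "\<dots> = map_poly hom (\<Prod>r\<leftarrow>rs. [:- r, 1:])"
      by (rule map_prod)
    finally have "map_poly hom (char_poly A) = map_poly hom (\<Prod>r\<leftarrow>rs. [:- r, 1:])"
      using hom.char_poly_hom[OF A] by (simp add: C_def)
    then have "char_poly A = (\<Prod>r\<leftarrow>rs. [:- r, 1:])" by (simp add: mp.eq_iff)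
    then have "proots (char_poly A) = mset rs"
    proof -
      have "proots (\<Prod>r\<leftarrow>qs. [:- r, 1:]) = mset qs" for qs :: "real list"
      proof (induction qs)
        case (Cons q qs)
        have "(\<Prod>r\<leftarrow>qs. [:- r, 1:]) \<noteq> (0 :: real poly)" by (auto simp: prod_list_zero_iff)
        then show ?case using Cons by (simp add: proots_mult del: mult_pCons_left)
      qed simp
      then show ?thesis using \<open>char_poly A = _\<close> by simp
    qed
    then show ?thesis using graph_spectrum_eq[OF vs] by (simp add: A_def rs_def)
  qed
qed

end

section \<open>Adjacency described by cyclic patterns\<close>

text \<open>Pairs of a cycle and a position on it, cycle by cycle; the place in this list determines
  the number of a vertex.\<close>

definition cyc_labels :: "nat list \<Rightarrow> (nat \<times> nat) list" where
  "cyc_labels ns = concat (map (\<lambda>(i, n). map (Pair i) [0..<n]) (List.enumerate 0 ns))"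

definition cyc_point :: "(int \<Rightarrow> 'a) list \<Rightarrow> nat \<times> nat \<Rightarrow> 'a" where
  "cyc_point cs p = (cs ! fst p) (int (snd p))"

definition cyc_adj :: "nat list \<Rightarrow> nat \<times> nat \<Rightarrow> nat \<times> nat \<Rightarrow> bool" where
  "cyc_adj ns p q \<longleftrightarrow> fst p = fst q \<and>
     (Suc (snd p) mod (ns ! fst p) = snd q \<or> Suc (snd q) mod (ns ! fst p) = snd p)"

text \<open>The entry \<open>(m, w, r)\<close> of the table describes the incidences between a cycle of points and a
  cycle of blocks: point \<open>k\<close> lies in block \<open>j\<close> iff \<open>j - k - r\<close> is congruent to \<open>0\<close> or \<open>w\<close> modulo \<open>m\<close>.\<close>

definition cyclic_inc :: "(int \<times> int \<times> int) list list \<Rightarrow> nat \<times> nat \<Rightarrow> nat \<times> nat \<Rightarrow> bool" where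
  "cyclic_inc T p q = (case T ! fst p ! fst q of (m, w, r) \<Rightarrow> (int (snd q) - int (snd p) - r) mod m \<in> {0, w})"

text \<open>Vertices below 18 have valency 24, those from 18 to 26 valency 8, and the others valency 14.\<close>

definition cyclic_adj :: "(int \<times> int \<times> int) list list \<Rightarrow> nat list \<Rightarrow> nat list \<Rightarrow> nat \<Rightarrow> nat \<Rightarrow> bool" where
  "cyclic_adj T np nb i j =
    (if i < 18 then
       if j < 18 then i \<noteq> j \<and> \<not> cyc_adj np (cyc_labels np ! i) (cyc_labels np ! j)
       else cyclic_inc T (cyc_labels np ! i) (cyc_labels nb ! (j - 18)) = (j < 27)
     else if j < 18 then cyclic_inc T (cyc_labels np ! j) (cyc_labels nb ! (i - 18)) = (i < 27)
     else cyc_adj nb (cyc_labels nb ! (i - 18)) (cyc_labels nb ! (j - 18)))"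

lemma set_cyc_labels: "set (cyc_labels ns) = {(i, k). i < length ns \<and> k < ns ! i}"
proof -
  have "set (List.enumerate 0 ns) = (\<lambda>i. (i, ns ! i)) ` {..<length ns}"
    by (auto simp: in_set_enumerate_eq image_iff)
  then show ?thesis by (auto simp: cyc_labels_def image_iff)
qed

context two_regular
begin

lemma set_cyc_points:
  assumes "\<And>i. i < length ns \<Longrightarrow> is_cycle (cs ! i) (ns ! i)"
  shows "cyc_point cs ` set (cyc_labels ns) = (\<Union>i<length ns. range (cs ! i))"
proof -
  have ran: "range (cs ! i) = (\<lambda>k. (cs ! i) (int k)) ` {..<ns ! i}" if "i < length ns" for i
  proof -
    have "{0..<int (ns ! i)} = int ` {..<ns ! i}"
      by (auto simp: image_iff) (metis nonneg_int_cases of_nat_less_iff lessThan_iff)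
    then show ?thesis unfolding range_cycle[OF assms[OF that]] by (simp add: image_image)
  qed
  show ?thesis
  proof (intro equalityI subsetI)
    fix x assume "x \<in> cyc_point cs ` set (cyc_labels ns)"
    then obtain i k where "i < length ns" "x = (cs ! i) (int k)"
      by (auto simp: set_cyc_labels cyc_point_def)
    then show "x \<in> (\<Union>i<length ns. range (cs ! i))" by blast
  next
    fix x assume "x \<in> (\<Union>i<length ns. range (cs ! i))"
    then obtain i where i: "i < length ns" "x \<in> range (cs ! i)" by blast
    then obtain k where k: "k < ns ! i" "x = (cs ! i) (int k)" unfolding ran[OF i(1)] by blast
    have "(i, k) \<in> set (cyc_labels ns)" by (simp add: set_cyc_labels i k)
    then show "x \<in> cyc_point cs ` set (cyc_labels ns)" by (rule image_eqI[rotated]) (simp add: cyc_point_def k)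
  qed
qed

text \<open>Adjacency means succession in one of the two directions. This form avoids predecessors,
  and with them subtraction on natural numbers.\<close>

lemma E_cyc_points:
  assumes cyc: "\<And>i. i < length ns \<Longrightarrow> is_cycle (cs ! i) (ns ! i)"
    and inj: "inj_on (cyc_point cs) (set (cyc_labels ns))"
    and p: "p \<in> set (cyc_labels ns)" and q: "q \<in> set (cyc_labels ns)"
  shows "E (cyc_point cs p) (cyc_point cs q) \<longleftrightarrow> cyc_adj ns p q"
proof -
  have succ: "cyc_point cs q = (cs ! fst p) (int (snd p) + 1) \<longleftrightarrow> fst p = fst q \<and> Suc (snd p) mod (ns ! fst p) = snd q"
    if p: "p \<in> set (cyc_labels ns)" and q: "q \<in> set (cyc_labels ns)" for p q
  proof -
    define n where "n = ns ! fst p"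
    have i: "fst p < length ns" "snd p < n" using p by (auto simp: set_cyc_labels n_def)
    note c = cyc[OF i(1), folded n_def]
    define r where "r = (fst p, Suc (snd p) mod n)"
    have r: "r \<in> set (cyc_labels ns)" using i by (simp add: r_def set_cyc_labels n_def)
    have "(cs ! fst p) (int (snd p) + 1) = cyc_point cs r"
      unfolding cyc_point_def r_def using cycle_mod[OF c, of "int (snd p) + 1"]
      by (simp add: zmod_int add.commute)
    then have "cyc_point cs q = (cs ! fst p) (int (snd p) + 1) \<longleftrightarrow> q = r"
      using inj_on_eq_iff[OF inj q r] by simp
    then show ?thesis by (auto simp: r_def n_def prod_eq_iff)
  qed
  have i: "fst p < length ns" using p by (auto simp: set_cyc_labels)
  have iq: "fst q < length ns" using q by (auto simp: set_cyc_labels)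
  have "E (cyc_point cs p) (cyc_point cs q) \<longleftrightarrow> cyc_point cs q = (cs ! fst p) (int (snd p) + 1) \<or> cyc_point cs q = (cs ! fst p) (int (snd p) - 1)"
    using cycle_E_iff[OF cyc[OF i], of "int (snd p)"] by (simp add: cyc_point_def)
  moreover have "E (cyc_point cs q) (cyc_point cs p) \<longleftrightarrow> cyc_point cs p = (cs ! fst q) (int (snd q) + 1) \<or> cyc_point cs p = (cs ! fst q) (int (snd q) - 1)"
    using cycle_E_iff[OF cyc[OF iq], of "int (snd q)"] by (simp add: cyc_point_def)
  moreover have "cyc_point cs p = (cs ! fst q) (int (snd q) + 1)" if *: "cyc_point cs q = (cs ! fst p) (int (snd p) - 1)"
  proof -
    have "\<exists>r\<in>set (cyc_labels ns). fst r = fst p \<and> (cs ! fst p) (int (snd p) - 1) = cyc_point cs r"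
    proof -
      have n: "0 < ns ! fst p" using cycle_length[OF cyc[OF i]] by simp
      let ?r = "(fst p, nat ((int (snd p) - 1) mod int (ns ! fst p)))"
      have r1: "?r \<in> set (cyc_labels ns)" using n i by (simp add: set_cyc_labels nat_less_iff)
      have r2: "cyc_point cs ?r = (cs ! fst p) (int (snd p) - 1)"
        using cycle_mod[OF cyc[OF i], of "int (snd p) - 1"] n by (simp add: cyc_point_def)
      show ?thesis by (rule bexI[OF _ r1]) (simp only: r2 fst_conv simp_thms)
    qed
    then have "fst q = fst p" using * inj_on_eq_iff[OF inj q] by metis
    then have "int (ns ! fst p) dvd int (snd q) - (int (snd p) - 1)"
      using * cycle_eq_iff[OF cyc[OF i]] by (simp add: cyc_point_def)
    then have "int (ns ! fst p) dvd int (snd p) - (int (snd q) + 1)"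
      by (metis diff_diff_eq2 dvd_diff_commute add.commute)
    then show ?thesis using cycle_eq_iff[OF cyc[OF i]] \<open>fst q = fst p\<close> by (simp add: cyc_point_def)
  qed
  moreover have "E (cyc_point cs p) (cyc_point cs q) \<longleftrightarrow> E (cyc_point cs q) (cyc_point cs p)" using sym by blast
  ultimately show ?thesis using succ[OF p q] succ[OF q p] unfolding cyc_adj_def by metis
qed

end

context three_valency_graph
begin

interpretation X: biadjacency "W 3" R B S Inc by (rule biadjacency)

text \<open>Both normal forms have all orientations equal to 1, so in either case a table of moduli,
  widths and offsets describes the whole graph.\<close>

lemma cyclic_labelling:
  assumes np: "length (cyc_labels np) = 18" and nb: "length (cyc_labels nb) = 18"
    and pc: "\<And>g. g < length np \<Longrightarrow> X.P.is_cycle (ps ! g) (np ! g)"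
    and bc: "\<And>h. h < length nb \<Longrightarrow> X.B.is_cycle (bs ! h) (nb ! h)"
    and covP: "W 3 = (\<Union>g<length np. range (ps ! g))" and covB: "B = (\<Union>h<length nb. range (bs ! h))"
    and low: "\<And>x. x < 9 \<Longrightarrow> range (bs ! fst (cyc_labels nb ! x)) \<subseteq> W 1"
    and high: "\<And>x. 9 \<le> x \<Longrightarrow> x < 18 \<Longrightarrow> range (bs ! fst (cyc_labels nb ! x)) \<subseteq> W 2"
    and inc: "\<And>g h. g < length np \<Longrightarrow> h < length nb \<Longrightarrow>
      (case T ! g ! h of (m, w, r) \<Rightarrow> X.pat (ps ! g) (bs ! h) m {0, w} (1, r))"
  shows "\<exists>vs. distinct vs \<and> set vs = V \<and> length vs = 36 \<and>
    (\<forall>i<36. \<forall>j<36. E (vs ! i) (vs ! j) \<longleftrightarrow> cyclic_adj T np nb i j)"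
proof -
  define lp lb where "lp = cyc_labels np" and "lb = cyc_labels nb"
  define pl bl where "pl = map (cyc_point ps) lp" and "bl = map (cyc_point bs) lb"
  have len: "length pl = 18" "length bl = 18" "length lp = 18" "length lb = 18"
    using np nb by (simp_all add: pl_def bl_def lp_def lb_def)
  have sets: "set pl = W 3" "set bl = B"
    using X.P.set_cyc_points[of np ps, OF pc] X.B.set_cyc_points[of nb bs, OF bc] covP covB
    by (simp_all add: pl_def bl_def lp_def lb_def)
  \<comment> \<open>Eighteen labels cover eighteen vertices, so no vertex is labelled twice.\<close>
  have dist: "distinct pl" "distinct bl"
    using sets len X.card_P X.card_B by (metis card_distinct)+
  then have injP: "inj_on (cyc_point ps) (set (cyc_labels np))" and injB: "inj_on (cyc_point bs) (set (cyc_labels nb))"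
    by (simp_all add: pl_def bl_def lp_def lb_def distinct_map)
  have lpm: "lp ! i \<in> set (cyc_labels np)" "lb ! i \<in> set (cyc_labels nb)" if "i < 18" for i
    using that len(3,4) nth_mem unfolding lp_def lb_def by metis+
  have pli: "pl ! i = cyc_point ps (lp ! i)" "bl ! i = cyc_point bs (lb ! i)" if "i < 18" for i
    using that len by (simp_all add: pl_def bl_def)
  have RR: "R (pl ! i) (pl ! j) \<longleftrightarrow> cyc_adj np (lp ! i) (lp ! j)" if "i < 18" "j < 18" for i j
    using X.P.E_cyc_points[of np ps, OF pc injP lpm(1)[OF that(1)] lpm(1)[OF that(2)]] that by (simp add: pli)
  have SS: "S (bl ! i) (bl ! j) \<longleftrightarrow> cyc_adj nb (lb ! i) (lb ! j)" if "i < 18" "j < 18" for i j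
    using X.B.E_cyc_points[of nb bs, OF bc injB lpm(2)[OF that(1)] lpm(2)[OF that(2)]] that by (simp add: pli)
  have II: "Inc (pl ! i) (bl ! x) \<longleftrightarrow> cyclic_inc T (lp ! i) (lb ! x)" if "i < 18" "x < 18" for i x
  proof -
    have "fst (lp ! i) < length np" "fst (lb ! x) < length nb"
      using lpm(1)[OF that(1)] lpm(2)[OF that(2)] by (auto simp: set_cyc_labels)
    from inc[OF this] show ?thesis
      by (auto simp: cyclic_inc_def X.pat_def pli that cyc_point_def split: prod.splits)
  qed
  have blW: "bl ! x \<in> W 1" if "x < 9" for x
    using low[OF that] pli(2)[of x] that by (auto simp: cyc_point_def lb_def)
  have blW2: "bl ! x \<in> W 2" if "9 \<le> x" "x < 18" for x
    using high[OF that] pli(2)[of x] that by (auto simp: cyc_point_def lb_def)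
  have plW: "pl ! i \<in> W 3" if "i < 18" for i using sets(1) len(1) that by (metis nth_mem)
  have PP: "E (pl ! i) (pl ! j) \<longleftrightarrow> i \<noteq> j \<and> \<not> cyc_adj np (lp ! i) (lp ! j)" if "i < 18" "j < 18" for i j
  proof -
    have "pl ! i = pl ! j \<longleftrightarrow> i = j" using dist(1) len that by (simp add: nth_eq_iff_index_eq)
    then show ?thesis using RR[OF that] plW that irrefl unfolding R_def by metis
  qed
  have PB: "E (pl ! i) (bl ! x) \<longleftrightarrow> cyclic_inc T (lp ! i) (lb ! x) = (x < 9)" if "i < 18" "x < 18" for i x
  proof -
    have "c (bl ! x) = 1 \<longleftrightarrow> x < 9"
      using blW[of x] blW2[of x] cV that by (cases "x < 9") auto
    then show ?thesis using II[OF that] by (auto simp: Inc_def)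
  qed
  have BB: "E (bl ! x) (bl ! y) \<longleftrightarrow> cyc_adj nb (lb ! x) (lb ! y)" if "x < 18" "y < 18" for x y
    using SS[OF that] sets(2) len that by (metis S_def nth_mem)
  define vs where "vs = pl @ bl"
  have "set pl \<inter> set bl = {}" unfolding sets B_def by (auto simp: W_def)
  then have "distinct vs" using dist by (simp add: vs_def)
  moreover have "set vs = V"
  proof -
    have "set vs = W 3 \<union> (W 1 \<union> W 2)" by (simp add: vs_def sets B_def)
    also have "\<dots> = W 1 \<union> (W 2 \<union> W 3)" by blast
    also have "\<dots> = V" by (rule V_eq[symmetric])
    finally show ?thesis .
  qed
  moreover have "length vs = 36" using len by (simp add: vs_def)
  moreover have "E (vs ! i) (vs ! j) \<longleftrightarrow> cyclic_adj T np nb i j" if "i < 36" "j < 36" for i j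
  proof -
    have nth: "vs ! k = (if k < 18 then pl ! k else bl ! (k - 18))" for k
      using len by (simp add: vs_def nth_append)
    have E_sym: "E u v \<longleftrightarrow> E v u" for u v using sym by blast
    have k: "k - 18 < 18" "k - 18 < 9 \<longleftrightarrow> k < 27" if "\<not> k < 18" "k < 36" for k :: nat using that by auto
    show ?thesis
    proof (cases "i < 18")
      case i: True
      show ?thesis
      proof (cases "j < 18")
        case True
        show ?thesis using PP[OF i True] i True by (simp add: nth cyclic_adj_def lp_def)
      next
        case False
        show ?thesis using PB[OF i k(1)[OF False that(2)], unfolded k(2)[OF False that(2)]] i False
          by (simp add: nth cyclic_adj_def lp_def lb_def)
      qed
    next
      case i: False
      note ki = k[OF i that(1)]
      show ?thesis
      proof (cases "j < 18")
        case True
        have "E (bl ! (i - 18)) (pl ! j) \<longleftrightarrow> cyclic_inc T (lp ! j) (lb ! (i - 18)) = (i < 27)"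
          using PB[OF True ki(1), unfolded ki(2)] E_sym by blast
        then show ?thesis using i True by (simp add: nth cyclic_adj_def lp_def lb_def)
      next
        case False
        show ?thesis using BB[OF ki(1) k(1)[OF False that(2)]] i False
          by (simp add: nth cyclic_adj_def lb_def)
      qed
    qed
  qed
  ultimately show ?thesis by blast
qed

end

section \<open>The two graphs and the classification\<close>

definition cycles1 :: "nat list" where
  "cycles1 = replicate 6 3"

definition table1 :: "(int \<times> int \<times> int) list list" where
  "table1 = map (map (\<lambda>r. (3, 0, r))) pentagon"

text \<open>The patterns of \<open>hex_labelling\<close>, with the points in the order
  \<open>c1\<close>, \<open>c2\<close>, \<open>w1\<close>, \<open>w2\<close> and the blocks in the
  order \<open>d3\<close>, \<open>t3\<close>, \<open>d2\<close>, \<open>t2\<close>.\<close>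

definition table2 :: "(int \<times> int \<times> int) list list" where
  "table2 = [[(6, 1, 0), (3, 0, 0), (6, 2, 2), (3, 0, 0)], [(6, 2, 0), (3, 0, 0), (6, 1, 0), (3, 0, 1)],
     [(3, 0, 0), (3, 0, 1), (3, 0, 0), (3, 0, 0)], [(3, 0, 0), (3, 0, 2), (3, 0, 2), (3, 0, 1)]]"

lemma labels1:
  "length (cyc_labels cycles1) = 18 \<and> list_all (\<lambda>x. fst (cyc_labels cycles1 ! x) < 3) [0..<9] \<and>
    list_all (\<lambda>x. 3 \<le> fst (cyc_labels cycles1 ! x) \<and> fst (cyc_labels cycles1 ! x) < 6) [9..<18]"
  by code_simp

lemma labels2:
  "length (cyc_labels [6, 6, 3, 3]) = 18 \<and> length (cyc_labels [6, 3, 6, 3]) = 18 \<and>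
    list_all (\<lambda>x. fst (cyc_labels [6, 3, 6, 3] ! x) < 2) [0..<9] \<and>
    list_all (\<lambda>x. 2 \<le> fst (cyc_labels [6, 3, 6, 3] ! x) \<and> fst (cyc_labels [6, 3, 6, 3] ! x) < 4) [9..<18]"
  by code_simp

definition class_weight :: "nat \<Rightarrow> nat" where
  "class_weight i = (if i < 18 then 3 else if i < 27 then 1 else 2)"

definition adj_rows :: "(nat \<Rightarrow> nat \<Rightarrow> bool) \<Rightarrow> bool list list" where
  "adj_rows f = map (\<lambda>i. map (f i) [0..<36]) [0..<36]"

text \<open>For a symmetric matrix \<open>common\<close> of two rows is an entry of its square, so
  the condition is A^2 + A = 2 c c^T + 6, together with symmetry and a zero diagonal.\<close>

definition check_rows :: "bool list list \<Rightarrow> bool" where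
  "check_rows rs \<longleftrightarrow> list_all (\<lambda>(i, r). \<not> r ! i \<and> list_all (\<lambda>(j, s). r ! j = s ! i \<and>
     common r s + (if r ! j then 1 else 0) = 2 * class_weight i * class_weight j + (if i = j then 6 else 0))
     (List.enumerate 0 rs)) (List.enumerate 0 rs)"

lemma check1: "let rs = adj_rows (cyclic_adj table1 cycles1 cycles1) in check_rows rs"
  by code_simp

lemma check2: "let rs = adj_rows (cyclic_adj table2 [6, 6, 3, 3] [6, 3, 6, 3]) in check_rows rs"
  by code_simp

text \<open>The vertices 18 to 26 are those of valency 8. They form three triangles in this graph,
  but a hexagon and a triangle in the other.\<close>

lemma low_transitive1:
  "list_all (\<lambda>i. list_all (\<lambda>j. list_all (\<lambda>k. i = k \<or> \<not> cyclic_adj table1 cycles1 cycles1 i j \<or>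
     \<not> cyclic_adj table1 cycles1 cycles1 j k \<or> cyclic_adj table1 cycles1 cycles1 i k) [18..<27]) [18..<27]) [18..<27]"
  by code_simp

lemma low_not_transitive2:
  "cyclic_adj table2 [6, 6, 3, 3] [6, 3, 6, 3] 18 19 \<and> cyclic_adj table2 [6, 6, 3, 3] [6, 3, 6, 3] 19 20 \<and>
    \<not> cyclic_adj table2 [6, 6, 3, 3] [6, 3, 6, 3] 18 20"
  by code_simp

context three_valency_graph
begin

interpretation X: biadjacency "W 3" R B S Inc by (rule biadjacency)

lemma closed_W1: "X.B.closed (W 1)" and closed_W2: "X.B.closed (W 2)"
proof -
  have no: "\<not> E u v \<and> \<not> E v u" if "u \<in> W 1" "v \<in> W 2" for u v
    using no_12_edges[OF that] sym by (auto simp: a_def)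
  show "X.B.closed (W 1)" "X.B.closed (W 2)"
    unfolding X.B.closed_def using no by (auto simp: B_def S_def)
qed

lemma tri_case:
  assumes tris: "X.P.tris = W 3" "X.B.tris = B"
  shows "\<exists>vs. distinct vs \<and> set vs = V \<and> length vs = 36 \<and>
    (\<forall>i<36. \<forall>j<36. E (vs ! i) (vs ! j) \<longleftrightarrow> cyclic_adj table1 cycles1 cycles1 i j)"
proof -
  have "W 1 \<subseteq> X.B.tris" "W 2 \<subseteq> X.B.tris" using tris(2) by (auto simp: B_def)
  obtain p :: "nat \<Rightarrow> int \<Rightarrow> 'a" where p: "\<forall>g<6. X.P.is_cycle (p g) 3" "(\<Union>g<6. range (p g)) = W 3"
    "\<forall>g<6. \<forall>h<6. g \<noteq> h \<longrightarrow> range (p g) \<inter> range (p h) = {}"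
    using X.P.tri_decomposition[OF X.P.closed_tris order_refl, of 6] W(5) unfolding tris(1) by auto
  obtain b1 :: "nat \<Rightarrow> int \<Rightarrow> 'a" where b1: "\<forall>g<3. X.B.is_cycle (b1 g) 3" "(\<Union>g<3. range (b1 g)) = W 1"
    "\<forall>g<3. \<forall>h<3. g \<noteq> h \<longrightarrow> range (b1 g) \<inter> range (b1 h) = {}"
    using X.B.tri_decomposition[OF closed_W1 \<open>W 1 \<subseteq> X.B.tris\<close>, of 3] W(3) by auto
  obtain b2 :: "nat \<Rightarrow> int \<Rightarrow> 'a" where b2: "\<forall>g<3. X.B.is_cycle (b2 g) 3" "(\<Union>g<3. range (b2 g)) = W 2"
    "\<forall>g<3. \<forall>h<3. g \<noteq> h \<longrightarrow> range (b2 g) \<inter> range (b2 h) = {}"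
    using X.B.tri_decomposition[OF closed_W2 \<open>W 2 \<subseteq> X.B.tris\<close>, of 3] W(4) by auto
  \<comment> \<open>The triangles of valency 8 come first, as the numbering of the vertices
    requires.\<close>
  define b where "b h = (if h < 3 then b1 h else b2 (h - 3))" for h
  have low: "range (b h) \<subseteq> W 1" if "h < 3" for h using b1(2) that by (auto simp: b_def)
  have high: "range (b h) \<subseteq> W 2" if "3 \<le> h" "h < 6" for h
  proof -
    have "h - 3 < 3" using that by auto
    then show ?thesis using b2(2) that by (auto simp: b_def)
  qed
  have U: "(\<Union>h<6. range (b h)) = B"
  proof -
    have "{..<6 :: nat} = {..<3} \<union> (\<lambda>h. h + 3) ` {..<3}"
    proof (intro equalityI subsetI)
      fix x :: nat assume "x \<in> {..<6}"
      then have "x < 3 \<or> x - 3 < 3 \<and> x = (x - 3) + 3" by auto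
      then show "x \<in> {..<3} \<union> (\<lambda>h. h + 3) ` {..<3}" by blast
    qed auto
    then have "(\<Union>h<6. range (b h)) = (\<Union>h<3. range (b h)) \<union> (\<Union>h<3. range (b (h + 3)))" by auto
    then show ?thesis using b1(2) b2(2) by (simp add: b_def B_def)
  qed
  have disj: "range (b g) \<inter> range (b h) = {}" if "g < 6" "h < 6" "g \<noteq> h" for g h
  proof (cases "g < 3 \<longleftrightarrow> h < 3")
    case True
    then show ?thesis
    proof (cases "g < 3")
      case True
      then show ?thesis using b1(3) \<open>g < 3 \<longleftrightarrow> h < 3\<close> that by (simp add: b_def)
    next
      case False
      then have "g - 3 < 3" "h - 3 < 3" "g - 3 \<noteq> h - 3" using that \<open>g < 3 \<longleftrightarrow> h < 3\<close> by auto
      then show ?thesis using b2(3) False \<open>g < 3 \<longleftrightarrow> h < 3\<close> by (simp add: b_def)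
    qed
  next
    case False
    then consider "g < 3" "3 \<le> h" | "3 \<le> g" "h < 3" by linarith
    then show ?thesis
    proof cases
      case 1
      then show ?thesis using low[of g] high[of h] that W_disjoint by blast
    next
      case 2
      then show ?thesis using low[of h] high[of g] that W_disjoint by blast
    qed
  qed
  have bc: "X.B.is_cycle (b h) 3" if "h < 6" for h using b1(1) b2(1) that by (auto simp: b_def)
  have "X.tri_labelling p b"
    unfolding X.tri_labelling_def
  proof (intro conjI)
    show "\<forall>g<6. X.P.is_cycle (p g) 3" by (rule p(1))
    show "\<forall>h<6. X.B.is_cycle (b h) 3" using bc by simp
    show "(\<Union>g<6. range (p g)) = W 3" by (rule p(2))
    show "(\<Union>h<6. range (b h)) = B" by (rule U)
    show "\<forall>g<6. \<forall>h<6. g \<noteq> h \<longrightarrow> range (p g) \<inter> range (p h) = {}" by (rule p(3))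
    show "\<forall>g<6. \<forall>h<6. g \<noteq> h \<longrightarrow> range (b g) \<inter> range (b h) = {}" using disj by simp
  qed
  from X.pentagon_labelling[OF this low high] obtain p' b' where
    pl: "X.pure_labelling p' b' (\<lambda>g h. pentagon ! g ! h)" and
    low': "\<forall>h<3. range (b' h) \<subseteq> W 1" and high': "\<forall>h. 3 \<le> h \<longrightarrow> h < 6 \<longrightarrow> range (b' h) \<subseteq> W 2"
    by blast
  have tl: "X.tri_labelling p' b'" using pl by (simp add: X.pure_labelling_def)
  have len: "length cycles1 = 6" by (simp add: cycles1_def)
  have nth: "map p' [0..<6] ! g = p' g" "map b' [0..<6] ! g = b' g" "cycles1 ! g = 3" if "g < 6" for g
    using that by (simp_all add: cycles1_def)
  have lab: "fst (cyc_labels cycles1 ! x) < 3" if "x < 9" for x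
  proof -
    have "x \<in> set [0..<9]" using that by simp
    then show ?thesis using labels1 unfolding list_all_iff by blast
  qed
  have lab2: "3 \<le> fst (cyc_labels cycles1 ! x) \<and> fst (cyc_labels cycles1 ! x) < 6" if "9 \<le> x" "x < 18" for x
  proof -
    have "x \<in> set [9..<18]" using that by (simp only: set_upt atLeastLessThan_iff)
    then show ?thesis using labels1 unfolding list_all_iff by blast
  qed
  show ?thesis
  proof (rule cyclic_labelling[where ps = "map p' [0..<6]" and bs = "map b' [0..<6]"])
    show "length (cyc_labels cycles1) = 18" "length (cyc_labels cycles1) = 18" using labels1 by blast+
    show "X.P.is_cycle (map p' [0..<6] ! g) (cycles1 ! g)" if "g < length cycles1" for g
      using tl that nth[of g] len by (simp add: X.tri_labelling_def)
    show "X.B.is_cycle (map b' [0..<6] ! g) (cycles1 ! g)" if "g < length cycles1" for g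
      using tl that nth[of g] len by (simp add: X.tri_labelling_def)
    show "W 3 = (\<Union>g<length cycles1. range (map p' [0..<6] ! g))" "B = (\<Union>h<length cycles1. range (map b' [0..<6] ! h))"
      using tl nth unfolding len X.tri_labelling_def by auto
    show "range (map b' [0..<6] ! fst (cyc_labels cycles1 ! x)) \<subseteq> W 1" if "x < 9" for x
      using lab[OF that] low' nth(2)[of "fst (cyc_labels cycles1 ! x)"] by simp
    show "range (map b' [0..<6] ! fst (cyc_labels cycles1 ! x)) \<subseteq> W 2" if "9 \<le> x" "x < 18" for x
      using lab2[OF that] high' nth(2)[of "fst (cyc_labels cycles1 ! x)"] by simp
    show "case table1 ! g ! h of (m, w, r) \<Rightarrow> X.pat (map p' [0..<6] ! g) (map b' [0..<6] ! h) m {0, w} (1, r)"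
      if "g < length cycles1" "h < length cycles1" for g h
    proof -
      have gh: "g < 6" "h < 6" using that len by auto
      have "length (pentagon ! g) = 6" "length pentagon = 6"
        using gh(1) by (auto simp: pentagon_def X.below_6)
      then have "table1 ! g ! h = (3, 0, pentagon ! g ! h)"
        using gh by (simp add: table1_def)
      then show ?thesis using pl gh nth by (simp add: X.pure_labelling_def)
    qed
  qed
qed

lemma hex_case:
  assumes few: "card X.P.tris \<le> 6" "card X.B.tris \<le> 6"
  shows "\<exists>vs. distinct vs \<and> set vs = V \<and> length vs = 36 \<and>
    (\<forall>i<36. \<forall>j<36. E (vs ! i) (vs ! j) \<longleftrightarrow> cyclic_adj table2 [6, 6, 3, 3] [6, 3, 6, 3] i j)"
proof -
  obtain d3 t3 where 3: "X.B.is_cycle d3 6" "X.B.is_cycle t3 3" "W 1 = range d3 \<union> range t3"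
    using biadjacency.closed_nine_structure[OF X.dual few(2) closed_W1 W(3)] by metis
  obtain d2 t2 where 2: "X.B.is_cycle d2 6" "X.B.is_cycle t2 3" "W 2 = range d2 \<union> range t2"
    using biadjacency.closed_nine_structure[OF X.dual few(2) closed_W2 W(4)] by metis
  interpret H: hexagonal "W 3" R B S Inc d2 t2 d3 t3
    by unfold_locales (use 2 3 in \<open>auto simp: B_def\<close>)
  obtain c1 c2 w1 w2 x2 s2 x3 s3 where
    L: "X.hex_labelling c1 c2 w1 w2 x2 s2 x3 s3" and
    B: "X.B.is_cycle x2 6" "X.B.is_cycle s2 3" "X.B.is_cycle x3 6" "X.B.is_cycle s3 3" and
    r: "range x2 = range d2" "range s2 = range t2" "range x3 = range d3" "range s3 = range t3"
    using H.hexagonal_labelling by blast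
  note L = L[unfolded X.hex_labelling_def]
  have below4: "g < 4 \<longleftrightarrow> g = 0 \<or> g = 1 \<or> g = 2 \<or> g = (3 :: nat)" for g by auto
  have U: "(\<Union>g<4. f g) = f 0 \<union> f 1 \<union> (f 2 \<union> f 3)" for f :: "nat \<Rightarrow> 'a set"
    by (auto simp: below4)
  have lab: "fst (cyc_labels [6, 3, 6, 3] ! x) < 2" if "x < 9" for x
  proof -
    have "x \<in> set [0..<9]" using that by simp
    then show ?thesis using labels2 unfolding list_all_iff by blast
  qed
  have lab2: "2 \<le> fst (cyc_labels [6, 3, 6, 3] ! x) \<and> fst (cyc_labels [6, 3, 6, 3] ! x) < 4" if "9 \<le> x" "x < 18" for x
  proof -
    have "x \<in> set [9..<18]" using that by (simp only: set_upt atLeastLessThan_iff)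
    then show ?thesis using labels2 unfolding list_all_iff by blast
  qed
  have W12: "range ([x3, s3, x2, s2] ! h) \<subseteq> W 1" if "h < 2" for h
  proof -
    have "h = 0 \<or> h = 1" using that by auto
    then show ?thesis using r 3 by auto
  qed
  have W22: "range ([x3, s3, x2, s2] ! h) \<subseteq> W 2" if "2 \<le> h" "h < 4" for h
  proof -
    have "h = 2 \<or> h = 3" using that by auto
    then show ?thesis using r 2 by auto
  qed
  show ?thesis
  proof (rule cyclic_labelling[where ps = "[c1, c2, w1, w2]" and bs = "[x3, s3, x2, s2]"])
    show "length (cyc_labels [6, 6, 3, 3]) = 18" "length (cyc_labels [6, 3, 6, 3]) = 18" using labels2 by blast+
    show "X.P.is_cycle ([c1, c2, w1, w2] ! g) ([6, 6, 3, 3] ! g)" if "g < length [6, 6, 3, 3 :: nat]" for g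
    proof -
      have "g = 0 \<or> g = 1 \<or> g = 2 \<or> g = 3" using that by auto
      then show ?thesis using L by (elim disjE) simp_all
    qed
    show "X.B.is_cycle ([x3, s3, x2, s2] ! g) ([6, 3, 6, 3] ! g)" if "g < length [6, 3, 6, 3 :: nat]" for g
    proof -
      have "g = 0 \<or> g = 1 \<or> g = 2 \<or> g = 3" using that by auto
      then show ?thesis using B by (elim disjE) simp_all
    qed
    have l4: "length [6, 6, 3, 3 :: nat] = 4" "length [6, 3, 6, 3 :: nat] = 4" by simp_all
    have "W 3 = range c1 \<union> range c2 \<union> (range w1 \<union> range w2)" using L by blast
    then show "W 3 = (\<Union>g<length [6, 6, 3, 3 :: nat]. range ([c1, c2, w1, w2] ! g))"
      unfolding l4 U by simp
    have "B = range x3 \<union> range s3 \<union> (range x2 \<union> range s2)" using 2 3 r by (simp add: B_def)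
    then show "B = (\<Union>h<length [6, 3, 6, 3 :: nat]. range ([x3, s3, x2, s2] ! h))"
      unfolding l4 U by simp
    show "range ([x3, s3, x2, s2] ! fst (cyc_labels [6, 3, 6, 3] ! x)) \<subseteq> W 1" if "x < 9" for x
      using W12[OF lab[OF that]] .
    show "range ([x3, s3, x2, s2] ! fst (cyc_labels [6, 3, 6, 3] ! x)) \<subseteq> W 2" if "9 \<le> x" "x < 18" for x
      using W22 lab2[OF that] by blast
    show "case table2 ! g ! h of (m, w, r) \<Rightarrow> X.pat ([c1, c2, w1, w2] ! g) ([x3, s3, x2, s2] ! h) m {0, w} (1, r)"
      if "g < length [6, 6, 3, 3 :: nat]" "h < length [6, 3, 6, 3 :: nat]" for g h
    proof -
      have "g = 0 \<or> g = 1 \<or> g = 2 \<or> g = 3" "h = 0 \<or> h = 1 \<or> h = 2 \<or> h = 3" using that by auto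
      then show ?thesis using L by (elim disjE) (simp_all add: table2_def)
    qed
  qed
qed

lemma classification:
  "\<exists>vs. distinct vs \<and> set vs = V \<and> length vs = 36 \<and>
    ((\<forall>i<36. \<forall>j<36. E (vs ! i) (vs ! j) \<longleftrightarrow> cyclic_adj table1 cycles1 cycles1 i j) \<or>
     (\<forall>i<36. \<forall>j<36. E (vs ! i) (vs ! j) \<longleftrightarrow> cyclic_adj table2 [6, 6, 3, 3] [6, 3, 6, 3] i j))"
  using X.all_or_few_tris tri_case hex_case by metis

end

section \<open>Isomorphisms and the final count\<close>

text \<open>Arcs are pairs of vertices, with the projections as tail and head on both sides; so the
  arc map of an isomorphism is determined by its vertex map.\<close>

lemma digraph_iso_iff_bij:
  assumes "pair_graph G" "pair_graph H"
  shows "digraph_iso (with_proj G) (with_proj H) \<longleftrightarrow>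
    (\<exists>h. bij_betw h (pverts G) (pverts H) \<and>
      (\<forall>u\<in>pverts G. \<forall>v\<in>pverts G. (u, v) \<in> parcs G \<longleftrightarrow> (h u, h v) \<in> parcs H))"
proof
  interpret G: pair_graph G by (rule assms(1))
  assume "digraph_iso (with_proj G) (with_proj H)"
  then obtain f where f: "pre_digraph.digraph_isomorphism (with_proj G) f" "with_proj H = app_iso f (with_proj G)"
    unfolding digraph_iso_def by blast
  define h where "h = iso_verts f"
  have v: "pverts H = h ` pverts G" and a: "parcs H = iso_arcs f ` parcs G"
    and t: "fst = iso_tail f" and hd: "snd = iso_head f"
    using arg_cong[OF f(2), of verts] arg_cong[OF f(2), of arcs] arg_cong[OF f(2), of tail] arg_cong[OF f(2), of head]
    by (simp_all add: h_def)
  have inj: "inj_on h (pverts G)"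
    and ends: "\<And>e. e \<in> parcs G \<Longrightarrow> h (fst e) = fst (iso_arcs f e) \<and> h (snd e) = snd (iso_arcs f e)"
    using f(1) unfolding pre_digraph.digraph_isomorphism_def h_def by (simp_all add: t hd)
  have fwd: "(h u, h v) \<in> parcs H" if "(u, v) \<in> parcs G" for u v
    using ends[OF that] that unfolding a by (metis fst_conv image_eqI prod.collapse snd_conv)
  have bwd: "(u, v) \<in> parcs G" if uv: "u \<in> pverts G" "v \<in> pverts G" and h: "(h u, h v) \<in> parcs H" for u v
  proof -
    obtain e where e: "e \<in> parcs G" "(h u, h v) = iso_arcs f e" using h unfolding a by blast
    then have "h (fst e) = h u" "h (snd e) = h v" using ends[OF e(1)] by (metis fst_conv, metis snd_conv)
    then have "fst e = u" "snd e = v"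
      using inj uv G.arc_fst_in_verts[OF e(1)] G.arc_snd_in_verts[OF e(1)] by (auto dest: inj_onD)
    then show ?thesis using e(1) by auto
  qed
  show "\<exists>h. bij_betw h (pverts G) (pverts H) \<and>
      (\<forall>u\<in>pverts G. \<forall>v\<in>pverts G. (u, v) \<in> parcs G \<longleftrightarrow> (h u, h v) \<in> parcs H)"
    using inj v fwd bwd by (intro exI[of _ h]) (auto simp: bij_betw_def)
next
  interpret G: pair_graph G by (rule assms(1))
  interpret H: pair_graph H by (rule assms(2))
  assume "\<exists>h. bij_betw h (pverts G) (pverts H) \<and>
      (\<forall>u\<in>pverts G. \<forall>v\<in>pverts G. (u, v) \<in> parcs G \<longleftrightarrow> (h u, h v) \<in> parcs H)"
  then obtain h where h: "bij_betw h (pverts G) (pverts H)"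
    "\<And>u v. u \<in> pverts G \<Longrightarrow> v \<in> pverts G \<Longrightarrow> (u, v) \<in> parcs G \<longleftrightarrow> (h u, h v) \<in> parcs H" by blast
  define f where "f = \<lparr>iso_verts = h, iso_arcs = map_prod h h, iso_head = snd, iso_tail = fst\<rparr>"
  have inj: "inj_on h (pverts G)" and im: "h ` pverts G = pverts H" using h(1) by (auto simp: bij_betw_def)
  have "inj_on (map_prod h h) (parcs G)"
  proof (rule inj_on_subset[OF map_prod_inj_on[OF inj inj]])
    show "parcs G \<subseteq> pverts G \<times> pverts G"
    proof
      fix e assume e: "e \<in> parcs G"
      show "e \<in> pverts G \<times> pverts G"
        using G.arc_fst_in_verts[OF e] G.arc_snd_in_verts[OF e] by (simp add: mem_Times_iff)
    qed
  qed
  then have 1: "pre_digraph.digraph_isomorphism (with_proj G) f"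
    using inj G.wf_digraph_axioms by (simp add: pre_digraph.digraph_isomorphism_def f_def)
  have "parcs H = map_prod h h ` parcs G"
  proof (intro equalityI subsetI)
    fix e assume e: "e \<in> parcs H"
    then obtain u v where uv: "u \<in> pverts G" "v \<in> pverts G" "e = (h u, h v)"
      using im H.arc_fst_in_verts[OF e] H.arc_snd_in_verts[OF e] by (metis imageE prod.collapse)
    then have "(u, v) \<in> parcs G" using h(2) e by simp
    then show "e \<in> map_prod h h ` parcs G" using uv(3) by force
  next
    fix e assume "e \<in> map_prod h h ` parcs G"
    then obtain u v where "(u, v) \<in> parcs G" "e = (h u, h v)" by auto
    then show "e \<in> parcs H" using h(2) G.in_arcsD1 G.in_arcsD2 by blast
  qed
  then have "with_proj H = app_iso f (with_proj G)"
    using im by (simp add: with_proj_def app_iso_def f_def)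
  then show "digraph_iso (with_proj G) (with_proj H)"
    using 1 unfolding digraph_iso_def by blast
qed

definition cyclic_graph :: "(int \<times> int \<times> int) list list \<Rightarrow> nat list \<Rightarrow> nat list \<Rightarrow> nat pair_pre_digraph" where
  "cyclic_graph T np nb = \<lparr>pverts = {..<36}, parcs = {(i, j). i < 36 \<and> j < 36 \<and> cyclic_adj T np nb i j}\<rparr>"

lemma cyclic_graph_simps [simp]:
  "pverts (cyclic_graph T np nb) = {..<36}"
  "(i, j) \<in> parcs (cyclic_graph T np nb) \<longleftrightarrow> i < 36 \<and> j < 36 \<and> cyclic_adj T np nb i j"
  by (simp_all add: cyclic_graph_def)

lemma check_rowsD:
  assumes chk: "check_rows (adj_rows f)" and ij: "i < 36" "j < 36"
  shows "\<not> f i i" "f i j = f j i"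
    "card {k. k < 36 \<and> f i k \<and> f k j} + of_bool (f i j) = 2 * class_weight i * class_weight j + (if i = j then 6 else 0)"
proof -
  have nth: "adj_rows f ! k = map (f k) [0..<36]" if "k < 36" for k using that by (simp add: adj_rows_def)
  have len: "length (adj_rows f) = 36" by (simp add: adj_rows_def)
  have mem: "(k, map (f k) [0..<36]) \<in> set (List.enumerate 0 (adj_rows f))" if "k < 36" for k
    using that nth[OF that] len by (simp add: in_set_enumerate_eq)
  have row: "\<not> f i i \<and> (\<forall>(j, s)\<in>set (List.enumerate 0 (adj_rows f)). map (f i) [0..<36] ! j = s ! i \<and>
     common (map (f i) [0..<36]) s + (if map (f i) [0..<36] ! j then 1 else 0) = 2 * class_weight i * class_weight j + (if i = j then 6 else 0))"
    if "i < 36" for i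
    using chk mem[OF that] that unfolding check_rows_def list_all_iff by fastforce
  show "\<not> f i i" using row[OF ij(1)] by blast
  have entry: "f i j = f j i \<and> common (map (f i) [0..<36]) (map (f j) [0..<36]) + (if f i j then 1 else 0)
      = 2 * class_weight i * class_weight j + (if i = j then 6 else 0)" if "i < 36" "j < 36" for i j
    using row[OF that(1)] mem[OF that(2)] that by fastforce
  show "f i j = f j i" using entry[OF ij] by blast
  have "common (map (f i) [0..<36]) (map (f j) [0..<36]) = card {k \<in> set [0..<36]. f i k \<and> f j k}"
    by (rule common_map) simp
  also have "{k \<in> set [0..<36]. f i k \<and> f j k} = {k. k < 36 \<and> f i k \<and> f k j}"
    using entry ij(2) by auto
  finally show "card {k. k < 36 \<and> f i k \<and> f k j} + of_bool (f i j) = 2 * class_weight i * class_weight j + (if i = j then 6 else 0)"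
    using conjunct2[OF entry[OF ij]] by (simp only: of_bool_def)
qed

text \<open>The characteristic polynomial is never computed: valencies and spectrum follow from the
  common neighbours verified by \<open>check_rows\<close>.\<close>

lemma cyclic_graph_facts:
  assumes chk: "check_rows (adj_rows (cyclic_adj T np nb))"
  defines "G \<equiv> cyclic_graph T np nb"
  shows "pair_graph G" "three_valency_graph (pverts G) (\<lambda>u v. (u, v) \<in> parcs G) class_weight"
    "has_valency_array G [18, 9, 9] [24, 14, 8]"
    "graph_spectrum G = replicate_mset 1 20 + replicate_mset 17 2 + replicate_mset 18 (- 3)"
proof -
  note C = check_rowsD[OF chk]
  have fin: "finite (parcs G)"
    by (rule finite_subset[of _ "{..<36} \<times> {..<36}"]) (auto simp: G_def)
  show pg: "pair_graph G"
    by unfold_locales (use fin C(1,2) in \<open>auto simp: G_def symmetric_def intro!: symI\<close>)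
  interpret pair_graph G by (rule pg)
  have cards: "card {u \<in> {..<36}. class_weight u = 1} = 9" "card {u \<in> {..<36}. class_weight u = 2} = 9"
    "card {u \<in> {..<36}. class_weight u = 3} = 18"
  proof -
    have "{u \<in> {..<36}. class_weight u = 1} = {18..<27}" "{u \<in> {..<36}. class_weight u = 2} = {27..<36}"
      "{u \<in> {..<36}. class_weight u = 3} = {..<18}"
      by (auto simp: class_weight_def)
    then show "card {u \<in> {..<36}. class_weight u = 1} = 9" "card {u \<in> {..<36}. class_weight u = 2} = 9"
      "card {u \<in> {..<36}. class_weight u = 3} = 18" by simp_all
  qed
  have nbs: "{w. (u, w) \<in> parcs G \<and> (w, v) \<in> parcs G} = {k. k < 36 \<and> cyclic_adj T np nb u k \<and> cyclic_adj T np nb k v}"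
    if "u < 36" "v < 36" for u v
    using that by (auto simp: G_def)
  show tv: "three_valency_graph (pverts G) (\<lambda>u v. (u, v) \<in> parcs G) class_weight"
  proof
    show "finite (pverts G)" by (simp add: G_def)
    show "u \<in> pverts G" if "(u, v) \<in> parcs G" for u v using that by (rule in_arcsD1)
    show "(v, u) \<in> parcs G" if "(u, v) \<in> parcs G" for u v using that by (rule arcs_sym)
    show "(u, u) \<notin> parcs G" for u by (rule arcs_irrefl)
    show "class_weight u \<in> {1, 2, 3}" for u by (simp add: class_weight_def)
    show "card {u \<in> pverts G. class_weight u = 1} = 9" "card {u \<in> pverts G. class_weight u = 2} = 9"
      "card {u \<in> pverts G. class_weight u = 3} = 18" using cards by (simp_all add: G_def)
    show "card {v. (u, v) \<in> parcs G} = 2 * (class_weight u)\<^sup>2 + 6" if "u \<in> pverts G" for u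
    proof -
      have u: "u < 36" using that by (simp add: G_def)
      have "card {v. (u, v) \<in> parcs G} = card {k. k < 36 \<and> cyclic_adj T np nb u k \<and> cyclic_adj T np nb k u}"
        using nbs[OF u u] nbs_two_paths[of u] by simp
      then show ?thesis using C(1)[OF u u] C(3)[OF u u] by (simp add: power2_eq_square)
    qed
    show "card {w. (u, w) \<in> parcs G \<and> (w, v) \<in> parcs G} + of_bool ((u, v) \<in> parcs G) = 2 * class_weight u * class_weight v"
      if "u \<in> pverts G" "v \<in> pverts G" "u \<noteq> v" for u v
    proof -
      have uv: "u < 36" "v < 36" using that by (simp_all add: G_def)
      then have "of_bool ((u, v) \<in> parcs G) = (of_bool (cyclic_adj T np nb u v) :: nat)" by (simp add: G_def)
      then show ?thesis using nbs[OF uv] C(3)[OF uv] that(3) by simp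
    qed
  qed
  show "has_valency_array G [18, 9, 9] [24, 14, 8]"
    "graph_spectrum G = replicate_mset 1 20 + replicate_mset 17 2 + replicate_mset 18 (- 3)"
    by (rule spectrum_of_three_valency_graph[OF tv])+
qed

lemma bij_card_nbs:
  assumes "pair_graph G" "pair_graph H" "bij_betw h (pverts G) (pverts H)"
    and arcs: "\<And>u v. u \<in> pverts G \<Longrightarrow> v \<in> pverts G \<Longrightarrow> (u, v) \<in> parcs G \<longleftrightarrow> (h u, h v) \<in> parcs H"
    and u: "u \<in> pverts G"
  shows "card {w. (h u, w) \<in> parcs H} = card {w. (u, w) \<in> parcs G}"
proof -
  interpret G: pair_graph G by (rule assms(1))
  interpret H: pair_graph H by (rule assms(2))
  have inj: "inj_on h (pverts G)" and im: "h ` pverts G = pverts H" using assms(3) by (auto simp: bij_betw_def)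
  have "{w. (h u, w) \<in> parcs H} = h ` {w. (u, w) \<in> parcs G}"
  proof (intro equalityI subsetI)
    fix w assume w: "w \<in> {w. (h u, w) \<in> parcs H}"
    then have "w \<in> pverts H" using H.in_arcsD2 by blast
    then obtain v where "v \<in> pverts G" "w = h v" using im by blast
    then show "w \<in> h ` {w. (u, w) \<in> parcs G}" using w arcs u by blast
  next
    fix w assume "w \<in> h ` {w. (u, w) \<in> parcs G}"
    then show "w \<in> {w. (h u, w) \<in> parcs H}" using arcs u G.in_arcsD2 by blast
  qed
  moreover have "inj_on h {w. (u, w) \<in> parcs G}"
    using inj by (rule inj_on_subset) (use G.in_arcsD2 in blast)
  ultimately show ?thesis by (simp add: card_image)
qed

lemma cyclic_graphs_not_iso:
  "\<not> digraph_iso (with_proj (cyclic_graph table1 cycles1 cycles1))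
     (with_proj (cyclic_graph table2 [6, 6, 3, 3] [6, 3, 6, 3]))"
proof
  define G1 where "G1 = cyclic_graph table1 cycles1 cycles1"
  define G2 where "G2 = cyclic_graph table2 [6, 6, 3, 3] [6, 3, 6, 3]"
  note F1 = cyclic_graph_facts[OF check1[unfolded Let_def], folded G1_def]
  note F2 = cyclic_graph_facts[OF check2[unfolded Let_def], folded G2_def]
  assume "digraph_iso (with_proj (cyclic_graph table1 cycles1 cycles1))
     (with_proj (cyclic_graph table2 [6, 6, 3, 3] [6, 3, 6, 3]))"
  then obtain h where bij: "bij_betw h (pverts G1) (pverts G2)"
    and arcs: "\<And>u v. u \<in> pverts G1 \<Longrightarrow> v \<in> pverts G1 \<Longrightarrow> (u, v) \<in> parcs G1 \<longleftrightarrow> (h u, h v) \<in> parcs G2"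
    using digraph_iso_iff_bij[OF F1(1) F2(1)] unfolding G1_def G2_def by blast
  \<comment> \<open>An isomorphism preserves valencies, so vertices of valency 8 come from vertices
    of valency 8.\<close>
  have low: "\<exists>u\<in>{18..<27}. h u = x" if x: "x \<in> {18..<27}" for x
  proof -
    have "x \<in> pverts G2" using x by (simp add: G2_def)
    then have "x \<in> h ` pverts G1" using bij by (simp add: bij_betw_def)
    then obtain u where u: "u \<in> pverts G1" "h u = x" by blast
    have "2 * (class_weight x)\<^sup>2 + 6 = 2 * (class_weight u)\<^sup>2 + 6"
      using bij_card_nbs[OF F1(1) F2(1) bij arcs u(1)] three_valency_graph.degree[OF F1(2) u(1)]
        three_valency_graph.degree[OF F2(2) \<open>x \<in> pverts G2\<close>] u(2) by simp
    moreover have "class_weight x = 1" using x by (simp add: class_weight_def)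
    ultimately have "(class_weight u)\<^sup>2 = 1" by simp
    moreover have "class_weight u = 1 \<or> class_weight u = 2 \<or> class_weight u = 3" by (simp add: class_weight_def)
    ultimately have "class_weight u = 1" by (elim disjE) simp_all
    then have "u \<in> {18..<27}" using u(1) by (simp add: class_weight_def G1_def split: if_splits)
    then show ?thesis using u(2) by blast
  qed
  obtain i j k where ijk: "i \<in> {18..<27}" "h i = 18" "j \<in> {18..<27}" "h j = 19" "k \<in> {18..<27}" "h k = 20"
    using low[of 18] low[of 19] low[of 20] by auto
  have V: "i \<in> pverts G1" "j \<in> pverts G1" "k \<in> pverts G1" using ijk by (simp_all add: G1_def)
  have P: "(i, j) \<in> parcs G1" "(j, k) \<in> parcs G1" "(i, k) \<notin> parcs G1"
    using arcs[OF V(1,2)] arcs[OF V(2,3)] arcs[OF V(1,3)] low_not_transitive2 by (simp_all add: ijk G2_def)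
  have ne: "i \<noteq> k" using ijk(2,6) by auto
  have "i = k \<or> \<not> cyclic_adj table1 cycles1 cycles1 i j \<or> \<not> cyclic_adj table1 cycles1 cycles1 j k \<or>
      cyclic_adj table1 cycles1 cycles1 i k"
    using low_transitive1 ijk(1,3,5) unfolding list_all_iff set_upt by blast
  moreover have "cyclic_adj table1 cycles1 cycles1 i j" "cyclic_adj table1 cycles1 cycles1 j k"
    "\<not> cyclic_adj table1 cycles1 cycles1 i k"
    using P V unfolding G1_def cyclic_graph_simps by blast+
  ultimately show False using ne by blast
qed

lemma iso_of_enumeration:
  assumes H: "pair_graph H" and G: "pair_graph (cyclic_graph T np nb)"
    and vs: "distinct vs" "set vs = pverts H" "length vs = 36"
    and adj: "\<forall>i<36. \<forall>j<36. (vs ! i, vs ! j) \<in> parcs H \<longleftrightarrow> cyclic_adj T np nb i j"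
  shows "digraph_iso (with_proj H) (with_proj (cyclic_graph T np nb))"
proof -
  have "bij_betw (\<lambda>i. vs ! i) {..<36} (pverts H)"
    using bij_betw_nth[OF vs(1), of "{..<36}" "pverts H"] vs by simp
  then have "digraph_iso (with_proj (cyclic_graph T np nb)) (with_proj H)"
    unfolding digraph_iso_iff_bij[OF G H] using adj by (intro exI[of _ "\<lambda>i. vs ! i"]) simp
  moreover interpret pair_graph "cyclic_graph T np nb" by (rule G)
  have "wf_digraph (with_proj (cyclic_graph T np nb))" by (rule wf_digraph_axioms)
  ultimately show ?thesis by (rule digraph_iso_swap[rotated])
qed

theorem theorem7p3:
  shows "\<exists>G1 G2 :: nat pair_pre_digraph.
    (\<forall>G \<in> {G1, G2}. pair_graph G \<and> has_valency_array G [18, 9, 9] [24, 14, 8] \<and>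
       graph_spectrum G =
         replicate_mset 1 20 + replicate_mset 17 2 + replicate_mset 18 (- 3)) \<and>
    \<not> digraph_iso (with_proj G1) (with_proj G2) \<and>
    (\<forall>H :: 'a pair_pre_digraph.
       pair_graph H \<and> has_valency_array H [18, 9, 9] [24, 14, 8] \<and>
       graph_spectrum H =
         replicate_mset 1 20 + replicate_mset 17 2 + replicate_mset 18 (- 3) \<longrightarrow>
       digraph_iso (with_proj H) (with_proj G1) \<or> digraph_iso (with_proj H) (with_proj G2))"
proof -
  define G1 where "G1 = cyclic_graph table1 cycles1 cycles1"
  define G2 where "G2 = cyclic_graph table2 [6, 6, 3, 3] [6, 3, 6, 3]"
  note F1 = cyclic_graph_facts[OF check1[unfolded Let_def], folded G1_def]
  note F2 = cyclic_graph_facts[OF check2[unfolded Let_def], folded G2_def]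
  have uniq: "digraph_iso (with_proj H) (with_proj G1) \<or> digraph_iso (with_proj H) (with_proj G2)"
    if pg: "pair_graph H" and va: "has_valency_array H [18, 9, 9] [24, 14, 8]"
      and sp: "graph_spectrum H = replicate_mset 1 20 + replicate_mset 17 2 + replicate_mset 18 (- 3)"
    for H :: "'a pair_pre_digraph"
  proof -
    obtain vs where vs: "distinct vs" "set vs = pverts H" "length vs = 36"
      and adj: "(\<forall>i<36. \<forall>j<36. (vs ! i, vs ! j) \<in> parcs H \<longleftrightarrow> cyclic_adj table1 cycles1 cycles1 i j) \<or>
        (\<forall>i<36. \<forall>j<36. (vs ! i, vs ! j) \<in> parcs H \<longleftrightarrow> cyclic_adj table2 [6, 6, 3, 3] [6, 3, 6, 3] i j)"
      using three_valency_graph.classification[OF pair_graph.three_valency_graph_of_spectrum[OF pg va sp]]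
      by blast
    from adj show ?thesis
    proof
      assume *: "\<forall>i<36. \<forall>j<36. (vs ! i, vs ! j) \<in> parcs H \<longleftrightarrow> cyclic_adj table1 cycles1 cycles1 i j"
      from iso_of_enumeration[OF pg F1(1)[unfolded G1_def] vs *] show ?thesis
        unfolding G1_def[symmetric] by (rule disjI1)
    next
      assume *: "\<forall>i<36. \<forall>j<36. (vs ! i, vs ! j) \<in> parcs H \<longleftrightarrow> cyclic_adj table2 [6, 6, 3, 3] [6, 3, 6, 3] i j"
      from iso_of_enumeration[OF pg F2(1)[unfolded G2_def] vs *] show ?thesis
        unfolding G2_def[symmetric] by (rule disjI2)
    qed
  qed
  show ?thesis
  proof (rule exI[of _ G1], rule exI[of _ G2], intro conjI)
    show "\<forall>G\<in>{G1, G2}. pair_graph G \<and> has_valency_array G [18, 9, 9] [24, 14, 8] \<and>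
        graph_spectrum G = replicate_mset 1 20 + replicate_mset 17 2 + replicate_mset 18 (- 3)"
      using F1(1,3,4) F2(1,3,4) by (blast | auto)
    show "\<not> digraph_iso (with_proj G1) (with_proj G2)"
      unfolding G1_def G2_def by (rule cyclic_graphs_not_iso)
    show "\<forall>H :: 'a pair_pre_digraph. pair_graph H \<and> has_valency_array H [18, 9, 9] [24, 14, 8] \<and>
        graph_spectrum H = replicate_mset 1 20 + replicate_mset 17 2 + replicate_mset 18 (- 3) \<longrightarrow>
        digraph_iso (with_proj H) (with_proj G1) \<or> digraph_iso (with_proj H) (with_proj G2)"
      using uniq by blast
  qed
qed

end
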